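(* Let $S$ be a finite, degree independent set of dominant rational self-maps of $\mathbb{P}^N$, let $\nu$ be a probability measure on $S$, and let $(\Phi_S,\bar{\nu})$ be the space of i.i.d. sequences of elements of $S$ distributed according to $\nu$. Then for all $P\in\mathbb{P}^N(\overline{\mathbb{Q}})_S$, \[\limsup_{n\to\infty}h(\gamma_n(P))^{1/n}\leq\delta_{S,\nu}\] for $\bar\nu$-almost every $\gamma\in\Phi_S$.
   Context: $\Phi_S=\prod_{i=1}^\infty S$ with product measure $\bar\nu$. For $\gamma=(\theta_1,\theta_2,\dots)\in\Phi_S$, $\gamma_n=\theta_n\circ\cdots\circ\theta_1$. $S$ is degree independent if $\deg(\theta_k\circ\cdots\circ\theta_1)\geq2$ for all $k\geq1$ and all $(\theta_1,\dots,\theta_k)\in S^k$. For $\phi\in S$, $I_\phi$ is the indeterminacy locus of $\phi$, $I_S=\bigcup_{\phi\in S}I_\phi$, and $\mathbb{P}^N(\overline{\mathbb{Q}})_S$ is the set of $P\in\mathbb{P}^N(\overline{\mathbb{Q}})$ such that $\{P,\gamma_1(P),\gamma_2(P),\dots\}\cap I_S=\varnothing$ for every $\gamma\in\Phi_S$. $h$ is the absolute Weil height on $\mathbb{P}^N(\overline{\mathbb{Q}})$. The dynamical degree is $\delta_{S,\nu}=\exp\big(\inf_{n\geq1}\mathbb{E}_n[\log\deg(\gamma_n)]/n\big)$, where $\mathbb{E}_n$ is expectation over $(\theta_1,\dots,\theta_n)\in S^n$ with respect to $\nu^n$. *)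

theory Defs
  imports "HOL-Probability.Probability" "HOL-Computational_Algebra.Polynomial"
          "HOL-Library.Poly_Mapping"
begin

type_synonym mpoly = "(nat \<Rightarrow>\<^sub>0 nat) \<Rightarrow>\<^sub>0 complex"

definition mp_eval :: "mpoly \<Rightarrow> (nat \<Rightarrow> complex) \<Rightarrow> complex" where
  "mp_eval p x = (\<Sum>m\<in>Poly_Mapping.keys p. Poly_Mapping.lookup p m * (\<Prod>i\<in>Poly_Mapping.keys m. x i ^ Poly_Mapping.lookup m (i::nat)))"

definition mp_const :: "complex \<Rightarrow> mpoly" where
  "mp_const c = Poly_Mapping.single 0 c"

definition mp_var :: "nat \<Rightarrow> mpoly" where
  "mp_var i = Poly_Mapping.single (Poly_Mapping.single i 1) 1"

definition mp_subst :: "mpoly \<Rightarrow> (nat \<Rightarrow> mpoly) \<Rightarrow> mpoly" where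
  "mp_subst p F = (\<Sum>m\<in>Poly_Mapping.keys p. mp_const (Poly_Mapping.lookup p m) * (\<Prod>i\<in>Poly_Mapping.keys m. F i ^ Poly_Mapping.lookup m i))"

definition mon_deg :: "(nat \<Rightarrow>\<^sub>0 nat) \<Rightarrow> nat" where
  "mon_deg m = (\<Sum>i\<in>Poly_Mapping.keys m. Poly_Mapping.lookup m i)"

text \<open>p is a homogeneous polynomial of degree d in X_0..X_N with algebraic coefficients
  (the zero polynomial is homogeneous of every degree).\<close>
definition hom_poly :: "nat \<Rightarrow> nat \<Rightarrow> mpoly \<Rightarrow> bool" where
  "hom_poly N d p \<longleftrightarrow> (\<forall>m\<in>Poly_Mapping.keys p. mon_deg m = d \<and> Poly_Mapping.keys m \<subseteq> {0..N} \<and> algebraic (Poly_Mapping.lookup p m))"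

definition hom_tuple :: "nat \<Rightarrow> nat \<Rightarrow> (nat \<Rightarrow> mpoly) \<Rightarrow> bool" where
  "hom_tuple N d F \<longleftrightarrow> (\<forall>i\<le>N. hom_poly N d (F i)) \<and> (\<exists>i\<le>N. F i \<noteq> 0) \<and> (\<forall>i>N. F i = 0)"

definition rat_map :: "nat \<Rightarrow> (nat \<Rightarrow> mpoly) \<Rightarrow> bool" where
  "rat_map N F \<longleftrightarrow> (\<exists>d. hom_tuple N d F)"

text \<open>G is a representative of degree d of the rational map given by F:
  [G_0 : ... : G_N] = [F_0 : ... : F_N] as rational maps.\<close>
definition rep_of :: "nat \<Rightarrow> (nat \<Rightarrow> mpoly) \<Rightarrow> nat \<Rightarrow> (nat \<Rightarrow> mpoly) \<Rightarrow> bool" where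
  "rep_of N F d G \<longleftrightarrow> hom_tuple N d G \<and> (\<forall>i\<le>N. \<forall>j\<le>N. G i * F j = G j * F i)"

text \<open>Degree of a rational map: minimal degree of a representing tuple
  (= degree of the representative with coprime coordinates).\<close>
definition rat_deg :: "nat \<Rightarrow> (nat \<Rightarrow> mpoly) \<Rightarrow> nat" where
  "rat_deg N F = (LEAST d. \<exists>G. rep_of N F d G)"

text \<open>Dominance: the image is not contained in any hypersurface.\<close>
definition dominant :: "nat \<Rightarrow> (nat \<Rightarrow> mpoly) \<Rightarrow> bool" where
  "dominant N F \<longleftrightarrow> (\<forall>Q. Q \<noteq> 0 \<longrightarrow> (\<forall>m\<in>Poly_Mapping.keys Q. Poly_Mapping.keys m \<subseteq> {0..N}) \<longrightarrow> mp_subst Q F \<noteq> 0)"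

definition rm_comp :: "nat \<Rightarrow> (nat \<Rightarrow> mpoly) \<Rightarrow> (nat \<Rightarrow> mpoly) \<Rightarrow> (nat \<Rightarrow> mpoly)" where
  "rm_comp N G F = (\<lambda>i. if i \<le> N then mp_subst (G i) F else 0)"

definition rm_id :: "nat \<Rightarrow> (nat \<Rightarrow> mpoly)" where
  "rm_id N = (\<lambda>i. if i \<le> N then mp_var i else 0)"

definition comp_list :: "nat \<Rightarrow> (nat \<Rightarrow> mpoly) list \<Rightarrow> (nat \<Rightarrow> mpoly)" where
  "comp_list N ts = foldl (\<lambda>F t. rm_comp N t F) (rm_id N) ts"

text \<open>Points are given by homogeneous coordinate vectors (x_0,...,x_N), extended by 0.\<close>
definition proj_pt :: "nat \<Rightarrow> (nat \<Rightarrow> complex) \<Rightarrow> bool" where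
  "proj_pt N x \<longleftrightarrow> (\<forall>i. algebraic (x i)) \<and> (\<exists>i\<le>N. x i \<noteq> 0) \<and> (\<forall>i>N. x i = 0)"

definition indet :: "nat \<Rightarrow> (nat \<Rightarrow> mpoly) \<Rightarrow> (nat \<Rightarrow> complex) \<Rightarrow> bool" where
  "indet N F x \<longleftrightarrow> (\<forall>d G. rep_of N F d G \<longrightarrow> (\<forall>i\<le>N. mp_eval (G i) x = 0))"

definition rm_apply :: "nat \<Rightarrow> (nat \<Rightarrow> mpoly) \<Rightarrow> (nat \<Rightarrow> complex) \<Rightarrow> (nat \<Rightarrow> complex)" where
  "rm_apply N F x =
     (let G = (SOME G. \<exists>d. rep_of N F d G \<and> (\<exists>i\<le>N. mp_eval (G i) x \<noteq> 0))
      in (\<lambda>i. if i \<le> N then mp_eval (G i) x else 0))"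

text \<open>orbit N g x n = gamma_n(x) where gamma_n = g (n-1) \<circ> ... \<circ> g 0,
  i.e. g i is theta_(i+1).\<close>
primrec orbit :: "nat \<Rightarrow> (nat \<Rightarrow> (nat \<Rightarrow> mpoly)) \<Rightarrow> (nat \<Rightarrow> complex) \<Rightarrow> nat \<Rightarrow> (nat \<Rightarrow> complex)" where
  "orbit N g x 0 = x"
| "orbit N g x (Suc n) = rm_apply N (g n) (orbit N g x n)"

definition good_pts :: "nat \<Rightarrow> (nat \<Rightarrow> mpoly) set \<Rightarrow> (nat \<Rightarrow> complex) set" where
  "good_pts N S = {x. proj_pt N x \<and>
     (\<forall>g. range g \<subseteq> S \<longrightarrow> (\<forall>n. \<forall>\<phi>\<in>S. \<not> indet N \<phi> (orbit N g x n)))}"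

definition subfield_C :: "complex set \<Rightarrow> bool" where
  "subfield_C K \<longleftrightarrow> 1 \<in> K \<and> (\<forall>a\<in>K. \<forall>b\<in>K. a + b \<in> K \<and> a - b \<in> K \<and> a * b \<in> K)
                   \<and> (\<forall>a\<in>K. inverse a \<in> K)"

definition gen_field :: "complex set \<Rightarrow> complex set" where
  "gen_field A = \<Inter>{K. subfield_C K \<and> A \<subseteq> K}"

text \<open>Field embeddings K \<rightarrow> C (made extensional); there are [K:Q] of them.\<close>
definition embeddings :: "complex set \<Rightarrow> (complex \<Rightarrow> complex) set" where
  "embeddings K = {\<sigma>. (\<forall>a\<in>K. \<forall>b\<in>K. \<sigma> (a + b) = \<sigma> a + \<sigma> b \<and> \<sigma> (a * b) = \<sigma> a * \<sigma> b)
                      \<and> \<sigma> 1 = 1 \<and> (\<forall>a. a \<notin> K \<longrightarrow> \<sigma> a = 0)}"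

definition ring_of_integers :: "complex set \<Rightarrow> complex set" where
  "ring_of_integers K = {a\<in>K. algebraic_int a}"

text \<open>Absolute norm of the ideal of O_K generated by x_0,...,x_N (all algebraic integers):
  the index [O_K : I].\<close>
definition ideal_norm :: "complex set \<Rightarrow> nat \<Rightarrow> (nat \<Rightarrow> complex) \<Rightarrow> nat" where
  "ideal_norm K N x =
     (let OK = ring_of_integers K;
          I = {\<Sum>i\<le>N. a i * x i | a. \<forall>i\<le>N. a i \<in> OK}
      in card ((\<lambda>b. {b + c | c. c \<in> I}) ` OK))"

text \<open>Height of a point with algebraic-integer coordinates, via the product formula
  decomposition: archimedean places = complex embeddings, non-archimedean part =
  - log of the norm of the ideal generated by the coordinates.\<close>
definition height_int :: "nat \<Rightarrow> (nat \<Rightarrow> complex) \<Rightarrow> real" where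
  "height_int N x =
     (let K = gen_field (x ` {0..N}); E = embeddings K
      in ((\<Sum>\<sigma>\<in>E. ln (Max ((\<lambda>i. cmod (\<sigma> (x i))) ` {0..N}))) - ln (real (ideal_norm K N x)))
         / real (card E))"

text \<open>Absolute logarithmic Weil height of the point [x_0 : ... : x_N]; scale by a positive
  integer to make coordinates algebraic integers (result independent of the choice).\<close>
definition weil_height :: "nat \<Rightarrow> (nat \<Rightarrow> complex) \<Rightarrow> real" where
  "weil_height N x =
     (let c = (SOME c::nat. c > 0 \<and> (\<forall>i. algebraic_int (of_nat c * x i)))
      in height_int N (\<lambda>i. of_nat c * x i))"

definition degree_independent :: "nat \<Rightarrow> (nat \<Rightarrow> mpoly) set \<Rightarrow> bool" where
  "degree_independent N S \<longleftrightarrow>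
     (\<forall>ts. ts \<noteq> [] \<longrightarrow> set ts \<subseteq> S \<longrightarrow> rat_deg N (comp_list N ts) \<ge> 2)"

definition exp_log_deg :: "nat \<Rightarrow> (nat \<Rightarrow> mpoly) set \<Rightarrow> (nat \<Rightarrow> mpoly) pmf \<Rightarrow> nat \<Rightarrow> real" where
  "exp_log_deg N S \<nu> n =
     (\<Sum>ts\<in>{ts. set ts \<subseteq> S \<and> length ts = n}.
        (\<Prod>i<n. pmf \<nu> (ts ! i)) * ln (real (rat_deg N (comp_list N ts))))"

definition dyn_degree :: "nat \<Rightarrow> (nat \<Rightarrow> mpoly) set \<Rightarrow> (nat \<Rightarrow> mpoly) pmf \<Rightarrow> real" where
  "dyn_degree N S \<nu> = exp (INF n\<in>{1..}. exp_log_deg N S \<nu> n / real n)"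

end

(* A representative of minimal degree of a composition cannot vanish at a point where the factors are defined
   one after the other, because polynomial rings are factorial.  Hence h(g(Q)) + C <= deg(g) (h(Q) + C) along the
   orbit for the finitely many compositions g of m maps, the degree being at least 2, and h(gamma_n(P)) is at most
   a constant times the product of the degrees of consecutive blocks of length m.  By the strong law of large
   numbers the n-th root of this product is at most exp(E_m[log deg] / m) in the limit, and one takes the
   infimum over m.

   To get by without valuations, the height of (x_0 : ... : x_N) with integral coordinates in a number field is
   computed from the norm form prod_s (s(x_0) + s(x_1) T + ... + s(x_N) T^N) in Z[T], whose content stands for the
   non-archimedean part: it scales correctly by Gauss' lemma, and Kronecker's lemma bounds the height of a
   polynomial image.  The content is at most the norm of the ideal (x_0, ..., x_N), so this height dominates
   the Weil height. *)

theory Submission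
  imports Defs "Jordan_Normal_Form.Char_Poly" "HOL-Computational_Algebra.Field_as_Ring"
begin

section \<open>Gauss' lemma for subrings of a domain\<close>

text \<open>Blocks are forced by the fact that a composition may have smaller degree than the
  product of the degrees of its factors: estimating one map at a time would only reach E_1[log deg].
  For fixed m the compositions of length at most m are finitely many, so one C serves them all, and
  deg >= 2 gives C + C <= deg * C; thus the error of every block is absorbed and the block
  inequalities multiply without a remainder.

  The Weil height of each iterate refers to the field generated by its own coordinates, which
  changes along the orbit, whereas the estimates run in a single number field containing the
  coordinates of P and the coefficients of the chosen representatives. Hence the substitute height
  has to be invariant under scaling and under extension of the field. Nonnegativity of the Weil
  height is shown as well, since the n-th root is a real power.

  Divisibility is taken relative to a subset of a domain: polynomials with algebraic coefficients in
  finitely many variables form subsets of one type, and the induction on the number of variables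
  runs over these subsets.\<close>

definition unit_in :: "'a::idom set \<Rightarrow> 'a \<Rightarrow> bool" where
  "unit_in A u \<longleftrightarrow> u \<in> A \<and> (\<exists>v\<in>A. u * v = 1)"

definition dvd_in :: "'a::idom set \<Rightarrow> 'a \<Rightarrow> 'a \<Rightarrow> bool" where
  "dvd_in A a b \<longleftrightarrow> (\<exists>c\<in>A. b = a * c)"

definition prime_in :: "'a::idom set \<Rightarrow> 'a \<Rightarrow> bool" where
  "prime_in A q \<longleftrightarrow> q \<in> A \<and> q \<noteq> 0 \<and> \<not> unit_in A q \<and>
     (\<forall>a\<in>A. \<forall>b\<in>A. dvd_in A q (a * b) \<longrightarrow> dvd_in A q a \<or> dvd_in A q b)"

definition subring_of :: "'a::idom set \<Rightarrow> bool" where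
  "subring_of A \<longleftrightarrow> 1 \<in> A \<and> (\<forall>a\<in>A. \<forall>b\<in>A. a - b \<in> A \<and> a * b \<in> A)"

text \<open>Asking for prime factors, and not merely irreducible ones, makes uniqueness automatic;
  for a subring this is therefore unique factorisation.\<close>

definition factorial_in :: "'a::idom set \<Rightarrow> bool" where
  "factorial_in A \<longleftrightarrow> (\<forall>a\<in>A. a \<noteq> 0 \<longrightarrow>
     (\<exists>u Q. unit_in A u \<and> (\<forall>q\<in>set Q. prime_in A q) \<and> a = u * prod_list Q))"

definition polys_over :: "'a::idom set \<Rightarrow> 'a poly set" where
  "polys_over A = {p. \<forall>i. coeff p i \<in> A}"

lemma subring_of_closed:
  assumes "subring_of A"
  shows "0 \<in> A" "1 \<in> A" "a \<in> A \<Longrightarrow> b \<in> A \<Longrightarrow> a - b \<in> A" "a \<in> A \<Longrightarrow> b \<in> A \<Longrightarrow> a * b \<in> A"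
    "a \<in> A \<Longrightarrow> - a \<in> A" "a \<in> A \<Longrightarrow> b \<in> A \<Longrightarrow> a + b \<in> A"
proof -
  show 1: "1 \<in> A" and d: "\<And>a b. a \<in> A \<Longrightarrow> b \<in> A \<Longrightarrow> a - b \<in> A"
    and "a \<in> A \<Longrightarrow> b \<in> A \<Longrightarrow> a * b \<in> A"
    using assms by (auto simp: subring_of_def)
  show 0: "0 \<in> A" using d[OF 1 1] by simp
  show m: "\<And>a. a \<in> A \<Longrightarrow> - a \<in> A" using d[OF 0] by simp
  show "a \<in> A \<Longrightarrow> b \<in> A \<Longrightarrow> a + b \<in> A" using d[of a "- b"] m[of b] by simp
qed

lemma subring_of_sum: "subring_of A \<Longrightarrow> (\<And>i. i \<in> I \<Longrightarrow> f i \<in> A) \<Longrightarrow> sum f I \<in> A"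
  by (induction I rule: infinite_finite_induct) (auto intro: subring_of_closed)

lemma subring_of_prod: "subring_of A \<Longrightarrow> (\<And>i. i \<in> I \<Longrightarrow> f i \<in> A) \<Longrightarrow> prod f I \<in> A"
  by (induction I rule: infinite_finite_induct) (auto intro: subring_of_closed)

lemma subring_of_power: "subring_of A \<Longrightarrow> a \<in> A \<Longrightarrow> a ^ n \<in> A"
  by (induction n) (auto intro: subring_of_closed)

lemma subring_of_prod_list: "subring_of A \<Longrightarrow> set Q \<subseteq> A \<Longrightarrow> prod_list Q \<in> A"
  by (induction Q) (auto intro: subring_of_closed)

lemma subring_of_polys_over: "subring_of A \<Longrightarrow> subring_of (polys_over A)"
  unfolding subring_of_def[of "polys_over A"]
proof (intro conjI ballI)
  assume A: "subring_of A"
  show "1 \<in> polys_over A" using subring_of_closed(1,2)[OF A] by (auto simp: polys_over_def coeff_1)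
  fix p q assume pq: "p \<in> polys_over A" "q \<in> polys_over A"
  thus "p - q \<in> polys_over A" using subring_of_closed(3)[OF A] by (auto simp: polys_over_def)
  show "p * q \<in> polys_over A" using subring_of_closed(4)[OF A] pq
    by (auto simp: polys_over_def coeff_mult intro!: subring_of_sum[OF A])
qed

lemma monom_in_polys_over: "subring_of A \<Longrightarrow> a \<in> A \<Longrightarrow> monom a n \<in> polys_over A"
  by (auto simp: polys_over_def intro: subring_of_closed)

lemma const_in_polys_over: "subring_of A \<Longrightarrow> a \<in> A \<Longrightarrow> [:a:] \<in> polys_over A"
  using monom_in_polys_over[of A a 0] by (simp add: monom_0)

lemma coeff_in_polys_over: "p \<in> polys_over A \<Longrightarrow> coeff p i \<in> A"
  by (auto simp: polys_over_def)

lemma unit_in_mult: "subring_of A \<Longrightarrow> unit_in A u \<Longrightarrow> unit_in A v \<Longrightarrow> unit_in A (u * v)"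
  unfolding unit_in_def
proof safe
  fix u' v' assume A: "subring_of A" "u \<in> A" "v \<in> A" "u' \<in> A" "v' \<in> A" "u * u' = 1" "v * v' = 1"
  have "u * v * (u' * v') = (u * u') * (v * v')" by (simp add: algebra_simps)
  with A show "\<exists>va\<in>A. u * v * va = 1" by (intro bexI[of _ "u' * v'"]) (auto intro: subring_of_closed)
qed (auto intro: subring_of_closed)

text \<open>Gauss' lemma in its prime form. Divisibility by a constant can be read off the
  coefficients; if \<open>q\<close> divided neither factor, then at the first coefficients
  \<open>i\<close> and \<open>j\<close> that it does not divide, all terms but one of the
  coefficient \<open>i + j\<close> of the product would be divisible by \<open>q\<close>.\<close>

lemma prime_in_polys_over_const:
  assumes A: "subring_of A" and q: "prime_in A q"
  shows "prime_in (polys_over A) [:q:]"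
proof -
  have qA: "q \<in> A" "q \<noteq> 0" using q by (auto simp: prime_in_def)
  have dvd_iff: "dvd_in (polys_over A) [:q:] f \<longleftrightarrow> (\<forall>i. dvd_in A q (coeff f i))" for f
  proof
    assume "dvd_in (polys_over A) [:q:] f"
    thus "\<forall>i. dvd_in A q (coeff f i)" by (auto simp: dvd_in_def polys_over_def)
  next
    assume *: "\<forall>i. dvd_in A q (coeff f i)"
    then obtain c where c: "\<And>i. c i \<in> A" "\<And>i. coeff f i = q * c i" unfolding dvd_in_def by metis
    have "c i = 0" if "i > degree f" for i using c(2)[of i] qA coeff_eq_0[OF that] by auto
    hence co: "coeff (Abs_poly c) = c"
      by (intro coeff_Abs_poly) auto
    have "f = [:q:] * Abs_poly c"
      by (rule poly_eqI) (simp add: co c(2))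
    moreover have "Abs_poly c \<in> polys_over A" by (simp add: polys_over_def co c)
    ultimately show "dvd_in (polys_over A) [:q:] f" unfolding dvd_in_def by blast
  qed
  have nu: "\<not> unit_in (polys_over A) [:q:]"
  proof
    assume "unit_in (polys_over A) [:q:]"
    then obtain v where v: "v \<in> polys_over A" "[:q:] * v = 1" by (auto simp: unit_in_def)
    have "coeff ([:q:] * v) 0 = 1" by (subst v(2)) simp
    moreover have "coeff ([:q:] * v) 0 = q * coeff v 0" by (simp only: coeff_mult) simp
    ultimately have "q * coeff v 0 = 1" by (metis (lifting))
    hence "unit_in A q" using v qA by (auto simp: unit_in_def polys_over_def)
    thus False using q by (auto simp: prime_in_def)
  qed
  have "dvd_in (polys_over A) [:q:] f \<or> dvd_in (polys_over A) [:q:] g"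
    if fg: "f \<in> polys_over A" "g \<in> polys_over A" "dvd_in (polys_over A) [:q:] (f * g)" for f g
  proof (rule ccontr)
    assume "\<not> ?thesis"
    hence "\<exists>i. \<not> dvd_in A q (coeff f i)" "\<exists>i. \<not> dvd_in A q (coeff g i)" by (auto simp: dvd_iff)
    then obtain i j where i: "\<not> dvd_in A q (coeff f i)" "\<And>k. k < i \<Longrightarrow> dvd_in A q (coeff f k)"
      and j: "\<not> dvd_in A q (coeff g j)" "\<And>k. k < j \<Longrightarrow> dvd_in A q (coeff g k)"
      using exists_least_iff[of "\<lambda>i. \<not> dvd_in A q (coeff f i)"] exists_least_iff[of "\<lambda>i. \<not> dvd_in A q (coeff g i)"]
      by blast
    have dsum: "dvd_in A q (sum h I)" if "\<And>k. k \<in> I \<Longrightarrow> dvd_in A q (h k)" for h and I :: "nat set"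
      using that
    proof (induction I rule: infinite_finite_induct)
      case (insert x F)
      obtain c where c: "c\<in>A" "h x = q * c" using insert.prems unfolding dvd_in_def by blast
      obtain d where d: "d\<in>A" "sum h F = q * d" using insert unfolding dvd_in_def by blast
      show ?case unfolding dvd_in_def using insert(1,2) c d A
        by (intro bexI[of _ "c + d"]) (auto simp: algebra_simps intro: subring_of_closed)
    qed (use A in \<open>auto simp: dvd_in_def intro!: bexI[of _ 0] subring_of_closed\<close>)
    have "coeff (f * g) (i + j) = (\<Sum>k\<le>i+j. coeff f k * coeff g (i + j - k))" by (simp add: coeff_mult)
    also have "\<dots> = coeff f i * coeff g j + (\<Sum>k\<in>{..i+j} - {i}. coeff f k * coeff g (i + j - k))"
      by (subst sum.remove[of _ i]) auto
    finally have e: "coeff f i * coeff g j = coeff (f * g) (i + j) - (\<Sum>k\<in>{..i+j} - {i}. coeff f k * coeff g (i + j - k))" by simp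
    have "dvd_in A q (\<Sum>k\<in>{..i+j} - {i}. coeff f k * coeff g (i + j - k))"
    proof (rule dsum)
      fix k assume "k \<in> {..i+j} - {i}"
      hence "k < i \<or> i + j - k < j" by auto
      thus "dvd_in A q (coeff f k * coeff g (i + j - k))"
      proof
        assume "k < i" with i(2)[of k] obtain c where "c \<in> A" "coeff f k = q * c" by (auto simp: dvd_in_def)
        thus ?thesis unfolding dvd_in_def using A coeff_in_polys_over[OF fg(2)]
          by (intro bexI[of _ "c * coeff g (i + j - k)"]) (auto simp: algebra_simps intro: subring_of_closed)
      next
        assume "i + j - k < j" with j(2)[of "i+j-k"] obtain c where "c \<in> A" "coeff g (i+j-k) = q * c" by (auto simp: dvd_in_def)
        thus ?thesis unfolding dvd_in_def using A coeff_in_polys_over[OF fg(1)]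
          by (intro bexI[of _ "c * coeff f k"]) (auto simp: algebra_simps intro: subring_of_closed)
      qed
    qed
    moreover have "dvd_in A q (coeff (f * g) (i + j))" using fg(3) by (simp add: dvd_iff)
    ultimately have "dvd_in A q (coeff f i * coeff g j)"
      unfolding e dvd_in_def using A
      by (metis right_diff_distrib subring_of_closed(3))
    thus False using i(1) j(1) q coeff_in_polys_over[OF fg(1)] coeff_in_polys_over[OF fg(2)]
      by (auto simp: prime_in_def)
  qed
  thus ?thesis using nu qA A by (auto simp: prime_in_def intro: const_in_polys_over)
qed

text \<open>One prime of the denominator at a time: it divides \<open>w\<close> or \<open>m\<close>
  and is cancelled there. The constants \<open>c1\<close> and \<open>c2\<close> record what has been
  removed, because later only a change of \<open>w\<close> by a constant of \<open>A\<close> can be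
  tolerated.\<close>

lemma gauss_split_primes:
  assumes A: "subring_of A" and Q: "\<forall>q\<in>set Q. prime_in A q"
    and "w \<in> polys_over A" "m \<in> polys_over A" "g \<in> polys_over A" "[:prod_list Q:] * g = w * m"
  shows "\<exists>w' m' c1 c2. w' \<in> polys_over A \<and> m' \<in> polys_over A \<and> c1 \<in> A \<and> c2 \<in> A \<and>
           g = w' * m' \<and> w = [:c1:] * w' \<and> m = [:c2:] * m'"
  using Q assms(3-)
proof (induction Q arbitrary: w m)
  case Nil
  thus ?case using A
    by (intro exI[of _ w] exI[of _ m] exI[of _ 1]) (auto intro: subring_of_closed simp: one_pCons)
next
  case (Cons q Q)
  have q: "prime_in A q" and qA: "q \<in> A" "q \<noteq> 0" using Cons.prems by (auto simp: prime_in_def)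
  have QA: "prod_list Q \<in> A" using Cons.prems A by (intro subring_of_prod_list) (auto simp: prime_in_def)
  have eq: "[:q:] * ([:prod_list Q:] * g) = w * m" using Cons.prems by (simp add: mult.commute)
  hence "dvd_in (polys_over A) [:q:] (w * m)" unfolding dvd_in_def using Cons.prems A QA
    by (metis const_in_polys_over subring_of_closed(4) subring_of_polys_over)
  hence "dvd_in (polys_over A) [:q:] w \<or> dvd_in (polys_over A) [:q:] m"
    using prime_in_polys_over_const[OF A q] Cons.prems by (auto simp: prime_in_def)
  thus ?case
  proof
    assume "dvd_in (polys_over A) [:q:] w"
    then obtain w1 where w1: "w1 \<in> polys_over A" "w = [:q:] * w1" by (auto simp: dvd_in_def)
    have "[:q:] * ([:prod_list Q:] * g) = [:q:] * (w1 * m)" using eq w1 by (simp add: algebra_simps)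
    hence "[:prod_list Q:] * g = w1 * m" using qA by (metis mult_cancel_left pCons_eq_0_iff)
    from Cons.IH[OF _ w1(1) _ _ this] Cons.prems obtain w' m' c1 c2 where
      "w' \<in> polys_over A" "m' \<in> polys_over A" "c1 \<in> A" "c2 \<in> A"
           "g = w' * m'" "w1 = [:c1:] * w'" "m = [:c2:] * m'" by auto
    thus ?thesis using A qA w1
      by (intro exI[of _ w'] exI[of _ m'] exI[of _ "c1 * q"] exI[of _ c2]) (auto simp: mult.commute intro: subring_of_closed)
  next
    assume "dvd_in (polys_over A) [:q:] m"
    then obtain m1 where m1: "m1 \<in> polys_over A" "m = [:q:] * m1" by (auto simp: dvd_in_def)
    have "[:q:] * ([:prod_list Q:] * g) = [:q:] * (w * m1)" using eq m1 by (simp add: algebra_simps)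
    hence "[:prod_list Q:] * g = w * m1" using qA by (metis mult_cancel_left pCons_eq_0_iff)
    from Cons.IH[OF _ _ m1(1) _ this] Cons.prems obtain w' m' c1 c2 where
      "w' \<in> polys_over A" "m' \<in> polys_over A" "c1 \<in> A" "c2 \<in> A"
           "g = w' * m'" "w = [:c1:] * w'" "m1 = [:c2:] * m'" by auto
    thus ?thesis using A qA m1
      by (intro exI[of _ w'] exI[of _ m'] exI[of _ c1] exI[of _ "c2 * q"]) (auto simp: mult.commute intro: subring_of_closed)
  qed
qed

text \<open>Takes the place of passing to the fraction field and back: a factorisation of
  \<open>g\<close> up to the denominator \<open>c\<close> becomes one over \<open>A\<close>. The
  unit in the factorisation of \<open>c\<close> is moved to the second factor.\<close>

lemma gauss_split:
  assumes A: "subring_of A" "factorial_in A" and c: "c \<in> A" "c \<noteq> 0"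
    and w: "w \<in> polys_over A" "m \<in> polys_over A" "g \<in> polys_over A" "[:c:] * g = w * m"
  obtains w' m' c1 where "w' \<in> polys_over A" "m' \<in> polys_over A" "c1 \<in> A"
    "g = w' * m'" "w = [:c1:] * w'"
proof -
  obtain u Q where u: "unit_in A u" "\<forall>q\<in>set Q. prime_in A q" "c = u * prod_list Q"
    using A(2) c unfolding factorial_in_def by blast
  then obtain v where v: "v \<in> A" "u * v = 1" "u \<in> A" by (auto simp: unit_in_def)
  have "[:prod_list Q:] * g = [:v:] * ([:c:] * g)" using v(2)
    by (simp add: u(3)) (metis mult.assoc mult.commute mult_1)
  also have "\<dots> = w * ([:v:] * m)" by (simp only: w(4)) (simp only: mult_ac)
  finally have "[:prod_list Q:] * g = w * ([:v:] * m)" .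
  from gauss_split_primes[OF A(1) u(2) w(1) _ w(3) this] obtain w' m' c1 c2 where
    "w' \<in> polys_over A" "m' \<in> polys_over A" "c1 \<in> A" "g = w' * m'" "w = [:c1:] * w'"
    using A v w const_in_polys_over[OF A(1) v(1)] subring_of_closed(4)[OF subring_of_polys_over[OF A(1)]]
    by blast
  thus ?thesis using that by blast
qed

text \<open>Pseudo-division, which stays in \<open>A\<close> by multiplying the dividend with powers
  of the leading coefficient. It serves ideals of polynomials here and, with a monic divisor,
  finitely generated rings of algebraic integers later.\<close>

lemma pseudo_reduce:
  assumes A: "subring_of A" and w: "w \<in> polys_over A" "w \<noteq> 0" and v: "v \<in> polys_over A"
  shows "\<exists>k m r. m \<in> polys_over A \<and> r \<in> polys_over A \<and>
    [:lead_coeff w ^ k:] * v = w * m + r \<and> (r = 0 \<or> degree r < degree w)"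
  using v
proof (induction "degree v" arbitrary: v rule: less_induct)
  case less
  note P = subring_of_polys_over[OF A]
  show ?case
  proof (cases "v = 0 \<or> degree v < degree w")
    case True
    thus ?thesis using less.prems subring_of_closed(1)[OF P]
      by (intro exI[of _ 0] exI[of _ v]) (auto simp: one_pCons)
  next
    case False
    define e where "e = degree v - degree w"
    define t where "t = monom (lead_coeff v) e"
    define v' where "v' = [:lead_coeff w:] * v - w * t"
    have t: "t \<in> polys_over A" unfolding t_def using A less.prems
      by (intro monom_in_polys_over) (auto simp: polys_over_def)
    have lw: "[:lead_coeff w:] \<in> polys_over A" using A w by (intro const_in_polys_over) (auto simp: polys_over_def)
    have v': "v' \<in> polys_over A" unfolding v'_def using t lw w less.prems
      by (intro subring_of_closed[OF P])
    have t': "t \<noteq> 0" "degree t = e" "lead_coeff t = lead_coeff v"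
      using False by (auto simp: t_def monom_eq_0_iff degree_monom_eq)
    have dt: "degree (w * t) = degree v" using False w t' by (simp add: degree_mult_eq e_def)
    hence dt': "coeff (w * t) (degree v) = lead_coeff w * lead_coeff v"
      using t' by (metis lead_coeff_mult)
    have "v' = 0 \<or> degree v' < degree v"
    proof (rule disjCI)
      assume "\<not> degree v' < degree v"
      moreover have le: "degree v' \<le> degree v" unfolding v'_def
        by (rule degree_diff_le) (auto simp: dt)
      moreover have "coeff v' (degree v) = 0" using dt' by (simp add: v'_def)
      ultimately show "v' = 0" by (metis leading_coeff_0_iff order_le_less)
    qed
    thus ?thesis
    proof
      assume "v' = 0"
      thus ?thesis using t subring_of_closed(1)[OF P]
        by (intro exI[of _ 1] exI[of _ t] exI[of _ 0]) (auto simp: v'_def)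
    next
      assume "degree v' < degree v"
      from less.hyps[OF this v'] obtain k m r where *: "m \<in> polys_over A" "r \<in> polys_over A"
        "[:lead_coeff w ^ k:] * v' = w * m + r" "r = 0 \<or> degree r < degree w" by blast
      have "[:lead_coeff w ^ Suc k:] * v = [:lead_coeff w ^ k:] * ([:lead_coeff w:] * v)"
        by (simp add: mult.commute)
      also have "[:lead_coeff w:] * v = v' + w * t" by (simp add: v'_def)
      also have "[:lead_coeff w ^ k:] * (v' + w * t) = w * m + r + [:lead_coeff w ^ k:] * (w * t)"
        by (simp only: distrib_left *(3))
      also have "\<dots> = w * (m + [:lead_coeff w ^ k:] * t) + r" by (simp only: ring_distribs mult_ac add_ac)
      finally have "[:lead_coeff w ^ Suc k:] * v = w * (m + [:lead_coeff w ^ k:] * t) + r" .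
      moreover have "m + [:lead_coeff w ^ k:] * t \<in> polys_over A"
        using * t A w by (intro subring_of_closed[OF P] const_in_polys_over subring_of_power) (auto simp: polys_over_def)
      ultimately show ?thesis using * by blast
    qed
  qed
qed

text \<open>An element of minimal degree of the ideal \<open>(f, a)\<close> replaces the gcd over the fraction field.\<close>
lemma ideal_generator:
  assumes A: "subring_of A" and f: "f \<in> polys_over A" "f \<noteq> 0" and a: "a \<in> polys_over A"
  obtains w s t where "s \<in> polys_over A" "t \<in> polys_over A" "w = s * f + t * a" "w \<noteq> 0" "w \<in> polys_over A"
    "\<And>v. v = f \<or> v = a \<Longrightarrow> \<exists>k m. m \<in> polys_over A \<and> [:lead_coeff w ^ k:] * v = w * m"
proof -
  note P = subring_of_polys_over[OF A]
  define J where "J = {s * f + t * a |s t. s \<in> polys_over A \<and> t \<in> polys_over A}"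
  have fJ: "f \<in> J" and aJ: "a \<in> J" unfolding J_def using subring_of_closed(1,2)[OF P] by force+
  obtain w where w: "w \<in> J" "w \<noteq> 0" "\<And>v. v \<in> J \<Longrightarrow> v \<noteq> 0 \<Longrightarrow> degree w \<le> degree v"
    using ex_has_least_nat[of "\<lambda>w. w \<in> J \<and> w \<noteq> 0" f degree] fJ f(2) by blast
  obtain s t where st: "s \<in> polys_over A" "t \<in> polys_over A" "w = s * f + t * a" using w(1) by (auto simp: J_def)
  have wA: "w \<in> polys_over A" unfolding st(3) using st f a by (intro subring_of_closed(4,6)[OF P])
  have "\<exists>k m. m \<in> polys_over A \<and> [:lead_coeff w ^ k:] * v = w * m" if v: "v = f \<or> v = a" for v
  proof -
    have vJ: "v \<in> J" and vA: "v \<in> polys_over A" using v f a fJ aJ by auto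
    from pseudo_reduce[OF A wA w(2) vA] obtain k m r where *: "m \<in> polys_over A" "r \<in> polys_over A"
      "[:lead_coeff w ^ k:] * v = w * m + r" "r = 0 \<or> degree r < degree w" by blast
    obtain s' t' where st': "s' \<in> polys_over A" "t' \<in> polys_over A" "v = s' * f + t' * a" using vJ by (auto simp: J_def)
    have lw: "[:lead_coeff w ^ k:] \<in> polys_over A" using wA A
      by (intro const_in_polys_over subring_of_power) (auto simp: polys_over_def)
    \<comment> \<open>The remainder belongs to the ideal again, so minimality of the degree of
      \<open>w\<close> forces it to vanish.\<close>
    have "r = [:lead_coeff w ^ k:] * v - w * m" using *(3) by simp
    also have "\<dots> = ([:lead_coeff w ^ k:] * s' - s * m) * f + ([:lead_coeff w ^ k:] * t' - t * m) * a"
      unfolding st(3) st'(3) by (simp only: ring_distribs mult_ac) (simp only: algebra_simps)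
    finally have "r \<in> J" unfolding J_def mem_Collect_eq
      using st(1,2) st'(1,2) *(1) lw
      by (intro exI conjI) (assumption | intro subring_of_closed(3,4)[OF P])+
    hence "r = 0" using w(3) *(4) by force
    thus ?thesis using * by auto
  qed
  thus ?thesis using that[OF st w(2) wA] by blast
qed

text \<open>Let \<open>f\<close> divide a * b. The element \<open>w\<close> of minimal degree in the
  ideal (f, a) is, up to constants, a factor of \<open>f\<close>. If it is a constant, multiplying
  its representation by \<open>b\<close> shows that \<open>f\<close> divides a constant multiple of
  \<open>b\<close>; otherwise \<open>w\<close> is a multiple of \<open>f\<close> by a constant, and
  \<open>f\<close> divides a constant multiple of \<open>a\<close>. Constants are removed by Gauss'
  lemma.\<close>

lemma prime_in_polys_over:
  assumes A: "subring_of A" "factorial_in A" and f: "f \<in> polys_over A" "degree f > 0"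
    and irr: "\<And>g h. g \<in> polys_over A \<Longrightarrow> h \<in> polys_over A \<Longrightarrow> f = g * h \<Longrightarrow> degree g = 0 \<or> degree h = 0"
    and prim: "\<And>c g. c \<in> A \<Longrightarrow> g \<in> polys_over A \<Longrightarrow> f = [:c:] * g \<Longrightarrow> unit_in A c"
  shows "prime_in (polys_over A) f"
proof -
  note P = subring_of_polys_over[OF A(1)]
  have f0: "f \<noteq> 0" using f by auto
  have key: "dvd_in (polys_over A) f b"
    if "c \<in> A" "c \<noteq> 0" "m \<in> polys_over A" "b \<in> polys_over A" "[:c:] * b = f * m" for b c m
  proof -
    from gauss_split[OF A that(1,2) f(1) that(3-5)] obtain f' m' c1 where
      *: "f' \<in> polys_over A" "m' \<in> polys_over A" "c1 \<in> A" "b = f' * m'" "f = [:c1:] * f'" by metis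
    from prim[OF *(3,1,5)] obtain v where v: "v \<in> A" "c1 * v = 1" by (auto simp: unit_in_def)
    have "f' = [:c1 * v:] * f'" by (simp add: v one_pCons)
    also have "\<dots> = f * [:v:]" by (simp add: *(5) mult.commute)
    finally have "b = f * ([:v:] * m')" by (subst *(4)) (simp only: mult_ac)
    thus ?thesis unfolding dvd_in_def using v * const_in_polys_over[OF A(1) v(1)] subring_of_closed(4)[OF P] by blast
  qed
  have nu: "\<not> unit_in (polys_over A) f"
  proof
    assume "unit_in (polys_over A) f"
    then obtain v where "f * v = 1" by (auto simp: unit_in_def)
    hence "degree f + degree v = 0" using f0 by (metis degree_1 degree_mult_eq mult_zero_right zero_neq_one)
    thus False using f by simp
  qed
  have "dvd_in (polys_over A) f b"
    if a: "a \<in> polys_over A" and b: "b \<in> polys_over A"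
      and ab: "dvd_in (polys_over A) f (a * b)" and na: "\<not> dvd_in (polys_over A) f a" for a b
  proof -
    obtain w s t where st: "s \<in> polys_over A" "t \<in> polys_over A" "w = s * f + t * a"
      and w: "w \<noteq> 0" "w \<in> polys_over A"
      and div: "\<And>v. v = f \<or> v = a \<Longrightarrow> \<exists>k m. m \<in> polys_over A \<and> [:lead_coeff w ^ k:] * v = w * m"
      using ideal_generator[OF A(1) f(1) f0 a] by metis
    note wA = w(2)
    have lw: "lead_coeff w ^ k \<in> A" "lead_coeff w ^ k \<noteq> 0" for k
      using w A by (auto simp: polys_over_def intro!: subring_of_power)
    from div[of f] obtain k m where m: "m \<in> polys_over A" "[:lead_coeff w ^ k:] * f = w * m" by blast
    from gauss_split[OF A lw wA m(1) f(1) m(2)] obtain w' m' c1 where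
      *: "w' \<in> polys_over A" "m' \<in> polys_over A" "c1 \<in> A" "f = w' * m'" "w = [:c1:] * w'" by metis
    from irr[OF *(1,2,4)] show ?thesis
    proof
      assume "degree w' = 0"
      then obtain e0 where "w' = [:e0:]" by (metis degree_eq_zeroE)
      hence we: "w = [:c1 * e0:]" using * by simp
      define e where "e = c1 * e0"
      have e: "e \<in> A" "e \<noteq> 0" using we wA w(1) by (auto simp: polys_over_def e_def dest: spec[of _ 0])
      obtain z where z: "z \<in> polys_over A" "a * b = f * z" using ab by (auto simp: dvd_in_def)
      have "[:e:] * b = (s * f + t * a) * b" using we st(3) e_def by simp
      also have "\<dots> = s * f * b + t * (a * b)" by (simp add: algebra_simps)
      also have "\<dots> = f * (s * b + t * z)" by (simp only: z) (simp add: algebra_simps)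
      finally show ?thesis by (rule key[OF e _ b, rotated]) (intro subring_of_closed(4,6)[OF P] st z b)
    next
      assume "degree m' = 0"
      then obtain e where e: "m' = [:e:]" by (metis degree_eq_zeroE)
      have eA: "e \<in> A" using *(2) e by (auto simp: polys_over_def dest: spec[of _ 0])
      have "f = [:e:] * w'" using * e by (simp add: mult.commute)
      from prim[OF eA *(1) this] obtain v where v: "v \<in> A" "e * v = 1" by (auto simp: unit_in_def)
      have "w = [:c1:] * ([:e * v:] * w')" by (simp add: v *(5))
      also have "\<dots> = f * [:c1 * v:]" by (simp add: *(4) e mult_ac)
      finally have wf: "w = f * [:c1 * v:]" .
      from div[of a] obtain k m where m: "m \<in> polys_over A" "[:lead_coeff w ^ k:] * a = w * m" by blast
      have "[:lead_coeff w ^ k:] * a = f * ([:c1 * v:] * m)" using m(2) wf by (metis mult.assoc)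
      with key[OF lw _ a] m v * const_in_polys_over[OF A(1)] subring_of_closed(4)[OF P] subring_of_closed(4)[OF A(1)]
      have "dvd_in (polys_over A) f a" by metis
      with na show ?thesis by simp
    qed
  qed
  thus ?thesis using f0 f nu by (auto simp: prime_in_def)
qed

text \<open>Primes are split off as long as some non-unit divides the polynomial. This ends because
  each of them also removes one prime from the factorisation of the leading coefficient, whose
  length is the induction measure.\<close>

lemma primitive_split:
  assumes A: "subring_of A" "factorial_in A" and f: "f \<in> polys_over A" "f \<noteq> 0"
  obtains c f' where "c \<in> A" "c \<noteq> 0" "f' \<in> polys_over A" "f = [:c:] * f'"
    "\<And>d g. d \<in> A \<Longrightarrow> g \<in> polys_over A \<Longrightarrow> f' = [:d:] * g \<Longrightarrow> unit_in A d"
proof -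
  have gen: "\<exists>c f'. c \<in> A \<and> c \<noteq> 0 \<and> f' \<in> polys_over A \<and> f = [:c:] * f' \<and>
      (\<forall>d\<in>A. \<forall>g\<in>polys_over A. f' = [:d:] * g \<longrightarrow> unit_in A d)"
    if "f \<in> polys_over A" "f \<noteq> 0" "lead_coeff f = u * prod_list Q" "unit_in A u" "\<forall>q\<in>set Q. prime_in A q"
    for u Q f
    using that
  proof (induction "length Q" arbitrary: f u Q rule: less_induct)
    case less
    show ?case
    proof (cases "\<forall>d\<in>A. \<forall>g\<in>polys_over A. f = [:d:] * g \<longrightarrow> unit_in A d")
      case True
      thus ?thesis using less.prems subring_of_closed(2)[OF A(1)] by (intro exI[of _ 1] exI[of _ f]) (auto simp: one_pCons)
    next
      case False
      then obtain d g where dg: "d \<in> A" "g \<in> polys_over A" "f = [:d:] * g" "\<not> unit_in A d" by blast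
      have d0: "d \<noteq> 0" "g \<noteq> 0" using dg less.prems by auto
      obtain u1 Q1 where Q1: "unit_in A u1" "\<forall>q\<in>set Q1. prime_in A q" "d = u1 * prod_list Q1"
        using A(2) dg d0 unfolding factorial_in_def by blast
      hence "Q1 \<noteq> []" using dg(4) by auto
      then obtain q Q2 where q: "Q1 = q # Q2" by (cases Q1) auto
      define g' where "g' = [:u1 * prod_list Q2:] * g"
      have qp: "prime_in A q" "q \<in> A" "q \<noteq> 0" using Q1 q by (auto simp: prime_in_def)
      have "u1 * prod_list Q2 \<in> A" using Q1 q A(1)
        by (intro subring_of_closed subring_of_prod_list) (auto simp: unit_in_def prime_in_def)
      hence g'A: "g' \<in> polys_over A" unfolding g'_def using dg A(1)
        by (intro subring_of_closed[OF subring_of_polys_over] const_in_polys_over)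
      have fq: "f = [:q:] * g'" using dg Q1 q by (simp add: g'_def mult_ac)
      have g'0: "g' \<noteq> 0" using fq less.prems by auto
      have lc: "q * lead_coeff g' = u * prod_list Q" using less.prems(3) fq qp by (simp add: lead_coeff_mult)
      have uA: "u \<in> A" "set Q \<subseteq> A" using less.prems by (auto simp: unit_in_def prime_in_def)
      have prd: "\<exists>r\<in>set Q'. dvd_in A q r" if "set Q' \<subseteq> A" "dvd_in A q (v * prod_list Q')" "unit_in A v" for Q' v
        using that
      proof (induction Q')
        case Nil
        then obtain x y where "x \<in> A" "y \<in> A" "v = q * x" "v * y = 1" by (auto simp: dvd_in_def unit_in_def)
        hence "q * (x * y) = 1" "x * y \<in> A" using A(1) by (auto simp: mult_ac intro: subring_of_closed)
        hence "unit_in A q" using qp by (auto simp: unit_in_def)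
        with qp show ?case by (auto simp: prime_in_def)
      next
        case (Cons r Q')
        have "dvd_in A q (r * (v * prod_list Q'))" using Cons.prems by (simp add: mult_ac)
        moreover have "r \<in> A" "v * prod_list Q' \<in> A" using Cons.prems A(1)
          by (auto simp: unit_in_def intro!: subring_of_closed subring_of_prod_list)
        ultimately have "dvd_in A q r \<or> dvd_in A q (v * prod_list Q')" using qp by (auto simp: prime_in_def)
        thus ?case using Cons by auto
      qed
      have "dvd_in A q (u * prod_list Q)" unfolding dvd_in_def lc[symmetric]
        using g'A by (auto simp: polys_over_def)
      from prd[OF uA(2) this less.prems(4)] obtain r where r: "r \<in> set Q" "dvd_in A q r" by blast
      then obtain x where x: "x \<in> A" "r = q * x" by (auto simp: dvd_in_def)
      have rp: "prime_in A r" using r less.prems by auto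
      have "dvd_in A r (q * x)" using x rp A(1) by (auto simp: dvd_in_def intro!: bexI[of _ 1] subring_of_closed)
      hence "dvd_in A r q \<or> dvd_in A r x" using rp qp x by (auto simp: prime_in_def)
      \<comment> \<open>Two primes dividing one another are associated; so \<open>r\<close> may be
        deleted from \<open>Q\<close> at the cost of the unit \<open>x\<close>.\<close>
      have ux: "unit_in A x" using \<open>dvd_in A r q \<or> dvd_in A r x\<close>
      proof
        assume "dvd_in A r q"
        then obtain y where "y \<in> A" "q = r * y" by (auto simp: dvd_in_def)
        hence "q * (x * y) = q * 1" using x by (simp add: mult_ac)
        hence "x * y = 1" using qp by simp
        thus ?thesis using x \<open>y \<in> A\<close> by (auto simp: unit_in_def)
      next
        assume "dvd_in A r x"
        then obtain y where "y \<in> A" "x = r * y" by (auto simp: dvd_in_def)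
        hence "x * (q * y) = x * 1" using x by (simp add: mult_ac)
        moreover have "x \<noteq> 0" using x rp by (auto simp: prime_in_def)
        ultimately have "q * y = 1" by simp
        hence "unit_in A q" using qp \<open>y \<in> A\<close> by (auto simp: unit_in_def)
        thus ?thesis using qp by (auto simp: prime_in_def)
      qed
      obtain Qa Qb where sp: "Q = Qa @ r # Qb" using r(1) by (meson split_list)
      have "q * lead_coeff g' = q * (u * x * prod_list (Qa @ Qb))" using lc x by (simp add: sp mult_ac)
      hence lc': "lead_coeff g' = (u * x) * prod_list (Qa @ Qb)" using qp by simp
      have "unit_in A (u * x)" using ux less.prems A(1) by (auto intro: unit_in_mult)
      from less.hyps[OF _ g'A g'0 lc' this] less.prems sp obtain c f' where
        *: "c \<in> A" "c \<noteq> 0" "f' \<in> polys_over A" "g' = [:c:] * f'"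
          "\<forall>d\<in>A. \<forall>g\<in>polys_over A. f' = [:d:] * g \<longrightarrow> unit_in A d" by auto
      have "f = [:q * c:] * f'" using fq * by (simp add: mult.commute)
      thus ?thesis using * qp A(1) by (intro exI[of _ "q * c"] exI[of _ f']) (auto simp: mult.commute intro: subring_of_closed)
    qed
  qed
  have "lead_coeff f \<in> A" "lead_coeff f \<noteq> 0" using f by (auto simp: polys_over_def)
  then obtain u Q where "unit_in A u" "\<forall>q\<in>set Q. prime_in A q" "lead_coeff f = u * prod_list Q"
    using A(2) unfolding factorial_in_def by blast
  from gen[OF f this(3,1,2)] that show ?thesis by blast
qed

text \<open>Induction on the degree. Constants inherit their factorisation from \<open>A\<close>, a
  product of two polynomials of positive degree is covered by the induction hypothesis, and in the
  remaining case the primitive part is prime.\<close>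

theorem factorial_in_polys_over:
  assumes A: "subring_of A" "factorial_in A"
  shows "factorial_in (polys_over A)"
proof -
  note P = subring_of_polys_over[OF A(1)]
  have const: "\<exists>u Q. unit_in (polys_over A) u \<and> (\<forall>q\<in>set Q. prime_in (polys_over A) q) \<and> [:c:] = u * prod_list Q"
    if cA: "c \<in> A" "c \<noteq> 0" for c
  proof -
    obtain u Q where Q: "unit_in A u" "\<forall>q\<in>set Q. prime_in A q" "c = u * prod_list Q"
      using A(2)[unfolded factorial_in_def, rule_format, OF cA] by blast
    have eq: "[:c:] = [:u:] * prod_list (map (\<lambda>q. [:q:]) Q)"
    proof -
      have "prod_list (map (\<lambda>q. [:q:]) Q) = [:prod_list Q:]" by (induction Q) (auto simp: one_pCons mult.commute)
      thus ?thesis by (simp add: Q(3))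
    qed
    have "unit_in (polys_over A) [:u:]"
    proof -
      from Q(1) obtain v where "v \<in> A" "u * v = 1" "u \<in> A" by (auto simp: unit_in_def)
      thus ?thesis unfolding unit_in_def
        using A(1) by (intro conjI bexI[of _ "[:v:]"] const_in_polys_over) (simp_all add: one_pCons mult.commute)
    qed
    moreover have "\<forall>r\<in>set (map (\<lambda>q. [:q:]) Q). prime_in (polys_over A) r"
      using Q(2) prime_in_polys_over_const[OF A(1)] by auto
    ultimately show ?thesis using eq by blast
  qed
  have comb: "\<exists>u Q. unit_in (polys_over A) u \<and> (\<forall>q\<in>set Q. prime_in (polys_over A) q) \<and> g * h = u * prod_list Q"
    if "\<exists>u Q. unit_in (polys_over A) u \<and> (\<forall>q\<in>set Q. prime_in (polys_over A) q) \<and> g = u * prod_list Q"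
       "\<exists>u Q. unit_in (polys_over A) u \<and> (\<forall>q\<in>set Q. prime_in (polys_over A) q) \<and> h = u * prod_list Q" for g h
  proof -
    from that obtain u Q v R where "unit_in (polys_over A) u" "\<forall>q\<in>set Q. prime_in (polys_over A) q" "g = u * prod_list Q"
      "unit_in (polys_over A) v" "\<forall>q\<in>set R. prime_in (polys_over A) q" "h = v * prod_list R" by blast
    thus ?thesis using unit_in_mult[OF P]
      by (intro exI[of _ "u * v"] exI[of _ "Q @ R"]) (auto simp: mult_ac)
  qed
  have "\<exists>u Q. unit_in (polys_over A) u \<and> (\<forall>q\<in>set Q. prime_in (polys_over A) q) \<and> f = u * prod_list Q"
    if "f \<in> polys_over A" "f \<noteq> 0" for f
    using that
  proof (induction "degree f" arbitrary: f rule: less_induct)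
    case less
    show ?case
    proof (cases "degree f = 0")
      case True
      then obtain c where "f = [:c:]" by (metis degree_eq_zeroE)
      thus ?thesis using const[of c] less.prems by (auto simp: polys_over_def dest: spec[of _ 0])
    next
      case pos: False
      show ?thesis
      proof (cases "\<exists>g h. g \<in> polys_over A \<and> h \<in> polys_over A \<and> f = g * h \<and> degree g \<noteq> 0 \<and> degree h \<noteq> 0")
        case True
        then obtain g h where gh: "g \<in> polys_over A" "h \<in> polys_over A" "f = g * h" "degree g \<noteq> 0" "degree h \<noteq> 0" by blast
        have "g \<noteq> 0" "h \<noteq> 0" "degree f = degree g + degree h" using gh less.prems by (auto simp: degree_mult_eq)
        thus ?thesis using comb less.hyps[of g] less.hyps[of h] gh by simp
      next
        case False
        obtain c f' where *: "c \<in> A" "c \<noteq> 0" "f' \<in> polys_over A" "f = [:c:] * f'"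
          "\<And>d g. d \<in> A \<Longrightarrow> g \<in> polys_over A \<Longrightarrow> f' = [:d:] * g \<Longrightarrow> unit_in A d"
          using primitive_split[OF A less.prems] by blast
        have "degree f' > 0" using pos * by simp
        have "prime_in (polys_over A) f'"
        proof (rule prime_in_polys_over[OF A *(3) \<open>degree f' > 0\<close>])
          fix g h assume gh: "g \<in> polys_over A" "h \<in> polys_over A" "f' = g * h"
          have "f = ([:c:] * g) * h" by (simp add: *(4) gh(3))
          moreover have "[:c:] * g \<in> polys_over A" using gh * A(1)
            by (intro subring_of_closed[OF P] const_in_polys_over)
          ultimately have "degree ([:c:] * g) = 0 \<or> degree h = 0" using False gh by blast
          thus "degree g = 0 \<or> degree h = 0" using *(2) by simp
        qed (use * in blast)
        hence "\<exists>u Q. unit_in (polys_over A) u \<and> (\<forall>q\<in>set Q. prime_in (polys_over A) q) \<and> f' = u * prod_list Q"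
          using subring_of_closed(2)[OF P] by (intro exI[of _ 1] exI[of _ "[f']"]) (auto simp: unit_in_def)
        from comb[OF const[OF *(1,2)] this] show ?thesis using *(4) by simp
      qed
    qed
  qed
  thus ?thesis by (auto simp: factorial_in_def)
qed

text \<open>Needed to carry factoriality over to \<open>mp_carrier (Suc n)\<close>, which is the
  image of the polynomials over \<open>mp_carrier n\<close> under evaluation at the last
  variable.\<close>

lemma factorial_in_image:
  assumes B: "subring_of B" "factorial_in B"
    and h: "\<And>a b. a \<in> B \<Longrightarrow> b \<in> B \<Longrightarrow> h (a * b) = h a * h b" "h 1 = 1" "h 0 = 0" "inj_on h B"
  shows "factorial_in (h ` B)"
proof -
  have unit: "unit_in (h ` B) (h u)" if "unit_in B u" for u
    using that h(1)[of u] h(2) by (auto simp: unit_in_def) metis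
  have unit': "unit_in B u" if "unit_in (h ` B) (h u)" "u \<in> B" for u
  proof -
    from that obtain v where v: "v \<in> B" "h u * h v = 1" by (auto simp: unit_in_def)
    hence "h (u * v) = h 1" using h that by simp
    hence "u * v = 1" using h(4) that v B(1) by (auto dest!: inj_onD intro: subring_of_closed)
    thus ?thesis using v that by (auto simp: unit_in_def)
  qed
  have dvd: "dvd_in (h ` B) (h a) (h b) \<longleftrightarrow> dvd_in B a b" if "a \<in> B" "b \<in> B" for a b
  proof
    assume "dvd_in B a b" thus "dvd_in (h ` B) (h a) (h b)" using h(1) that by (auto simp: dvd_in_def)
  next
    assume "dvd_in (h ` B) (h a) (h b)"
    then obtain c where c: "c \<in> B" "h b = h a * h c" by (auto simp: dvd_in_def)
    hence "h b = h (a * c)" using h that by simp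
    hence "b = a * c" using h(4) that c B(1) by (auto dest!: inj_onD intro: subring_of_closed)
    thus "dvd_in B a b" using c by (auto simp: dvd_in_def)
  qed
  have prime: "prime_in (h ` B) (h q)" if "prime_in B q" for q
  proof -
    have q: "q \<in> B" "q \<noteq> 0" "\<not> unit_in B q" using that by (auto simp: prime_in_def)
    have "h q \<noteq> 0" using inj_onD[OF h(4), of q 0] h(3) q subring_of_closed(1)[OF B(1)] by auto
    moreover have "dvd_in (h ` B) (h q) x \<or> dvd_in (h ` B) (h q) y"
      if xy: "x \<in> h ` B" "y \<in> h ` B" "dvd_in (h ` B) (h q) (x * y)" for x y
    proof -
      obtain a b where ab: "a \<in> B" "b \<in> B" "x = h a" "y = h b" using xy by auto
      hence "dvd_in B q (a * b)" using xy(3) q dvd[of q "a * b"] h(1) subring_of_closed(4)[OF B(1)] by simp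
      thus ?thesis using \<open>prime_in B q\<close> ab q dvd by (auto simp: prime_in_def)
    qed
    ultimately show ?thesis using q unit' by (auto simp: prime_in_def)
  qed
  have "\<exists>v R. unit_in (h ` B) v \<and> (\<forall>q\<in>set R. prime_in (h ` B) q) \<and> h a = v * prod_list R"
    if a: "a \<in> B" "h a \<noteq> 0" for a
  proof -
    have "a \<noteq> 0" using a h(3) by auto
    then obtain u Q where Q: "unit_in B u" "\<forall>q\<in>set Q. prime_in B q" "a = u * prod_list Q"
      using B(2) a unfolding factorial_in_def by blast
    have QB: "set Q \<subseteq> B" using Q by (auto simp: prime_in_def)
    hence "h (prod_list Q) = prod_list (map h Q)"
      by (induction Q) (auto simp: h subring_of_prod_list[OF B(1)])
    hence "h a = h u * prod_list (map h Q)" using Q h(1) QB subring_of_prod_list[OF B(1)] by (simp add: unit_in_def)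
    thus ?thesis using unit[OF Q(1)] prime Q(2) by (intro exI[of _ "h u"] exI[of _ "map h Q"]) auto
  qed
  thus ?thesis by (auto simp: factorial_in_def)
qed

section \<open>Algebraic integers\<close>

text \<open>The determinant trick: the numbers \<open>g i\<close> form an eigenvector with
  eigenvalue \<open>z\<close> of an integer matrix, so \<open>z\<close> is a root of a monic
  integral characteristic polynomial.\<close>

lemma algebraic_int_of_span:
  fixes g :: "nat \<Rightarrow> complex" and z :: complex
  assumes nz: "i0 < n" "g i0 \<noteq> 0" and "\<And>i. i < n \<Longrightarrow> \<exists>a::nat \<Rightarrow> int. z * g i = (\<Sum>j<n. of_int (a j) * g j)"
  shows "algebraic_int z"
proof -
  from assms obtain a :: "nat \<Rightarrow> nat \<Rightarrow> int" where a: "\<And>i. i < n \<Longrightarrow> z * g i = (\<Sum>j<n. of_int (a i j) * g j)"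
    by metis
  define A where "A = mat n n (\<lambda>(i, j). a i j)"
  define B where "B = map_mat (of_int :: int \<Rightarrow> complex) A"
  have A: "A \<in> carrier_mat n n" and B: "B \<in> carrier_mat n n" by (auto simp: A_def B_def)
  have "eigenvector B (vec n g) z" unfolding eigenvector_def
  proof (intro conjI)
    show "vec n g \<noteq> 0\<^sub>v (dim_row B)"
    proof
      assume "vec n g = 0\<^sub>v (dim_row B)"
      hence "Matrix.vec n g $ i0 = 0\<^sub>v (dim_row B) $ i0" by simp
      thus False using nz B by (auto simp: index_vec)
    qed
    show "B *\<^sub>v vec n g = z \<cdot>\<^sub>v vec n g"
      by (rule eq_vecI) (auto simp: B_def A_def scalar_prod_def a atLeast0LessThan)
  qed (use B in auto)
  hence "eigenvalue B z" by (auto simp: eigenvalue_def)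
  hence "poly (char_poly B) z = 0" using eigenvalue_root_char_poly[OF B] by blast
  moreover have "char_poly B = map_poly of_int (char_poly A)"
    unfolding B_def by (rule of_int_hom.char_poly_hom[OF A])
  moreover have "lead_coeff (char_poly B) = 1" using degree_monic_char_poly[OF B] by simp
  ultimately show ?thesis
    by (intro algebraic_int.intros[of "char_poly B"]) auto
qed

definition zspan :: "complex set \<Rightarrow> complex set" where
  "zspan G = {x. \<exists>a::complex \<Rightarrow> int. x = (\<Sum>g\<in>G. of_int (a g) * g)}"

definition fg_ring :: "complex set \<Rightarrow> bool" where
  "fg_ring R \<longleftrightarrow> subring_of R \<and> (\<exists>G. finite G \<and> G \<subseteq> R \<and> R \<subseteq> zspan G)"

lemma zspan_0: "0 \<in> zspan G"
  unfolding zspan_def by (auto intro!: exI[of _ "\<lambda>_. 0"])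

lemma zspan_add: "x \<in> zspan G \<Longrightarrow> y \<in> zspan G \<Longrightarrow> x + y \<in> zspan G"
proof -
  assume "x \<in> zspan G" "y \<in> zspan G"
  then obtain a b where "x = (\<Sum>g\<in>G. of_int (a g) * g)" "y = (\<Sum>g\<in>G. of_int (b g) * g)" by (auto simp: zspan_def)
  thus ?thesis unfolding zspan_def by (auto intro!: exI[of _ "\<lambda>g. a g + b g"] simp: algebra_simps sum.distrib)
qed

lemma zspan_scale: "x \<in> zspan G \<Longrightarrow> of_int k * x \<in> zspan G"
proof -
  assume "x \<in> zspan G"
  then obtain a where "x = (\<Sum>g\<in>G. of_int (a g) * g)" by (auto simp: zspan_def)
  thus ?thesis unfolding zspan_def
    by (auto intro!: exI[of _ "\<lambda>g. k * a g"] simp: sum_distrib_left mult.assoc)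
qed

lemma zspan_sum: "(\<And>i. i \<in> I \<Longrightarrow> f i \<in> zspan G) \<Longrightarrow> sum f I \<in> zspan G"
  by (induction I rule: infinite_finite_induct) (auto intro: zspan_0 zspan_add)

lemma zspan_base: "finite G \<Longrightarrow> g \<in> G \<Longrightarrow> g \<in> zspan G"
  unfolding zspan_def
  by (auto intro!: exI[of _ "\<lambda>h. if h = g then 1 else 0"] simp: if_distrib if_distribR sum.delta cong: if_cong)

lemma fg_ring_algebraic_int:
  assumes R: "fg_ring R" and x: "x \<in> R"
  shows "algebraic_int x"
proof -
  from R obtain G where sub: "subring_of R" and G: "finite G" "G \<subseteq> R" "R \<subseteq> zspan G" by (auto simp: fg_ring_def)
  obtain g where g: "bij_betw g {..<card G} G" using ex_bij_betw_nat_finite[OF G(1)] by (auto simp: atLeast0LessThan)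
  \<comment> \<open>An eigenvector must not be zero; the generators do not all vanish because they
    span 1.\<close>
  have "\<exists>h\<in>G. h \<noteq> 0"
  proof (rule ccontr)
    assume "\<not> ?thesis"
    hence "\<And>y. y \<in> zspan G \<Longrightarrow> y = 0" by (auto simp: zspan_def intro!: sum.neutral)
    moreover have "1 \<in> zspan G" using subring_of_closed(2)[OF sub] G by blast
    ultimately show False by (metis one_neq_zero)
  qed
  then obtain i0 where i0: "i0 < card G" "g i0 \<noteq> 0" using g by (metis bij_betw_iff_bijections lessThan_iff)
  show ?thesis
  proof (rule algebraic_int_of_span[of i0 "card G" g, OF i0])
    fix i assume "i < card G"
    hence "g i \<in> G" using g by (auto simp: bij_betw_def)
    hence "x * g i \<in> zspan G" using x G subring_of_closed(4)[OF sub] by blast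
    then obtain a where "x * g i = (\<Sum>h\<in>G. of_int (a h) * h)" by (auto simp: zspan_def)
    also have "\<dots> = (\<Sum>j<card G. of_int (a (g j)) * g j)"
      using sum.reindex_bij_betw[OF g, of "\<lambda>h. of_int (a h) * h"] by simp
    finally show "\<exists>a::nat \<Rightarrow> int. x * g i = (\<Sum>j<card G. of_int (a j) * g j)"
      by (intro exI[of _ "\<lambda>j. a (g j)"])
  qed
qed

text \<open>Division by the monic \<open>p\<close> reduces every polynomial expression in
  \<open>x\<close> to degree below \<open>degree p\<close>; hence the products of the old generators
  with these finitely many powers of \<open>x\<close> span the larger ring over the
  integers.\<close>

lemma fg_ring_adjoin:
  assumes R: "fg_ring R" and p: "lead_coeff p = 1" "p \<in> polys_over R" "poly p x = 0"
  shows "\<exists>R'. fg_ring R' \<and> R \<subseteq> R' \<and> x \<in> R'"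
proof -
  from R obtain G where sub: "subring_of R" and G: "finite G" "G \<subseteq> R" "R \<subseteq> zspan G" by (auto simp: fg_ring_def)
  note P = subring_of_polys_over[OF sub]
  define R' where "R' = (\<lambda>q. poly q x) ` polys_over R"
  define G' where "G' = (\<lambda>(g, j). g * x ^ j) ` (G \<times> {..<degree p})"
  have RR': "R \<subseteq> R'"
  proof
    fix r assume "r \<in> R"
    thus "r \<in> R'" unfolding R'_def by (intro image_eqI[of _ _ "[:r:]"] const_in_polys_over[OF sub]) auto
  qed
  have xR': "x \<in> R'" unfolding R'_def
    by (intro image_eqI[of _ _ "monom 1 1"] monom_in_polys_over[OF sub] subring_of_closed(2)[OF sub]) (auto simp: poly_monom)
  have sub': "subring_of R'" unfolding subring_of_def
  proof (intro conjI ballI)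
    show "1 \<in> R'" using RR' subring_of_closed(2)[OF sub] by blast
    fix a b assume "a \<in> R'" "b \<in> R'"
    then obtain u v where uv: "u \<in> polys_over R" "v \<in> polys_over R" "a = poly u x" "b = poly v x" by (auto simp: R'_def)
    show "a - b \<in> R'" unfolding R'_def uv using uv subring_of_closed(3)[OF P, of u v]
      by (intro image_eqI[of _ _ "u - v"]) auto
    show "a * b \<in> R'" unfolding R'_def uv using uv subring_of_closed(4)[OF P, of u v]
      by (intro image_eqI[of _ _ "u * v"]) auto
  qed
  have finG': "finite G'" using G by (auto simp: G'_def)
  have gx: "r * x ^ j \<in> zspan G'" if "r \<in> R" "j < degree p" for r j
  proof -
    obtain a where "r = (\<Sum>g\<in>G. of_int (a g) * g)" using \<open>r \<in> R\<close> G(3) unfolding zspan_def by blast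
    hence "r * x ^ j = (\<Sum>g\<in>G. of_int (a g) * (g * x ^ j))" by (simp add: sum_distrib_right mult.assoc)
    moreover have "g * x ^ j \<in> zspan G'" if "g \<in> G" for g
      using that \<open>j < degree p\<close> by (intro zspan_base finG') (auto simp: G'_def)
    ultimately show ?thesis by (auto intro!: zspan_sum zspan_scale)
  qed
  have "R' \<subseteq> zspan G'"
  proof
    fix y assume "y \<in> R'"
    then obtain q where q: "q \<in> polys_over R" "y = poly q x" by (auto simp: R'_def)
    have p0: "p \<noteq> 0" using p(1) by auto
    from pseudo_reduce[OF sub p(2) p0 q(1)] obtain m r where r: "r \<in> polys_over R" "q = p * m + r"
      "r = 0 \<or> degree r < degree p" using p(1) by (auto simp: one_pCons)
    have y: "y = poly r x" using q r p by simp
    show "y \<in> zspan G'"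
    proof (cases "r = 0")
      case True thus ?thesis using y zspan_0 by simp
    next
      case False
      hence "degree r < degree p" using r by auto
      thus ?thesis unfolding y poly_altdef using r(1)
        by (intro zspan_sum gx) (auto simp: polys_over_def)
    qed
  qed
  moreover have "G' \<subseteq> R'" unfolding G'_def using G RR' xR'
    by (auto intro!: subring_of_closed(4)[OF sub'] subring_of_power[OF sub'])
  ultimately have "fg_ring R'" using sub' finG' by (auto simp: fg_ring_def)
  thus ?thesis using RR' xR' by blast
qed

text \<open>The elements are adjoined to the integers one after another. All closure properties of
  algebraic integers, including closure under roots of monic polynomials, then follow from
  \<open>fg_ring_algebraic_int\<close>.\<close>

lemma fg_ring_algebraic_ints:
  assumes "finite X" "\<And>x. x \<in> X \<Longrightarrow> algebraic_int x"
  shows "\<exists>R. fg_ring R \<and> X \<subseteq> R"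
  using assms
proof (induction X rule: finite_induct)
  case empty
  have "fg_ring \<int>" unfolding fg_ring_def subring_of_def
    by (intro conjI exI[of _ "{1}"]) (auto simp: zspan_def elim!: Ints_cases intro: exI[of _ "\<lambda>_. _::int"])
  thus ?case by blast
next
  case (insert x X)
  then obtain R where R: "fg_ring R" "X \<subseteq> R" by auto
  have "algebraic_int x" using insert by auto
  then obtain p where p: "lead_coeff p = 1" "\<forall>i. coeff p i \<in> \<int>" "poly p x = 0" by (auto elim: algebraic_int.cases)
  have sub: "subring_of R" using R by (simp add: fg_ring_def)
  have nat: "of_nat n \<in> R" for n by (induction n) (auto intro: subring_of_closed(1,2,6)[OF sub])
  have "of_int k \<in> R" for k
    by (cases k rule: int_cases) (auto intro: nat subring_of_closed(5)[OF sub] simp del: of_nat_Suc)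
  hence "p \<in> polys_over R" using p(2) by (auto simp: polys_over_def elim!: Ints_cases) (metis Ints_cases)
  from fg_ring_adjoin[OF R(1) p(1) this p(3)] show ?case using R by blast
qed

lemma algebraic_int_monic_root:
  fixes x :: complex
  assumes "lead_coeff p = 1" "\<And>i. algebraic_int (coeff p i)" "poly p x = 0"
  shows "algebraic_int x"
proof -
  have "\<exists>R. fg_ring R \<and> insert 0 (set (coeffs p)) \<subseteq> R"
    using assms(2) by (intro fg_ring_algebraic_ints) (auto simp: coeffs_def split: if_splits)
  then obtain R where R: "fg_ring R" "insert 0 (set (coeffs p)) \<subseteq> R" by blast
  have "p \<in> polys_over R" unfolding polys_over_def using R(2)
    by (auto simp: coeffs_def) (metis (no_types, lifting) R(2) coeff_in_coeffs coeff_0 coeff_eq_0 insert_subset le_degree subsetD)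
  from fg_ring_adjoin[OF R(1) assms(1) this assms(3)] show ?thesis using fg_ring_algebraic_int by blast
qed

lemma
  fixes x y :: complex
  assumes "algebraic_int x" "algebraic_int y"
  shows algebraic_int_plus: "algebraic_int (x + y)" and algebraic_int_times: "algebraic_int (x * y)"
    and algebraic_int_diff: "algebraic_int (x - y)"
proof -
  obtain R where R: "fg_ring R" "{x, y} \<subseteq> R" using fg_ring_algebraic_ints[of "{x, y}"] assms by auto
  hence "subring_of R" by (auto simp: fg_ring_def)
  from subring_of_closed[OF this] R have "x + y \<in> R" "x * y \<in> R" "x - y \<in> R" by auto
  thus "algebraic_int (x + y)" "algebraic_int (x * y)" "algebraic_int (x - y)"
    using fg_ring_algebraic_int[OF R(1)] by auto
qed

lemma algebraic_int_of_int [simp]: "algebraic_int (of_int k :: complex)"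
  by (rule int_imp_algebraic_int) auto

lemma algebraic_int_1 [simp]: "algebraic_int (1 :: complex)"
  by (rule int_imp_algebraic_int) auto

lemma algebraic_int_of_nat [simp]: "algebraic_int (of_nat k :: complex)"
  by (rule int_imp_algebraic_int) auto

lemma subring_of_algebraic_ints: "subring_of {x::complex. algebraic_int x}"
  unfolding subring_of_def by (auto intro: algebraic_int_diff algebraic_int_times)

lemma algebraic_int_sum: "(\<And>i. i \<in> I \<Longrightarrow> algebraic_int (f i :: complex)) \<Longrightarrow> algebraic_int (sum f I)"
  using subring_of_sum[OF subring_of_algebraic_ints, of I f] by auto

lemma algebraic_int_prod: "(\<And>i. i \<in> I \<Longrightarrow> algebraic_int (f i :: complex)) \<Longrightarrow> algebraic_int (prod f I)"
  using subring_of_prod[OF subring_of_algebraic_ints, of I f] by auto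

lemma algebraic_int_power: "algebraic_int (x :: complex) \<Longrightarrow> algebraic_int (x ^ n)"
  using subring_of_power[OF subring_of_algebraic_ints, of x n] by auto

text \<open>With \<open>a\<close> the leading coefficient and \<open>n\<close> the degree,
  multiplying the equation by \<open>a ^ (n - 1)\<close> turns it into the monic equation
  \<open>q\<close> for \<open>a * x\<close>, and the coefficients remain algebraic integers.\<close>

lemma algebraic_int_lead_coeff_times_root:
  fixes f :: "complex poly"
  assumes f: "\<And>i. algebraic_int (coeff f i)" "f \<noteq> 0" "poly f x = 0"
  shows "algebraic_int (lead_coeff f * x)"
proof -
  define n where "n = degree f"
  define a where "a = lead_coeff f"
  have n: "n > 0" using f by (auto simp: n_def intro!: gr0I) (metis degree_eq_zeroE poly_const_conv poly_0 pCons_0_0 poly_pCons mult_zero_right add.right_neutral)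
  define q where "q = monom 1 n + (\<Sum>i<n. monom (a ^ (n - 1 - i) * coeff f i) i)"
  have cq: "coeff q i = (if i = n then 1 else if i < n then a ^ (n - 1 - i) * coeff f i else 0)" for i
  proof -
    have "(\<Sum>j<n. coeff (monom (a ^ (n - 1 - j) * coeff f j) j) i) = (\<Sum>j<n. if j = i then a ^ (n - 1 - i) * coeff f i else 0)"
      by (rule sum.cong) auto
    thus ?thesis by (simp add: q_def coeff_sum)
  qed
  have "degree q = n"
    by (rule antisym[OF degree_le le_degree]) (auto simp: cq)
  hence "lead_coeff q = 1" by (simp add: cq)
  moreover have "algebraic_int (coeff q i)" for i
    using f(1) by (auto simp: cq a_def intro!: algebraic_int_times algebraic_int_power)
  moreover have "poly q (a * x) = 0"
  proof -
    have "poly q (a * x) = (a * x) ^ n + (\<Sum>i<n. a ^ (n - 1 - i) * coeff f i * (a * x) ^ i)"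
      by (simp add: q_def poly_sum poly_monom)
    also have "(a * x) ^ n = a ^ (n - 1) * (coeff f n * x ^ n)" using n
      by (cases n) (auto simp: a_def n_def power_mult_distrib)
    also have "(\<Sum>i<n. a ^ (n - 1 - i) * coeff f i * (a * x) ^ i) = (\<Sum>i<n. a ^ (n - 1) * (coeff f i * x ^ i))"
    proof (rule sum.cong)
      fix i assume "i \<in> {..<n}"
      hence "a ^ (n - 1) = a ^ (n - 1 - i) * a ^ i" by (simp flip: power_add)
      thus "a ^ (n - 1 - i) * coeff f i * (a * x) ^ i = a ^ (n - 1) * (coeff f i * x ^ i)"
        by (simp add: power_mult_distrib mult_ac)
    qed auto
    also have "a ^ (n - 1) * (coeff f n * x ^ n) + (\<Sum>i<n. a ^ (n - 1) * (coeff f i * x ^ i)) = a ^ (n - 1) * poly f x"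
      by (simp add: poly_altdef n_def[symmetric] lessThan_Suc_atMost[symmetric] distrib_left sum_distrib_left)
    finally show ?thesis using f by simp
  qed
  ultimately show ?thesis unfolding a_def[symmetric] by (rule algebraic_int_monic_root)
qed

lemma algebraic_imp_scaled_algebraic_int:
  fixes x :: complex
  assumes "algebraic x"
  shows "\<exists>c::nat. c > 0 \<and> algebraic_int (of_nat c * x)"
proof -
  from assms obtain p where p: "\<And>i. coeff p i \<in> \<int>" "p \<noteq> 0" "poly p x = 0" by (elim algebraicE) blast
  have ai: "algebraic_int (coeff p i)" for i using p(1) by (intro int_imp_algebraic_int)
  obtain k where k: "lead_coeff p = of_int k" using p(1)[of "degree p"] by (auto elim: Ints_cases)
  have "algebraic_int (of_int k * x)" using algebraic_int_lead_coeff_times_root[OF ai p(2,3)] unfolding k .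
  hence "algebraic_int (of_int (sgn k) * (of_int k * x))" by (rule algebraic_int_times[OF algebraic_int_of_int])
  moreover have "of_int (sgn k) * (of_int k * x) = of_nat (nat \<bar>k\<bar>) * x"
    by (cases "k \<ge> 0") (auto simp: sgn_if)
  moreover have "k \<noteq> 0" using k p(2) by auto
  ultimately show ?thesis by (intro exI[of _ "nat \<bar>k\<bar>"]) auto
qed

lemma scaled_algebraic:
  fixes x :: complex
  assumes "algebraic (of_nat c * x)" "c > 0"
  shows "algebraic x"
proof -
  from assms obtain p where p: "\<And>i. coeff p i \<in> \<int>" "p \<noteq> 0" "poly p (of_nat c * x) = 0" by (elim algebraicE) blast
  have "coeff (pcompose p [:0, of_nat c:]) i = coeff p i * of_nat c ^ i" for i
    by (metis coeff_pcompose_linear mult.commute)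
  thus ?thesis using p assms(2)
    by (intro algebraicI[of "pcompose p [:0, of_nat c:]"]) (auto simp: poly_pcompose pcompose_eq_0_iff mult.commute)
qed

lemma
  fixes x y :: complex
  assumes "algebraic x" "algebraic y"
  shows algebraic_plus: "algebraic (x + y)" and algebraic_times: "algebraic (x * y)"
    and algebraic_diff: "algebraic (x - y)"
proof -
  obtain c d :: nat where cd: "c > 0" "d > 0" "algebraic_int (of_nat c * x)" "algebraic_int (of_nat d * y)"
    using assms algebraic_imp_scaled_algebraic_int by metis
  have "algebraic_int (of_nat d * (of_nat c * x) + of_nat c * (of_nat d * y))"
       "algebraic_int (of_nat d * (of_nat c * x) - of_nat c * (of_nat d * y))"
       "algebraic_int ((of_nat c * x) * (of_nat d * y))"
    by (rule algebraic_int_plus algebraic_int_diff algebraic_int_times algebraic_int_of_nat cd)+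
  moreover have "of_nat d * (of_nat c * x) + of_nat c * (of_nat d * y) = of_nat (c * d) * (x + y)"
    "of_nat d * (of_nat c * x) - of_nat c * (of_nat d * y) = of_nat (c * d) * (x - y)"
    "(of_nat c * x) * (of_nat d * y) = of_nat (c * d) * (x * y)"
    by (simp_all add: algebra_simps)
  ultimately have "algebraic_int (of_nat (c * d) * (x + y))" "algebraic_int (of_nat (c * d) * (x - y))"
        "algebraic_int (of_nat (c * d) * (x * y))" by metis+
  thus "algebraic (x + y)" "algebraic (x * y)" "algebraic (x - y)"
    using cd by (auto intro: scaled_algebraic[of "c * d"] algebraic_int_imp_algebraic simp del: of_nat_mult)
qed

lemma subring_of_algebraics: "subring_of {x::complex. algebraic x}"
  unfolding subring_of_def by (auto intro: algebraic_diff algebraic_times algebraic_int_imp_algebraic)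

section \<open>Representatives of rational maps\<close>

definition mon_eval :: "(nat \<Rightarrow> 'a::comm_ring_1) \<Rightarrow> (nat \<Rightarrow>\<^sub>0 nat) \<Rightarrow> 'a" where
  "mon_eval x m = (\<Prod>i\<in>Poly_Mapping.keys m. x i ^ Poly_Mapping.lookup m i)"

text \<open>A common form of \<open>mp_eval\<close>, of \<open>mp_subst\<close> and of the grading
  \<open>deg_poly\<close>, which differ in what happens to coefficients and variables; the
  homomorphism laws are thus proved only once, in the locale \<open>coeff_hom\<close>.\<close>

definition mp_ins :: "(complex \<Rightarrow> 'a::comm_ring_1) \<Rightarrow> (nat \<Rightarrow> 'a) \<Rightarrow> mpoly \<Rightarrow> 'a" where
  "mp_ins c x p = (\<Sum>m\<in>Poly_Mapping.keys p. c (Poly_Mapping.lookup p m) * mon_eval x m)"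

lemma mp_eval_conv_ins: "mp_eval p x = mp_ins (\<lambda>a. a) x p"
  by (simp add: mp_eval_def mp_ins_def mon_eval_def)

lemma mp_subst_conv_ins: "mp_subst p F = mp_ins mp_const F p"
  by (simp add: mp_subst_def mp_ins_def mon_eval_def)

lemma mon_eval_superset:
  assumes "finite J" "Poly_Mapping.keys m \<subseteq> J"
  shows "mon_eval x m = (\<Prod>i\<in>J. x i ^ Poly_Mapping.lookup m i)"
  unfolding mon_eval_def using assms
  by (intro prod.mono_neutral_left) (auto simp: in_keys_iff)

lemma mon_eval_0 [simp]: "mon_eval x 0 = 1"
  by (simp add: mon_eval_def)

lemma mon_eval_add: "mon_eval x (m + m') = mon_eval x m * mon_eval x m'"
proof -
  let ?J = "Poly_Mapping.keys m \<union> Poly_Mapping.keys m'"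
  have "mon_eval x (m + m') = (\<Prod>i\<in>?J. x i ^ Poly_Mapping.lookup (m + m') i)"
    using keys_add[of m m'] by (intro mon_eval_superset) auto
  also have "\<dots> = (\<Prod>i\<in>?J. x i ^ Poly_Mapping.lookup m i) * (\<Prod>i\<in>?J. x i ^ Poly_Mapping.lookup m' i)"
    by (simp add: lookup_add power_add prod.distrib)
  also have "(\<Prod>i\<in>?J. x i ^ Poly_Mapping.lookup m i) = mon_eval x m" by (rule mon_eval_superset[symmetric]) auto
  also have "(\<Prod>i\<in>?J. x i ^ Poly_Mapping.lookup m' i) = mon_eval x m'" by (rule mon_eval_superset[symmetric]) auto
  finally show ?thesis .
qed

lemma mpoly_decompose: "(p::mpoly) = (\<Sum>m\<in>Poly_Mapping.keys p. Poly_Mapping.single m (Poly_Mapping.lookup p m))"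
  by (rule poly_mapping_eqI) (auto simp: lookup_sum lookup_single when_def sum.delta in_keys_iff)

locale coeff_hom =
  fixes c :: "complex \<Rightarrow> 'a::comm_ring_1"
  assumes add: "c (a + b) = c a + c b" and mult: "c (a * b) = c a * c b" and one: "c 1 = 1"
begin

lemma zero: "c 0 = 0" using add[of 0 0] by simp

lemma ins_superset:
  assumes "finite J" "Poly_Mapping.keys p \<subseteq> J"
  shows "mp_ins c x p = (\<Sum>m\<in>J. c (Poly_Mapping.lookup p m) * mon_eval x m)"
  unfolding mp_ins_def using assms
  by (intro sum.mono_neutral_left) (auto simp: in_keys_iff zero)

lemma ins_0 [simp]: "mp_ins c x 0 = 0" by (simp add: mp_ins_def)

lemma ins_add: "mp_ins c x (p + q) = mp_ins c x p + mp_ins c x q"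
proof -
  let ?J = "Poly_Mapping.keys p \<union> Poly_Mapping.keys q"
  have "mp_ins c x (p + q) = (\<Sum>m\<in>?J. c (Poly_Mapping.lookup (p + q) m) * mon_eval x m)"
    using keys_add[of p q] by (intro ins_superset) auto
  also have "\<dots> = (\<Sum>m\<in>?J. c (Poly_Mapping.lookup p m) * mon_eval x m) + (\<Sum>m\<in>?J. c (Poly_Mapping.lookup q m) * mon_eval x m)"
    by (simp add: lookup_add add algebra_simps sum.distrib)
  also have "(\<Sum>m\<in>?J. c (Poly_Mapping.lookup p m) * mon_eval x m) = mp_ins c x p" by (rule ins_superset[symmetric]) auto
  also have "(\<Sum>m\<in>?J. c (Poly_Mapping.lookup q m) * mon_eval x m) = mp_ins c x q" by (rule ins_superset[symmetric]) auto
  finally show ?thesis .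
qed

lemma ins_single: "mp_ins c x (Poly_Mapping.single m a) = c a * mon_eval x m"
  by (simp add: mp_ins_def zero)

lemma ins_sum: "mp_ins c x (sum f I) = (\<Sum>i\<in>I. mp_ins c x (f i))"
  by (induction I rule: infinite_finite_induct) (auto simp: ins_add)

lemma ins_mult: "mp_ins c x (p * q) = mp_ins c x p * mp_ins c x q"
proof -
  have "p * q = (\<Sum>m\<in>Poly_Mapping.keys p. \<Sum>m'\<in>Poly_Mapping.keys q.
      Poly_Mapping.single (m + m') (Poly_Mapping.lookup p m * Poly_Mapping.lookup q m'))"
    by (subst (1) mpoly_decompose[of p], subst (1) mpoly_decompose[of q]) (simp add: sum_product mult_single)
  hence "mp_ins c x (p * q) = (\<Sum>m\<in>Poly_Mapping.keys p. \<Sum>m'\<in>Poly_Mapping.keys q.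
     (c (Poly_Mapping.lookup p m) * mon_eval x m) * (c (Poly_Mapping.lookup q m') * mon_eval x m'))"
    by (simp add: ins_sum ins_single mon_eval_add mult mult_ac)
  thus ?thesis by (simp add: mp_ins_def sum_product)
qed

lemma ins_1: "mp_ins c x 1 = 1"
  using ins_single[of x 0 1] one by simp

lemma ins_power: "mp_ins c x (p ^ n) = mp_ins c x p ^ n"
  by (induction n) (auto simp: ins_1 ins_mult)

lemma ins_prod: "mp_ins c x (prod f I) = (\<Prod>i\<in>I. mp_ins c x (f i))"
  by (induction I rule: infinite_finite_induct) (auto simp: ins_1 ins_mult)

lemma ins_mon_eval: "mp_ins c x (mon_eval F m) = mon_eval (\<lambda>i. mp_ins c x (F i)) m"
  by (simp add: mon_eval_def ins_prod ins_power)

end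

interpretation ident: coeff_hom "\<lambda>a. a"
  by unfold_locales auto

interpretation const: coeff_hom mp_const
  by unfold_locales (auto simp: mp_const_def single_add mult_single)

lemmas mp_eval_mult = ident.ins_mult[folded mp_eval_conv_ins]
lemmas mp_eval_1 = ident.ins_1[folded mp_eval_conv_ins]

lemma mp_eval_subst: "mp_eval (mp_subst p F) x = mp_eval p (\<lambda>i. mp_eval (F i) x)"
proof -
  have "mp_ins (\<lambda>a. a) x (mp_ins mp_const F p) =
     (\<Sum>m\<in>Poly_Mapping.keys p. mp_ins (\<lambda>a. a) x (mp_const (Poly_Mapping.lookup p m)) * mp_ins (\<lambda>a. a) x (mon_eval F m))"
    by (simp add: mp_ins_def[of mp_const] ident.ins_sum ident.ins_mult)
  also have "\<dots> = mp_ins (\<lambda>a. a) (\<lambda>i. mp_ins (\<lambda>a. a) x (F i)) p"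
    by (simp add: mp_ins_def[of "\<lambda>a. a" _ p] ident.ins_mon_eval mp_const_def ident.ins_single)
  finally show ?thesis by (simp add: mp_eval_conv_ins mp_subst_conv_ins)
qed

section \<open>The factorial ring of polynomials with algebraic coefficients\<close>

definition mp_carrier :: "nat \<Rightarrow> mpoly set" where
  "mp_carrier n = {p. \<forall>m\<in>Poly_Mapping.keys p. Poly_Mapping.keys m \<subseteq> {..<n} \<and> algebraic (Poly_Mapping.lookup p m)}"

definition mp_hom :: "nat \<Rightarrow> mpoly set" where
  "mp_hom d = {p. \<forall>m\<in>Poly_Mapping.keys p. mon_deg m = d}"

lemma hom_poly_iff: "hom_poly N d p \<longleftrightarrow> p \<in> mp_carrier (Suc N) \<and> p \<in> mp_hom d"
  by (auto simp: hom_poly_def mp_carrier_def mp_hom_def lessThan_Suc_atMost atLeast0AtMost)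

lemma algebraic_lookup: "p \<in> mp_carrier n \<Longrightarrow> algebraic (Poly_Mapping.lookup p m)"
  by (cases "m \<in> Poly_Mapping.keys p") (auto simp: mp_carrier_def in_keys_iff)

lemma single_in_mp_carrier:
  "algebraic a \<Longrightarrow> Poly_Mapping.keys m \<subseteq> {..<n} \<Longrightarrow> Poly_Mapping.single m a \<in> mp_carrier n"
  by (auto simp: mp_carrier_def split: if_splits)

lemma mp_carrier_add: assumes "p \<in> mp_carrier n" "q \<in> mp_carrier n" shows "p + q \<in> mp_carrier n"
  unfolding mp_carrier_def
proof (intro CollectI ballI conjI)
  fix m assume "m \<in> Poly_Mapping.keys (p + q)"
  hence "m \<in> Poly_Mapping.keys p \<or> m \<in> Poly_Mapping.keys q" using keys_add[of p q] by auto
  thus "Poly_Mapping.keys m \<subseteq> {..<n}" using assms by (auto simp: mp_carrier_def)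
  show "algebraic (Poly_Mapping.lookup (p + q) m)"
    using assms by (simp add: lookup_add algebraic_plus algebraic_lookup)
qed

lemma mp_carrier_sum: "(\<And>i. i \<in> I \<Longrightarrow> f i \<in> mp_carrier n) \<Longrightarrow> sum f I \<in> mp_carrier n"
proof (induction I rule: infinite_finite_induct)
  case (insert x F) thus ?case by (simp add: mp_carrier_add)
qed (auto simp: mp_carrier_def)

lemma subring_of_mp_carrier: "subring_of (mp_carrier n)"
  unfolding subring_of_def
proof (intro conjI ballI)
  show "1 \<in> mp_carrier n" using single_in_mp_carrier[of 1 0 n] by (simp add: algebraic_int_imp_algebraic)
  fix p q assume p: "p \<in> mp_carrier n" "q \<in> mp_carrier n"
  have "- q \<in> mp_carrier n" using p(2) by (auto simp: mp_carrier_def in_keys_iff)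
  from mp_carrier_add[OF p(1) this] show "p - q \<in> mp_carrier n" by simp
  have "p * q = (\<Sum>m\<in>Poly_Mapping.keys p. \<Sum>m'\<in>Poly_Mapping.keys q.
      Poly_Mapping.single (m + m') (Poly_Mapping.lookup p m * Poly_Mapping.lookup q m'))"
    by (subst (1) mpoly_decompose[of p], subst (1) mpoly_decompose[of q]) (simp add: sum_product mult_single)
  also have "\<dots> \<in> mp_carrier n"
  proof (intro mp_carrier_sum single_in_mp_carrier)
    fix m m' assume "m \<in> Poly_Mapping.keys p" "m' \<in> Poly_Mapping.keys q"
    thus "Poly_Mapping.keys (m + m') \<subseteq> {..<n}" using keys_add[of m m'] p by (fastforce simp: mp_carrier_def)
    show "algebraic (Poly_Mapping.lookup p m * Poly_Mapping.lookup q m')"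
      using p by (intro algebraic_times algebraic_lookup)
  qed
  finally show "p * q \<in> mp_carrier n" .
qed

text \<open>\<open>mp_carrier (Suc n)\<close> is the polynomial ring in the transcendental element \<open>mp_var n\<close> over \<open>mp_carrier n\<close>.\<close>
lemma mp_var_power: "mp_var n ^ j = Poly_Mapping.single (Poly_Mapping.single n j) 1"
proof (induction j)
  case (Suc j)
  show ?case by (simp add: Suc, simp add: mp_var_def mult_single single_add[symmetric])
qed simp

lemma mp_carrier_mono: "p \<in> mp_carrier n \<Longrightarrow> n \<le> k \<Longrightarrow> p \<in> mp_carrier k"
  by (fastforce simp: mp_carrier_def)

lemma poly_mp_var_in: "P \<in> polys_over (mp_carrier n) \<Longrightarrow> poly P (mp_var n) \<in> mp_carrier (Suc n)"
  unfolding poly_altdef mp_var_power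
  by (intro subring_of_sum[OF subring_of_mp_carrier] subring_of_closed(4)[OF subring_of_mp_carrier]
       single_in_mp_carrier)
     (auto simp: algebraic_int_imp_algebraic intro: mp_carrier_mono coeff_in_polys_over split: if_splits)

lemma poly_mp_var_surj:
  assumes "p \<in> mp_carrier (Suc n)"
  shows "\<exists>P\<in>polys_over (mp_carrier n). p = poly P (mp_var n)"
proof -
  define P where "P = (\<Sum>m\<in>Poly_Mapping.keys p.
    monom (Poly_Mapping.single (Poly_Mapping.update n 0 m) (Poly_Mapping.lookup p m)) (Poly_Mapping.lookup m n))"
  have "P \<in> polys_over (mp_carrier n)" unfolding P_def
  proof (intro subring_of_sum[OF subring_of_polys_over] subring_of_mp_carrier monom_in_polys_over single_in_mp_carrier)
    fix m assume "m \<in> Poly_Mapping.keys p"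
    hence "Poly_Mapping.keys m \<subseteq> {..<Suc n}" using assms by (auto simp: mp_carrier_def)
    thus "Poly_Mapping.keys (Poly_Mapping.update n 0 m) \<subseteq> {..<n}"
      by (auto simp: keys_update less_Suc_eq)
    show "algebraic (Poly_Mapping.lookup p m)" using assms by (rule algebraic_lookup)
  qed
  moreover have "poly P (mp_var n) = p"
  proof -
    have "Poly_Mapping.update n 0 m + Poly_Mapping.single n (Poly_Mapping.lookup m n) = m" for m :: "nat \<Rightarrow>\<^sub>0 nat"
      by (rule poly_mapping_eqI) (auto simp: lookup_add lookup_update lookup_single when_def)
    hence "poly P (mp_var n) = (\<Sum>m\<in>Poly_Mapping.keys p. Poly_Mapping.single m (Poly_Mapping.lookup p m))"
      by (simp add: P_def poly_sum poly_monom mp_var_power mult_single)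
    thus ?thesis using mpoly_decompose[of p] by simp
  qed
  ultimately show ?thesis by blast
qed

text \<open>Separating the exponent of the variable \<open>n\<close> in each monomial recovers the
  coefficients of \<open>P\<close> from its value; so \<open>mp_var n\<close> is transcendental over
  \<open>mp_carrier n\<close>.\<close>

lemma lookup_poly_mp_var:
  assumes P: "P \<in> polys_over (mp_carrier n)" and m: "n \<notin> Poly_Mapping.keys m"
  shows "Poly_Mapping.lookup (poly P (mp_var n)) (m + Poly_Mapping.single n j) = Poly_Mapping.lookup (coeff P j) m"
proof -
  have l: "Poly_Mapping.lookup (a * mp_var n ^ i) (m + Poly_Mapping.single n j) = (if i = j then Poly_Mapping.lookup a m else 0)"
    if a: "a \<in> mp_carrier n" for a i
  proof -
    have "a * mp_var n ^ i = (\<Sum>k\<in>Poly_Mapping.keys a. Poly_Mapping.single (k + Poly_Mapping.single n i) (Poly_Mapping.lookup a k))"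
      by (subst (1) mpoly_decompose[of a]) (simp add: mp_var_power sum_distrib_right mult_single)
    hence "Poly_Mapping.lookup (a * mp_var n ^ i) (m + Poly_Mapping.single n j) =
       (\<Sum>k\<in>Poly_Mapping.keys a. if k + Poly_Mapping.single n i = m + Poly_Mapping.single n j then Poly_Mapping.lookup a k else 0)"
      by (simp add: lookup_sum lookup_single when_def)
    also have "\<dots> = (\<Sum>k\<in>Poly_Mapping.keys a. if k = m \<and> i = j then Poly_Mapping.lookup a k else 0)"
    proof (rule sum.cong)
      fix k assume "k \<in> Poly_Mapping.keys a"
      hence "n \<notin> Poly_Mapping.keys k" using a by (auto simp: mp_carrier_def)
      hence "k + Poly_Mapping.single n i = m + Poly_Mapping.single n j \<longleftrightarrow> k = m \<and> i = j"
        using m by (metis add_right_cancel in_keys_iff lookup_add lookup_single_eq add_0)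
      thus "(if k + Poly_Mapping.single n i = m + Poly_Mapping.single n j then Poly_Mapping.lookup a k else 0) =
            (if k = m \<and> i = j then Poly_Mapping.lookup a k else 0)" by simp
    qed simp
    also have "\<dots> = (if i = j then Poly_Mapping.lookup a m else 0)"
      by (auto simp: sum.delta in_keys_iff)
    finally show ?thesis .
  qed
  have "Poly_Mapping.lookup (poly P (mp_var n)) (m + Poly_Mapping.single n j) =
     (\<Sum>i\<le>degree P. if i = j then Poly_Mapping.lookup (coeff P i) m else 0)"
    unfolding poly_altdef lookup_sum using P by (intro sum.cong l) (auto simp: polys_over_def)
  also have "\<dots> = Poly_Mapping.lookup (coeff P j) m"
    by (auto simp: sum.delta coeff_eq_0)
  finally show ?thesis .
qed

lemma inj_on_poly_mp_var: "inj_on (\<lambda>P. poly P (mp_var n)) (polys_over (mp_carrier n))"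
proof (rule inj_onI)
  fix P Q assume PQ: "P \<in> polys_over (mp_carrier n)" "Q \<in> polys_over (mp_carrier n)" "poly P (mp_var n) = poly Q (mp_var n)"
  show "P = Q"
  proof (rule poly_eqI, rule poly_mapping_eqI)
    fix j m
    have z: "Poly_Mapping.lookup a m = 0" if "n \<in> Poly_Mapping.keys m" "a \<in> mp_carrier n" for a
    proof (rule ccontr)
      assume "Poly_Mapping.lookup a m \<noteq> 0"
      hence "m \<in> Poly_Mapping.keys a" by (simp add: in_keys_iff)
      with that show False by (auto simp: mp_carrier_def)
    qed
    show "Poly_Mapping.lookup (coeff P j) m = Poly_Mapping.lookup (coeff Q j) m"
    proof (cases "n \<in> Poly_Mapping.keys m")
      case True thus ?thesis using z PQ by (auto simp: polys_over_def)
    next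
      case False
      thus ?thesis using lookup_poly_mp_var[OF PQ(1) False] lookup_poly_mp_var[OF PQ(2) False] PQ(3) by metis
    qed
  qed
qed

lemma mp_carrier_0_unit:
  assumes "a \<in> mp_carrier 0" "a \<noteq> 0"
  shows "unit_in (mp_carrier 0) a"
proof -
  have "m = 0" if "m \<in> Poly_Mapping.keys a" for m
    using assms(1) that by (auto simp: mp_carrier_def intro!: poly_mapping_eqI)
  hence "Poly_Mapping.lookup a m = 0" if "m \<noteq> 0" for m using that by (auto simp: in_keys_iff)
  hence a: "a = Poly_Mapping.single 0 (Poly_Mapping.lookup a 0)"
    by (intro poly_mapping_eqI) (auto simp: lookup_single when_def)
  define x where "x = Poly_Mapping.lookup a 0"
  have x: "x \<noteq> 0" "algebraic x" using a assms algebraic_lookup by (auto simp: x_def)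
  have "a * Poly_Mapping.single 0 (inverse x) = 1"
    by (subst a) (simp add: x_def[symmetric] mult_single x)
  moreover have "Poly_Mapping.single 0 (inverse x) \<in> mp_carrier 0"
    using x by (intro single_in_mp_carrier) auto
  ultimately show ?thesis using assms by (auto simp: unit_in_def)
qed

text \<open>The coefficients are kept algebraic because dividing a representative by a common prime
  factor must give a representative again, and \<open>hom_poly\<close> asks for algebraic
  coefficients. The induction starts with nonzero constants, which are units.\<close>

theorem factorial_in_mp_carrier: "factorial_in (mp_carrier n)"
proof (induction n)
  case 0
  show ?case unfolding factorial_in_def
  proof (intro ballI impI)
    fix a assume "a \<in> mp_carrier 0" "a \<noteq> 0"
    thus "\<exists>u Q. unit_in (mp_carrier 0) u \<and> (\<forall>q\<in>set Q. prime_in (mp_carrier 0) q) \<and> a = u * prod_list Q"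
      using mp_carrier_0_unit by (intro exI[of _ a] exI[of _ "[]"]) auto
  qed
next
  case (Suc n)
  have "(\<lambda>P. poly P (mp_var n)) ` polys_over (mp_carrier n) = mp_carrier (Suc n)"
    using poly_mp_var_in poly_mp_var_surj by blast
  moreover have "factorial_in ((\<lambda>P. poly P (mp_var n)) ` polys_over (mp_carrier n))"
    by (rule factorial_in_image[OF subring_of_polys_over factorial_in_polys_over])
       (use Suc subring_of_mp_carrier inj_on_poly_mp_var in auto)
  ultimately show ?case by simp
qed


section \<open>Homogeneity through a grading variable\<close>

definition deg_poly :: "mpoly \<Rightarrow> mpoly poly" where
  "deg_poly p = mp_ins (\<lambda>a. [:mp_const a:]) (\<lambda>i. [:0, mp_var i:]) p"

interpretation degp: coeff_hom "\<lambda>a. [:mp_const a:]"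
  by unfold_locales (auto simp: const.add const.mult const.one one_pCons mult.commute)

lemma mon_eval_mp_var: "mon_eval mp_var m = Poly_Mapping.single m 1"
proof -
  have "(\<Prod>i\<in>J. mp_var i ^ f i) = Poly_Mapping.single (\<Sum>i\<in>J. Poly_Mapping.single i (f i)) 1" if "finite J" for J and f :: "nat \<Rightarrow> nat"
    using that by (induction J) (auto simp: mp_var_power mult_single)
  moreover have "(\<Sum>i\<in>Poly_Mapping.keys m. Poly_Mapping.single i (Poly_Mapping.lookup m i)) = m"
    by (rule poly_mapping_eqI) (auto simp: lookup_sum lookup_single when_def sum.delta in_keys_iff)
  ultimately show ?thesis by (simp add: mon_eval_def)
qed

lemma mp_var_nonzero: "mp_var i \<noteq> 0"
  unfolding mp_var_def by (metis lookup_single_eq lookup_zero one_neq_zero)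

lemma deg_poly_altdef:
  "deg_poly p = (\<Sum>m\<in>Poly_Mapping.keys p. monom (Poly_Mapping.single m (Poly_Mapping.lookup p m)) (mon_deg m))"
proof -
  have X: "[:0, a:] = monom a 1" for a :: mpoly by (simp add: monom_Suc monom_0)
  have "(\<Prod>i\<in>J. [:0, mp_var i:] ^ f i) = monom (\<Prod>i\<in>J. mp_var i ^ f i) (\<Sum>i\<in>J. f i)" if "finite J" for J and f :: "nat \<Rightarrow> nat"
    using that by (induction J) (auto simp: X monom_power mult_monom monom_0 one_pCons)
  hence "mon_eval (\<lambda>i. [:0, mp_var i:]) m = monom (mon_eval mp_var m) (mon_deg m)" for m
    by (simp add: mon_eval_def mon_deg_def)
  thus ?thesis
    by (simp add: deg_poly_def mp_ins_def mon_eval_mp_var smult_monom mp_const_def mult_single)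
qed

lemma poly_deg_poly_1: "poly (deg_poly p) 1 = p"
  using mpoly_decompose[of p] by (simp add: deg_poly_altdef poly_sum poly_monom)

text \<open>\<open>deg_poly\<close> replaces every variable \<open>x_i\<close> by
  \<open>T x_i\<close>, so that homogeneous parts become coefficients with respect to
  \<open>T\<close>. As \<open>deg_poly\<close> is multiplicative, homogeneity of products and
  factors is reduced to monomials in one variable.\<close>

lemma mp_hom_iff: "p \<in> mp_hom d \<longleftrightarrow> deg_poly p = monom p d"
proof
  assume "p \<in> mp_hom d"
  hence "deg_poly p = (\<Sum>m\<in>Poly_Mapping.keys p. monom (Poly_Mapping.single m (Poly_Mapping.lookup p m)) d)"
    by (auto simp: deg_poly_altdef mp_hom_def intro!: sum.cong)
  also have "\<dots> = monom (\<Sum>m\<in>Poly_Mapping.keys p. Poly_Mapping.single m (Poly_Mapping.lookup p m)) d"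
    by (rule poly_eqI) (simp add: coeff_sum)
  finally show "deg_poly p = monom p d" using mpoly_decompose[of p] by simp
next
  assume eq: "deg_poly p = monom p d"
  show "p \<in> mp_hom d" unfolding mp_hom_def
  proof (intro CollectI ballI, rule ccontr)
    fix m assume m: "m \<in> Poly_Mapping.keys p" "mon_deg m \<noteq> d"
    have "Poly_Mapping.lookup (coeff (deg_poly p) (mon_deg m)) m =
      (\<Sum>k\<in>Poly_Mapping.keys p. if k = m then Poly_Mapping.lookup p m else 0)"
      unfolding deg_poly_altdef coeff_sum lookup_sum
      by (rule sum.cong) (auto simp: lookup_single when_def)
    also have "\<dots> = Poly_Mapping.lookup p m" using m by simp
    finally have "Poly_Mapping.lookup p m = 0" using m(2) by (simp add: eq)
    thus False using m(1) by (simp add: in_keys_iff)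
  qed
qed

lemma deg_poly_mult: "deg_poly (p * q) = deg_poly p * deg_poly q"
  by (simp add: deg_poly_def degp.ins_mult)

lemma mp_hom_mult: "p \<in> mp_hom d \<Longrightarrow> q \<in> mp_hom e \<Longrightarrow> p * q \<in> mp_hom (d + e)"
  by (simp add: mp_hom_iff deg_poly_mult mult_monom)

lemma mp_hom_0 [simp]: "0 \<in> mp_hom d"
  by (simp add: mp_hom_def)

lemma mp_hom_1: "1 \<in> mp_hom 0"
  by (auto simp: mp_hom_def mon_deg_def)

lemma mp_hom_sum: "(\<And>i. i \<in> I \<Longrightarrow> f i \<in> mp_hom d) \<Longrightarrow> sum f I \<in> mp_hom d"
  by (simp add: mp_hom_iff deg_poly_def degp.ins_sum) (simp add: monom_sum)

lemma mp_hom_power: "p \<in> mp_hom d \<Longrightarrow> p ^ n \<in> mp_hom (n * d)"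
  by (induction n) (auto simp: mp_hom_1 intro: mp_hom_mult)

lemma mp_hom_unique: "p \<in> mp_hom d \<Longrightarrow> p \<in> mp_hom e \<Longrightarrow> p \<noteq> 0 \<Longrightarrow> d = e"
  by (metis degree_monom_eq mp_hom_iff)

text \<open>In the grading variable the product is a monomial, so the orders at 0 of the two factors
  have the same sum as their degrees. An order never exceeds the degree; hence they agree, and each
  factor is a monomial.\<close>

lemma mp_hom_factor:
  assumes "p * q \<in> mp_hom d" "p * q \<noteq> 0"
  shows "\<exists>e. p \<in> mp_hom e"
proof -
  let ?A = "deg_poly p" and ?B = "deg_poly q"
  have eq: "?A * ?B = monom (p * q) d" using assms by (simp add: mp_hom_iff deg_poly_mult)
  have nz: "?A \<noteq> 0" "?B \<noteq> 0" "?A * ?B \<noteq> 0" using assms eq by (auto simp: monom_eq_0_iff)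
  have "order 0 ?A + order 0 ?B = d"
    using order_mult[OF nz(3), of 0] eq assms by (simp add: order_0_monom)
  moreover have "degree ?A + degree ?B = d"
    using degree_mult_eq[OF nz(1,2)] eq assms by (simp add: degree_monom_eq)
  ultimately have "degree ?A \<le> order 0 ?A"
    using order_degree[OF nz(1), of 0] order_degree[OF nz(2), of 0] by linarith
  hence "monom 1 (degree ?A) dvd ?A" using nz by (simp add: monom_1_dvd_iff)
  then obtain k where k: "?A = monom 1 (degree ?A) * k" by (auto elim: dvdE)
  hence "k \<noteq> 0" using nz by auto
  hence "degree ?A = degree ?A + degree k"
    using degree_mult_eq[of "monom (1::mpoly) (degree ?A)" k] k by (metis degree_monom_eq monom_eq_0_iff one_neq_zero)
  hence "degree k = 0" by simp
  then obtain a where a: "k = [:a:]" by (rule degree_eq_zeroE)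
  define n where "n = degree ?A"
  have "monom 1 n * [:a:] = monom a n" by (simp add: mult_monom flip: monom_0)
  hence A: "?A = monom a n" using k unfolding a n_def[symmetric] by metis
  hence "a = p" using poly_deg_poly_1[of p] by (simp add: poly_monom)
  thus ?thesis using A mp_hom_iff by blast
qed

lemma unit_in_mp_carrier_hom_0:
  assumes "q \<in> mp_carrier n" "q \<in> mp_hom 0" "q \<noteq> 0"
  shows "unit_in (mp_carrier n) q"
proof -
  have "m = 0" if "m \<in> Poly_Mapping.keys q" for m
  proof -
    have "mon_deg m = 0" using assms(2) that by (auto simp: mp_hom_def)
    hence "Poly_Mapping.lookup m i = 0" for i by (cases "i \<in> Poly_Mapping.keys m") (auto simp: mon_deg_def in_keys_iff)
    thus ?thesis by (intro poly_mapping_eqI) simp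
  qed
  hence "q \<in> mp_carrier 0" using assms(1) by (auto simp: mp_carrier_def)
  from mp_carrier_0_unit[OF this assms(3)] show ?thesis
    using mp_carrier_mono[of _ 0 n] by (auto simp: unit_in_def)
qed

text \<open>Proportionality of tuples is transitive only through a tuple with a nonzero coordinate,
  here \<open>F k\<close>, whose square is cancelled at the end.\<close>

lemma rep_of_proportional:
  assumes "rep_of N F d G" "rep_of N F e H" "k \<le> N" "F k \<noteq> 0" "i \<le> N" "j \<le> N"
  shows "G i * H j = G j * H i"
proof -
  have G: "G a * F b = G b * F a" if "a \<le> N" "b \<le> N" for a b using assms(1) that by (auto simp: rep_of_def)
  have H: "H a * F b = H b * F a" if "a \<le> N" "b \<le> N" for a b using assms(2) that by (auto simp: rep_of_def)
  have "(G i * H j) * (F k * F k) = (G i * F k) * (H j * F k)" by (simp add: mult_ac)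
  also have "\<dots> = (G k * F i) * (H k * F j)" using G[of i k] H[of j k] assms by simp
  also have "\<dots> = (G k * F j) * (H k * F i)" by (simp add: mult_ac)
  also have "\<dots> = (G j * F k) * (H i * F k)" using G[of j k] H[of i k] assms by simp
  also have "\<dots> = (G j * H i) * (F k * F k)" by (simp add: mult_ac)
  finally show ?thesis using assms(4) by simp
qed

text \<open>A common zero of a representative of minimal degree lies on a prime factor \<open>q\<close> of one coordinate;
  comparing with \<open>H\<close> shows that \<open>q\<close> divides every coordinate, contradicting minimality.\<close>
lemma min_rep_nonvanishing:
  assumes F: "k \<le> N" "F k \<noteq> 0" and G: "rep_of N F (rat_deg N F) G"
    and H: "rep_of N F e H" "i0 \<le> N" "mp_eval (H i0) x \<noteq> 0"
  shows "\<exists>i\<le>N. mp_eval (G i) x \<noteq> 0"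
proof (rule ccontr)
  assume "\<not> ?thesis"
  hence Gx: "mp_eval (G i) x = 0" if "i \<le> N" for i using that by auto
  define A where "A = mp_carrier (Suc N)"
  note A = subring_of_mp_carrier[of "Suc N", folded A_def]
  have pr: "G i * H j = G j * H i" if "i \<le> N" "j \<le> N" for i j
    using rep_of_proportional[OF G H(1) F that] .
  have GA: "G i \<in> A" "G i \<in> mp_hom (rat_deg N F)" if "i \<le> N" for i
    using G that by (auto simp: rep_of_def hom_tuple_def hom_poly_iff A_def)
  have HA: "H i \<in> A" if "i \<le> N" for i
    using H that by (auto simp: rep_of_def hom_tuple_def hom_poly_iff A_def)
  have H0: "H i0 \<noteq> 0" using H(3) by (auto simp: mp_eval_conv_ins)
  obtain i1 where i1: "i1 \<le> N" "G i1 \<noteq> 0" using G by (auto simp: rep_of_def hom_tuple_def)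
  have G0: "G i0 \<noteq> 0"
    using pr[OF i1(1) H(2)] i1(2) H0 by auto
  obtain u Q where uQ: "unit_in A u" "\<forall>q\<in>set Q. prime_in A q" "G i0 = u * prod_list Q"
    using factorial_in_mp_carrier[of "Suc N"] GA(1)[OF H(2)] G0 unfolding factorial_in_def A_def by blast
  obtain v where "u * v = 1" using uQ(1) by (auto simp: unit_in_def)
  hence "mp_eval u x * mp_eval v x = 1" by (metis mp_eval_mult mp_eval_1)
  hence "mp_eval u x \<noteq> 0" by auto
  hence "mp_eval (prod_list Q) x = 0" using Gx[OF H(2)] by (simp add: uQ(3) mp_eval_mult)
  hence "\<exists>q\<in>set Q. mp_eval q x = 0"
    by (induction Q) (auto simp: mp_eval_1 mp_eval_mult)
  then obtain q where q: "q \<in> set Q" "mp_eval q x = 0" by blast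
  have qp: "prime_in A q" using q uQ by auto
  have qA: "q \<in> A" "q \<noteq> 0" "\<not> unit_in A q" using qp by (auto simp: prime_in_def)
  obtain Qa Qb where sp: "Q = Qa @ q # Qb" using q(1) by (meson split_list)
  have dv: "G i0 = q * (u * prod_list (Qa @ Qb))" by (simp add: uQ(3) sp mult_ac)
  have rA: "u * prod_list (Qa @ Qb) \<in> A" using uQ A
    by (intro subring_of_closed subring_of_prod_list) (auto simp: sp unit_in_def prime_in_def)
  have "dvd_in A q (G j)" if j: "j \<le> N" for j
  proof -
    have "G j * H i0 = q * ((u * prod_list (Qa @ Qb)) * H j)" using pr[OF H(2) j] dv by (simp add: mult_ac)
    hence "dvd_in A q (G j * H i0)" unfolding dvd_in_def
      using rA HA[OF j] subring_of_closed(4)[OF A] by blast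
    hence "dvd_in A q (G j) \<or> dvd_in A q (H i0)" using qp GA[OF j] HA[OF H(2)] by (auto simp: prime_in_def)
    moreover have "\<not> dvd_in A q (H i0)" using H(3) q(2) by (auto simp: dvd_in_def mp_eval_mult)
    ultimately show ?thesis by simp
  qed
  then obtain g0 where g0: "\<And>j. j \<le> N \<Longrightarrow> g0 j \<in> A \<and> G j = q * g0 j" unfolding dvd_in_def by metis
  \<comment> \<open>The quotients are cut off because \<open>hom_tuple\<close> demands zeros beyond
    \<open>N\<close>.\<close>
  define g where "g = (\<lambda>j. if j \<le> N then g0 j else 0)"
  have g: "g j \<in> A" "G j = q * g j" if "j \<le> N" for j using g0[OF that] that by (auto simp: g_def)
  have "q * g i0 \<in> mp_hom (rat_deg N F)" "q * g i0 \<noteq> 0" using g[OF H(2)] GA(2)[OF H(2)] G0 by auto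
  then obtain b where b: "q \<in> mp_hom b" using mp_hom_factor by blast
  \<comment> \<open>A prime is not a unit, so it has positive degree, and dividing by it lowers the
    degree that was assumed minimal.\<close>
  have bpos: "b > 0" using unit_in_mp_carrier_hom_0[of q "Suc N"] qA b unfolding A_def by (cases b) auto
  have gh: "g j \<in> mp_hom (rat_deg N F - b)" "g j \<noteq> 0 \<Longrightarrow> b \<le> rat_deg N F" if j: "j \<le> N" for j
  proof -
    have "g j \<in> mp_hom (rat_deg N F - b) \<and> (g j \<noteq> 0 \<longrightarrow> b \<le> rat_deg N F)"
    proof (cases "g j = 0")
      case False
      hence nz: "q * g j \<noteq> 0" "g j * q \<noteq> 0" using qA by auto
      have h: "q * g j \<in> mp_hom (rat_deg N F)" using g(2)[OF j] GA(2)[OF j] by simp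
      hence "g j * q \<in> mp_hom (rat_deg N F)" by (simp add: mult.commute)
      then obtain c where c: "g j \<in> mp_hom c" using mp_hom_factor nz by blast
      from mp_hom_unique[OF mp_hom_mult[OF b c] h nz(1)] have "b + c = rat_deg N F" .
      moreover from this have "rat_deg N F - b = c" by simp
      ultimately show ?thesis using c by auto
    qed simp
    thus "g j \<in> mp_hom (rat_deg N F - b)" "g j \<noteq> 0 \<Longrightarrow> b \<le> rat_deg N F" by auto
  qed
  have gi0: "g i0 \<noteq> 0" using g(2)[OF H(2)] G0 by auto
  have "g i * F j = g j * F i" if ij: "i \<le> N" "j \<le> N" for i j
  proof -
    have "q * (g i * F j) = q * (g j * F i)" using G g ij by (auto simp: rep_of_def mult_ac)
    thus ?thesis using qA by simp
  qed
  hence "rep_of N F (rat_deg N F - b) g" unfolding rep_of_def hom_tuple_def hom_poly_iff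
    using gh g gi0 H(2) unfolding A_def by (auto simp: g_def)
  hence "rat_deg N F \<le> rat_deg N F - b" unfolding rat_deg_def[of N F] by (metis (mono_tags) Least_le)
  thus False using bpos gh(2)[OF H(2) gi0] by simp
qed


section \<open>Compositions of maps and orbits of points\<close>

definition list_orbit :: "nat \<Rightarrow> (nat \<Rightarrow> mpoly) list \<Rightarrow> (nat \<Rightarrow> complex) \<Rightarrow> (nat \<Rightarrow> complex)" where
  "list_orbit N ts y = foldl (\<lambda>x t. rm_apply N t x) y ts"

lemma list_orbit_Nil [simp]: "list_orbit N [] y = y"
  and list_orbit_snoc: "list_orbit N (ts @ [t]) y = rm_apply N t (list_orbit N ts y)"
  and list_orbit_append: "list_orbit N (ts @ us) y = list_orbit N us (list_orbit N ts y)"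
  by (simp_all add: list_orbit_def)

lemma comp_list_snoc: "comp_list N (ts @ [t]) = rm_comp N t (comp_list N ts)"
  by (simp add: comp_list_def)

lemma comp_list_beyond: "i > N \<Longrightarrow> comp_list N ts i = 0"
  by (cases ts rule: rev_cases) (auto simp: comp_list_snoc rm_comp_def comp_list_def rm_id_def)

lemma orbit_conv_list_orbit: "orbit N g y n = list_orbit N (map g [0..<n]) y"
  by (induction n) (auto simp: list_orbit_snoc)

lemma mp_subst_in_mp_hom:
  assumes p: "p \<in> mp_hom e" and F: "\<And>i. F i \<in> mp_hom d"
  shows "mp_subst p F \<in> mp_hom (e * d)"
  unfolding mp_subst_conv_ins mp_ins_def
proof (rule mp_hom_sum)
  fix m assume m: "m \<in> Poly_Mapping.keys p"
  have "(\<Prod>i\<in>J. F i ^ f i) \<in> mp_hom ((\<Sum>i\<in>J. f i) * d)" if "finite J" for J and f :: "nat \<Rightarrow> nat"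
    using that
  proof (induction J)
    case (insert x J)
    thus ?case using mp_hom_mult[OF mp_hom_power[OF F[of x], of "f x"] insert.IH] by (simp add: algebra_simps)
  qed (simp add: mp_hom_1)
  hence "mon_eval F m \<in> mp_hom (mon_deg m * d)" by (simp add: mon_eval_def mon_deg_def)
  moreover have "mon_deg m = e" using p m by (auto simp: mp_hom_def)
  moreover have "mp_const c \<in> mp_hom 0" for c by (auto simp: mp_hom_def mp_const_def mon_deg_def split: if_splits)
  ultimately show "mp_const (Poly_Mapping.lookup p m) * mon_eval F m \<in> mp_hom (e * d)"
    using mp_hom_mult by fastforce
qed

lemma mp_subst_in_mp_carrier:
  assumes p: "p \<in> mp_carrier n" and F: "\<And>i. F i \<in> mp_carrier k"
  shows "mp_subst p F \<in> mp_carrier k"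
  unfolding mp_subst_conv_ins mp_ins_def mp_const_def mon_eval_def using p F
  by (intro mp_carrier_sum subring_of_closed(4) subring_of_prod subring_of_power subring_of_mp_carrier
       single_in_mp_carrier algebraic_lookup) auto

lemma mp_subst_scale:
  assumes p: "p \<in> mp_hom e"
  shows "mp_subst p (\<lambda>i. a * F i) = a ^ e * mp_subst p F"
proof -
  have "mon_eval (\<lambda>i. a * F i) m = a ^ mon_deg m * mon_eval F m" for m
    by (simp add: mon_eval_def mon_deg_def power_mult_distrib prod.distrib power_sum)
  moreover have "mon_deg m = e" if "m \<in> Poly_Mapping.keys p" for m using p that by (auto simp: mp_hom_def)
  ultimately show ?thesis unfolding mp_subst_conv_ins mp_ins_def
    by (simp add: sum_distrib_left mult_ac cong: sum.cong)
qed

text \<open>The tuples \<open>F'\<close> and \<open>F\<close> agree after multiplication by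
  \<open>F k\<close> and \<open>F' k\<close>. Inserting them into forms of degree \<open>e\<close>
  turns these factors into their \<open>e\<close>-th powers, and the power of \<open>F k\<close> can
  be cancelled.\<close>

lemma rep_of_rm_comp:
  assumes F': "rep_of N F d F'" and k: "k \<le> N" "F k \<noteq> 0" and F0: "\<And>i. i > N \<Longrightarrow> F i = 0"
    and h: "rep_of N t e h" and nz: "\<exists>i\<le>N. rm_comp N h F' i \<noteq> 0"
  shows "rep_of N (rm_comp N t F) (e * d) (rm_comp N h F')"
proof -
  have F'c: "F' i \<in> mp_carrier (Suc N)" "F' i \<in> mp_hom d" for i
    using F' by (cases "i \<le> N"; force simp: rep_of_def hom_tuple_def hom_poly_iff mp_carrier_def)+
  have hc: "h i \<in> mp_carrier (Suc N)" "h i \<in> mp_hom e" if "i \<le> N" for i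
    using h that by (auto simp: rep_of_def hom_tuple_def hom_poly_iff)
  have "hom_tuple N (e * d) (rm_comp N h F')"
    unfolding hom_tuple_def hom_poly_iff using nz F'c hc
    by (auto simp: rm_comp_def intro!: mp_subst_in_mp_hom mp_subst_in_mp_carrier)
  moreover have "rm_comp N h F' i * rm_comp N t F j = rm_comp N h F' j * rm_comp N t F i"
    if ij: "i \<le> N" "j \<le> N" for i j
  proof -
    have "(\<lambda>i. F k * F' i) = (\<lambda>i. F' k * F i)"
    proof
      fix i show "F k * F' i = F' k * F i"
        using F' k F0[of i] by (cases "i \<le> N") (auto simp: rep_of_def hom_tuple_def mult.commute)
    qed
    hence s: "F k ^ e * mp_subst (h i) F' = F' k ^ e * mp_subst (h i) F" if "i \<le> N" for i
      using mp_subst_scale[OF hc(2)[OF that], of "F k" F'] mp_subst_scale[OF hc(2)[OF that], of "F' k" F] by simp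
    have th: "mp_subst (h i) F * mp_subst (t j) F = mp_subst (h j) F * mp_subst (t i) F"
      using h ij by (simp add: rep_of_def mp_subst_conv_ins flip: const.ins_mult)
    have "F k ^ e * (mp_subst (h i) F' * mp_subst (t j) F) = F' k ^ e * (mp_subst (h i) F * mp_subst (t j) F)"
      using s[OF ij(1)] by (simp flip: mult.assoc)
    also have "\<dots> = F k ^ e * (mp_subst (h j) F' * mp_subst (t i) F)"
      using s[OF ij(2)] th by (simp flip: mult.assoc)
    finally show ?thesis using k ij by (simp add: rm_comp_def)
  qed
  ultimately show ?thesis by (simp add: rep_of_def)
qed

lemma algebraic_mp_eval:
  assumes "p \<in> mp_carrier n" "\<And>i. algebraic (x i)"
  shows "algebraic (mp_eval p x)"
proof -
  have "mp_eval p x \<in> {x. algebraic x}"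
    unfolding mp_eval_conv_ins mp_ins_def mon_eval_def using assms
    by (intro subring_of_sum subring_of_closed(4) subring_of_prod subring_of_power subring_of_algebraics)
       (auto intro: algebraic_lookup)
  thus ?thesis by simp
qed

lemma rep_of_const: "(\<And>i. i \<le> N \<Longrightarrow> F i = 0) \<Longrightarrow> rep_of N F 0 (\<lambda>i. if i \<le> N then 1 else 0)"
  by (auto simp: rep_of_def hom_tuple_def hom_poly_iff mp_hom_1 subring_of_closed(2)[OF subring_of_mp_carrier])

text \<open>If all coordinates vanished, a constant tuple would satisfy the equations of a
  representative and \<open>rat_deg\<close> would be 0; degree at least 2 thus keeps compositions
  from degenerating.\<close>

lemma degree_independent_nonzero:
  assumes "degree_independent N S" "set ts \<subseteq> S"
  shows "\<exists>i\<le>N. comp_list N ts i \<noteq> 0"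
proof (cases "ts = []")
  case True
  thus ?thesis by (auto simp: comp_list_def rm_id_def mp_var_nonzero intro!: exI[of _ 0])
next
  case False
  show ?thesis
  proof (rule ccontr)
    assume "\<not> ?thesis"
    hence "rat_deg N (comp_list N ts) = 0" unfolding rat_deg_def
      using rep_of_const[of N "comp_list N ts"] by (intro Least_eq_0) auto
    moreover have "rat_deg N (comp_list N ts) \<ge> 2" using assms False by (auto simp: degree_independent_def)
    ultimately show False by simp
  qed
qed

lemma rm_apply_rep:
  assumes "\<not> indet N t x"
  obtains d G where "rep_of N t d G" "rm_apply N t x = (\<lambda>i. if i \<le> N then mp_eval (G i) x else 0)"
    "\<exists>i\<le>N. mp_eval (G i) x \<noteq> 0"
proof -
  define G where "G = (SOME G. \<exists>d. rep_of N t d G \<and> (\<exists>i\<le>N. mp_eval (G i) x \<noteq> 0))"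
  have "\<exists>G d. rep_of N t d G \<and> (\<exists>i\<le>N. mp_eval (G i) x \<noteq> 0)" using assms by (auto simp: indet_def)
  hence "\<exists>d. rep_of N t d G \<and> (\<exists>i\<le>N. mp_eval (G i) x \<noteq> 0)" unfolding G_def by (rule someI_ex)
  then obtain d where "rep_of N t d G" "\<exists>i\<le>N. mp_eval (G i) x \<noteq> 0" by blast
  moreover have "rm_apply N t x = (\<lambda>i. if i \<le> N then mp_eval (G i) x else 0)"
    by (simp only: rm_apply_def G_def Let_def)
  ultimately show ?thesis using that by blast
qed

text \<open>Prefixing a sequence with \<open>t\<close> shifts the orbit by one, so the condition for
  all sequences at \<open>y\<close> contains the one for all sequences at the image of
  \<open>y\<close>.\<close>

lemma good_pts_rm_apply:
  assumes y: "y \<in> good_pts N S" and t: "t \<in> S"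
  shows "rm_apply N t y \<in> good_pts N S"
proof -
  have py: "proj_pt N y" and ind: "\<And>g n \<phi>. range g \<subseteq> S \<Longrightarrow> \<phi> \<in> S \<Longrightarrow> \<not> indet N \<phi> (orbit N g y n)"
    using y by (auto simp: good_pts_def)
  have "\<not> indet N t y" using ind[of "\<lambda>_. t" t 0] t by auto
  then obtain d G where G: "rep_of N t d G" "rm_apply N t y = (\<lambda>i. if i \<le> N then mp_eval (G i) y else 0)"
    "\<exists>i\<le>N. mp_eval (G i) y \<noteq> 0" by (rule rm_apply_rep)
  have "proj_pt N (rm_apply N t y)" unfolding proj_pt_def G(2) using G(1,3) py
    by (auto simp: rep_of_def hom_tuple_def hom_poly_iff proj_pt_def intro!: algebraic_mp_eval)
  moreover have "\<not> indet N \<phi> (orbit N g (rm_apply N t y) n)" if "range g \<subseteq> S" "\<phi> \<in> S" for g n \<phi>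
  proof -
    have "orbit N (case_nat t g) y (Suc n) = orbit N g (rm_apply N t y) n" by (induction n) auto
    moreover have "range (case_nat t g) \<subseteq> S" using that(1) t by (auto simp: image_subset_iff split: nat.splits)
    ultimately show ?thesis using ind[of "case_nat t g" \<phi> "Suc n"] that by auto
  qed
  ultimately show ?thesis by (auto simp: good_pts_def)
qed

lemma good_pts_list_orbit: "y \<in> good_pts N S \<Longrightarrow> set ts \<subseteq> S \<Longrightarrow> list_orbit N ts y \<in> good_pts N S"
  by (induction ts rule: rev_induct) (auto simp: list_orbit_snoc good_pts_rm_apply)

text \<open>Composing representatives that are nonzero at the successive points of the orbit gives a
  representative of the composition that is nonzero at \<open>y\<close>, but its degree need not be
  minimal.\<close>

lemma list_orbit_rep:
  assumes di: "degree_independent N S" and y: "y \<in> good_pts N S" and ts: "set ts \<subseteq> S"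
  shows "\<exists>d H. rep_of N (comp_list N ts) d H \<and> (\<forall>i. list_orbit N ts y i = mp_eval (H i) y)"
  using ts
proof (induction ts rule: rev_induct)
  case Nil
  have y0: "y i = 0" if "i > N" for i using y that by (auto simp: good_pts_def proj_pt_def)
  have "mp_var i \<in> mp_carrier (Suc N)" if "i \<le> N" for i unfolding mp_var_def using that
    by (intro single_in_mp_carrier) (auto simp: algebraic_int_imp_algebraic)
  moreover have "mp_var i \<in> mp_hom 1" for i by (auto simp: mp_hom_def mp_var_def mon_deg_def)
  ultimately have "rep_of N (rm_id N) 1 (rm_id N)"
    by (auto simp: rep_of_def hom_tuple_def hom_poly_iff rm_id_def mult.commute mp_var_nonzero intro!: exI[of _ 0])
  moreover have "y i = mp_eval (rm_id N i) y" for i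
    using y0[of i] by (auto simp: rm_id_def mp_eval_conv_ins mp_var_def ident.ins_single mon_eval_def)
  ultimately show ?case unfolding comp_list_def foldl.simps list_orbit_Nil by blast
next
  case (snoc t ts)
  then obtain d H where H: "rep_of N (comp_list N ts) d H" "\<And>i. list_orbit N ts y i = mp_eval (H i) y" by auto
  define z where "z = list_orbit N ts y"
  have z: "z \<in> good_pts N S" unfolding z_def using good_pts_list_orbit[OF y] snoc.prems by auto
  have t: "t \<in> S" using snoc.prems by auto
  have "\<not> indet N t z" using z t unfolding good_pts_def by (auto dest!: spec[of _ "\<lambda>_. t"] bspec[of _ _ t] spec[of _ 0])
  then obtain e G where G: "rep_of N t e G" "rm_apply N t z = (\<lambda>i. if i \<le> N then mp_eval (G i) z else 0)"
    "\<exists>i\<le>N. mp_eval (G i) z \<noteq> 0" by (rule rm_apply_rep)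
  have ev: "mp_eval (rm_comp N G H i) y = (if i \<le> N then mp_eval (G i) z else 0)" for i
    by (simp add: rm_comp_def mp_eval_subst z_def H(2)[symmetric] mp_eval_conv_ins[of 0])
  obtain k where k: "k \<le> N" "comp_list N ts k \<noteq> 0"
    using degree_independent_nonzero[OF di, of ts] snoc.prems by auto
  have "\<exists>i\<le>N. rm_comp N G H i \<noteq> 0"
  proof -
    obtain i where i: "i \<le> N" "mp_eval (G i) z \<noteq> 0" using G(3) by blast
    hence "mp_eval (rm_comp N G H i) y \<noteq> 0" using ev by simp
    hence "rm_comp N G H i \<noteq> 0" by (auto simp: mp_eval_conv_ins)
    thus ?thesis using i by blast
  qed
  from rep_of_rm_comp[OF H(1) k comp_list_beyond G(1) this]
  have "rep_of N (comp_list N (ts @ [t])) (e * d) (rm_comp N G H)" by (simp add: comp_list_snoc)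
  moreover have "list_orbit N (ts @ [t]) y i = mp_eval (rm_comp N G H i) y" for i
    by (simp add: list_orbit_snoc z_def[symmetric] G(2) ev)
  ultimately show ?case by blast
qed

text \<open>Passes from the composed representative to one of minimal degree, whose degree is the
  one in \<open>dyn_degree\<close>. The scalar \<open>l\<close> is inevitable, since
  \<open>rm_apply\<close> chooses a representative at every step.\<close>

theorem list_orbit_min_rep:
  assumes di: "degree_independent N S" and y: "y \<in> good_pts N S" and ts: "set ts \<subseteq> S"
    and G: "rep_of N (comp_list N ts) (rat_deg N (comp_list N ts)) G"
  shows "\<exists>l. l \<noteq> 0 \<and> algebraic l \<and> (\<forall>i. list_orbit N ts y i = l * mp_eval (G i) y)" "\<exists>i\<le>N. mp_eval (G i) y \<noteq> 0"
proof -
  obtain d H where H: "rep_of N (comp_list N ts) d H" "\<And>i. list_orbit N ts y i = mp_eval (H i) y"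
    using list_orbit_rep[OF assms(1-3)] by auto
  define z where "z = list_orbit N ts y"
  have z: "proj_pt N z" "proj_pt N y" using good_pts_list_orbit[OF y ts] y unfolding z_def by (auto simp: good_pts_def)
  then obtain i0 where i0: "i0 \<le> N" "z i0 \<noteq> 0" by (auto simp: proj_pt_def)
  obtain k where k: "k \<le> N" "comp_list N ts k \<noteq> 0"
    using degree_independent_nonzero[OF di ts] by auto
  have "mp_eval (H i0) y \<noteq> 0" using i0(2) H(2) by (simp add: z_def)
  from min_rep_nonvanishing[OF k G H(1) i0(1) this]
  obtain j where j: "j \<le> N" "mp_eval (G j) y \<noteq> 0" by blast
  thus "\<exists>i\<le>N. mp_eval (G i) y \<noteq> 0" by blast
  have pr: "mp_eval (G j) y * z i = mp_eval (G i) y * z j" if "i \<le> N" for i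
    using rep_of_proportional[OF G H(1) k j(1) that] H(2) by (metis mp_eval_mult z_def)
  have eq: "z i = (z j / mp_eval (G j) y) * mp_eval (G i) y" for i
  proof (cases "i \<le> N")
    case True thus ?thesis using pr[OF True] j by (simp add: field_simps)
  next
    case False
    moreover from this have "G i = 0" using G by (auto simp: rep_of_def hom_tuple_def)
    ultimately show ?thesis using z by (simp add: proj_pt_def mp_eval_conv_ins)
  qed
  have "z j / mp_eval (G j) y \<noteq> 0" using eq[of i0] i0 by auto
  moreover have "algebraic (z j / mp_eval (G j) y)" unfolding divide_inverse
    using z j G by (intro algebraic_times algebraic_inverse algebraic_mp_eval)
      (auto simp: proj_pt_def rep_of_def hom_tuple_def hom_poly_iff)
  ultimately show "\<exists>l. l \<noteq> 0 \<and> algebraic l \<and> (\<forall>i. list_orbit N ts y i = l * mp_eval (G i) y)"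
    using eq unfolding z_def by blast
qed

lemma exists_min_rep:
  assumes "degree_independent N S" "y \<in> good_pts N S" "set ts \<subseteq> S"
  shows "\<exists>G. rep_of N (comp_list N ts) (rat_deg N (comp_list N ts)) G"
proof -
  have "\<exists>d G. rep_of N (comp_list N ts) d G" using list_orbit_rep[OF assms] by blast
  thus ?thesis unfolding rat_deg_def by (rule LeastI_ex)
qed

section \<open>Number fields as quotients of rational polynomials\<close>

interpretation of_rat_poly_hom: map_poly_inj_idom_hom "of_rat :: rat \<Rightarrow> complex" ..

text \<open>Elements of the field generated by \<open>s\<close> are handled as rational polynomials;
  evaluating the same polynomial at another root of the minimal polynomial of \<open>s\<close> is
  conjugation.\<close>

definition reval :: "complex \<Rightarrow> rat poly \<Rightarrow> complex" where
  "reval s r = poly (map_poly of_rat r) s"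

interpretation reval: comm_ring_hom "reval s"
  by unfold_locales (auto simp: reval_def hom_distribs)

interpretation reval_poly: map_poly_comm_ring_hom "reval s" ..

lemma reval_const [simp]: "reval s [:a:] = of_rat a"
  by (simp add: reval_def hom_distribs)

lemma reval_pCons [simp]: "reval s (pCons a r) = of_rat a + s * reval s r"
  by (simp add: reval_def hom_distribs)

lemma reval_smult [simp]: "reval s (Polynomial.smult a r) = of_rat a * reval s r"
  by (simp add: reval_def hom_distribs)

lemma reval_monom: "reval s (monom a k) = of_rat a * s ^ k"
  by (simp add: reval_def poly_monom)

lemma reval_pcompose: "reval s (pcompose q r) = reval (reval s r) q"
  by (induction q) (auto simp: pcompose_pCons reval.hom_add reval.hom_mult)

lemma reval_altdef: "degree r < n \<Longrightarrow> reval s r = (\<Sum>k<n. of_rat (coeff r k) * s ^ k)"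
  unfolding reval_def poly_altdef
  by (rule sum.mono_neutral_cong_left) (auto simp: coeff_eq_0)

definition rroots :: "rat poly \<Rightarrow> complex set" where
  "rroots p = {s. reval s p = 0}"

text \<open>If \<open>p\<close> does not divide \<open>r\<close>, the two are coprime, and a Bezout
  relation evaluated at \<open>s\<close> shows that \<open>r\<close> does not vanish there. The
  criterion does not mention the root, which lets equations pass to all conjugates.\<close>

lemma reval_eq_0_iff:
  assumes p: "irreducible p" and s: "s \<in> rroots p"
  shows "reval s r = 0 \<longleftrightarrow> p dvd r"
proof
  assume "p dvd r"
  then obtain k where "r = p * k" by (auto elim: dvdE)
  thus "reval s r = 0" using s by (simp add: reval.hom_mult rroots_def)
next
  assume r: "reval s r = 0"
  show "p dvd r"
  proof (rule ccontr)
    assume "\<not> p dvd r"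
    hence "coprime p r" using p by (simp add: irreducible_imp_prime_elem prime_elem_imp_coprime)
    hence "fst (bezout_coefficients p r) * p + snd (bezout_coefficients p r) * r = 1"
      by (simp add: bezout_coefficients_fst_snd)
    hence "reval s (fst (bezout_coefficients p r) * p + snd (bezout_coefficients p r) * r) = 1" by simp
    thus False using r s by (simp add: reval.hom_mult reval.hom_add rroots_def)
  qed
qed

lemma reval_eq_iff:
  assumes "irreducible p" "s \<in> rroots p" "t \<in> rroots p"
  shows "reval s r = reval s r' \<longleftrightarrow> reval t r = reval t r'"
  using reval_eq_0_iff[OF assms(1,2), of "r - r'"] reval_eq_0_iff[OF assms(1,3), of "r - r'"]
  by (simp add: reval.hom_minus)

lemma irreducible_rat_poly_degree: "irreducible (p :: rat poly) \<Longrightarrow> degree p > 0"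
  by (metis gr0I irreducible_def is_unit_iff_degree)

lemma finite_rroots: "irreducible p \<Longrightarrow> finite (rroots p)"
  unfolding rroots_def reval_def
  by (rule poly_roots_finite) (auto simp: irreducible_def)

lemma pderiv_nonzero_at_rroot:
  assumes p: "irreducible p" and s: "s \<in> rroots p"
  shows "poly (pderiv (map_poly of_rat p)) s \<noteq> 0"
proof
  assume "poly (pderiv (map_poly of_rat p)) s = 0"
  moreover have "pderiv (map_poly of_rat p) = map_poly (of_rat :: rat \<Rightarrow> complex) (pderiv p)"
    by (rule poly_eqI) (simp add: coeff_pderiv of_rat_mult of_rat_add)
  ultimately have "p dvd pderiv p" using reval_eq_0_iff[OF p s, of "pderiv p"] by (simp add: reval_def)
  moreover have "degree (pderiv p) < degree p" "pderiv p \<noteq> 0"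
    using irreducible_rat_poly_degree[OF p] by (auto simp: degree_pderiv pderiv_eq_0_iff)
  ultimately show False by (auto dest: dvd_imp_degree_le)
qed

lemma card_rroots:
  assumes p: "irreducible p"
  shows "card (rroots p) = degree p"
proof -
  have "rsquarefree (map_poly (of_rat :: rat \<Rightarrow> complex) p)"
    using pderiv_nonzero_at_rroot[OF p] by (auto simp: rsquarefree_roots rroots_def reval_def)
  moreover have "map_poly (of_rat :: rat \<Rightarrow> complex) p \<noteq> 0" using p by (auto simp: irreducible_def)
  ultimately have "card {x. poly (map_poly (of_rat :: rat \<Rightarrow> complex) p) x = 0} = degree (map_poly (of_rat :: rat \<Rightarrow> complex) p)"
    using rsquarefree_card_degree by blast
  thus ?thesis by (simp add: rroots_def reval_def)
qed

lemma rroots_enum: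
  assumes p: "irreducible p"
  obtains s where "bij_betw s {..<degree p} (rroots p)"
  using ex_bij_betw_nat_finite[OF finite_rroots[OF p]] card_rroots[OF p] by (auto simp: atLeast0LessThan)

lemma rroots_nonempty: "irreducible p \<Longrightarrow> rroots p \<noteq> {}"
  using card_rroots[of p] irreducible_rat_poly_degree[of p] by auto

lemma algebraic_rroot:
  assumes "irreducible p" "s \<in> rroots p"
  shows "algebraic s"
proof (rule algebraicI'[of "map_poly of_rat p"])
  show "map_poly of_rat p \<noteq> (0 :: complex poly)" using assms by (auto simp: irreducible_def)
qed (use assms in \<open>auto simp: rroots_def reval_def\<close>)

lemma int_poly_of_int_coeffs:
  fixes q :: "'a::ring_char_0 poly"
  assumes "\<And>i. coeff q i \<in> \<int>"
  shows "\<exists>M. q = map_poly of_int M"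
proof -
  have "\<forall>i. \<exists>k. coeff q i = of_int k" using assms by (auto elim: Ints_cases)
  then obtain c where c: "\<And>i. coeff q i = of_int (c i)" by metis
  have c0: "c i = 0" if "i > degree q" for i using c[of i] coeff_eq_0[OF that] by simp
  define M where "M = (\<Sum>i\<le>degree q. monom (c i) i)"
  have "coeff M i = c i" for i
  proof -
    have "coeff M i = (\<Sum>k\<le>degree q. if k = i then c i else 0)"
      unfolding M_def coeff_sum by (rule sum.cong) auto
    also have "\<dots> = c i" using c0[of i] by (simp add: not_le)
    finally show ?thesis .
  qed
  hence "q = map_poly of_int M" by (intro poly_eqI) (simp add: c coeff_map_poly)
  thus ?thesis by blast
qed

lemma algebraic_min_rat_poly:
  assumes "algebraic (a :: complex)"
  shows "\<exists>p. irreducible p \<and> a \<in> rroots p"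
proof -
  have "\<exists>p::rat poly. p \<noteq> 0 \<and> reval a p = 0"
  proof -
    obtain q where q: "\<And>i. coeff q i \<in> \<int>" "q \<noteq> 0" "poly q a = 0" using assms by (elim algebraicE) blast
    then obtain M where M: "q = map_poly of_int M" using int_poly_of_int_coeffs by blast
    define p where "p = map_poly rat_of_int M"
    have "map_poly of_rat p = q" by (rule poly_eqI) (simp add: p_def M coeff_map_poly)
    thus ?thesis using q by (intro exI[of _ p]) (auto simp: reval_def)
  qed
  then obtain p :: "rat poly" where p: "p \<noteq> 0" "reval a p = 0"
    and min: "\<And>q. q \<noteq> 0 \<Longrightarrow> reval a q = 0 \<Longrightarrow> degree p \<le> degree q"
    using ex_has_least_nat[of "\<lambda>p. p \<noteq> 0 \<and> reval a p = 0" _ degree] by metis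
  have "irreducible p" unfolding irreducible_def
  proof (intro conjI allI impI)
    show "\<not> p dvd 1"
    proof
      assume "p dvd 1"
      then obtain k where "1 = p * k" by (metis dvdE)
      hence "reval a 1 = reval a p * reval a k" by (metis reval.hom_mult)
      thus False using p by simp
    qed
    fix u v assume uv: "p = u * v"
    hence nz: "u \<noteq> 0" "v \<noteq> 0" "degree p = degree u + degree v" using p by (auto simp: degree_mult_eq)
    have "reval a u = 0 \<or> reval a v = 0" using p(2) uv by (simp add: reval.hom_mult)
    thus "u dvd 1 \<or> v dvd 1" using min[of u] min[of v] nz by (auto simp: is_unit_iff_degree)
  qed (use p in auto)
  thus ?thesis using p by (auto simp: rroots_def)
qed

lemma reval_inverse:
  assumes p: "irreducible p" and s: "s \<in> rroots p" and "reval s r \<noteq> 0"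
  shows "\<exists>r'. \<forall>t\<in>rroots p. reval t r * reval t r' = 1"
proof -
  have "\<not> p dvd r" using assms reval_eq_0_iff by blast
  hence "coprime p r" using p by (simp add: irreducible_imp_prime_elem prime_elem_imp_coprime)
  hence e: "fst (bezout_coefficients p r) * p + snd (bezout_coefficients p r) * r = 1"
    by (simp add: bezout_coefficients_fst_snd)
  have "reval t r * reval t (snd (bezout_coefficients p r)) = 1" if "t \<in> rroots p" for t
    using arg_cong[OF e, of "reval t"] that by (simp add: reval.hom_mult reval.hom_add rroots_def mult.commute)
  thus ?thesis by blast
qed

lemma reval_mod: "s \<in> rroots p \<Longrightarrow> reval s (r mod p) = reval s r"
proof -
  assume "s \<in> rroots p"
  moreover have "reval s r = reval s (r div p * p + r mod p)" by simp
  ultimately show ?thesis by (simp only: reval.hom_add reval.hom_mult rroots_def) simp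
qed

lemma algebraic_reval: "algebraic s \<Longrightarrow> algebraic (reval s r)"
proof (induction r)
  case (pCons a r)
  have "algebraic (complex_of_rat a)" by (rule rat_imp_algebraic) simp
  thus ?case using pCons by (simp add: algebraic_plus algebraic_times)
qed simp

text \<open>A monic integral equation for the value at \<open>s\<close>, composed with
  \<open>r\<close>, is divisible by \<open>p\<close> and therefore vanishes at \<open>t\<close>
  too.\<close>

lemma algebraic_int_conjugate:
  assumes p: "irreducible p" "s \<in> rroots p" "t \<in> rroots p" and i: "algebraic_int (reval s r)"
  shows "algebraic_int (reval t r)"
proof -
  obtain f :: "int poly" where f: "poly (map_poly of_int f) (reval s r) = 0" "lead_coeff f = 1"
    using i by (auto simp: algebraic_int_altdef_ipoly)
  define g where "g = (map_poly rat_of_int f)"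
  have g: "map_poly of_rat g = (map_poly of_int f :: complex poly)"
    by (rule poly_eqI) (simp add: g_def coeff_map_poly)
  have "reval s (pcompose g r) = 0" using f by (simp add: reval_pcompose) (simp add: reval_def g)
  hence "reval t (pcompose g r) = 0" using reval_eq_0_iff[OF p(1)] p by metis
  hence "poly (map_poly of_int f) (reval t r) = 0" by (simp add: reval_pcompose) (simp add: reval_def g)
  thus ?thesis using f(2) by (auto simp: algebraic_int_altdef_ipoly)
qed

section \<open>Vandermonde matrices, norm forms and conjugates\<close>

definition vand :: "(nat \<Rightarrow> complex) \<Rightarrow> nat \<Rightarrow> complex mat" where
  "vand s n = mat n n (\<lambda>(i, j). s i ^ j)"

lemma vand_carrier [simp]: "vand s n \<in> carrier_mat n n"
  by (simp add: vand_def)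

text \<open>A vector in the kernel would be the coefficient vector of a nonzero polynomial of degree
  below \<open>n\<close> with \<open>n\<close> distinct roots.\<close>

lemma det_vand_nonzero:
  assumes "inj_on s {..<n}"
  shows "det (vand s n) \<noteq> 0"
proof
  assume "det (vand s n) = 0"
  then obtain v where v: "v \<in> carrier_vec n" "v \<noteq> 0\<^sub>v n" "vand s n *\<^sub>v v = 0\<^sub>v n"
    using det_0_iff_vec_prod_zero_field[OF vand_carrier] by blast
  define q where "q = (\<Sum>j<n. monom (v $ j) j)"
  have cq: "coeff q j = (if j < n then v $ j else 0)" for j
    by (auto simp: q_def coeff_sum sum.delta' if_distrib cong: if_cong)
  have "\<exists>j<n. v $ j \<noteq> 0" using v(1,2) by (metis carrier_vecD eq_vecI index_zero_vec)
  then obtain j where "j < n" "v $ j \<noteq> 0" by blast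
  hence q0: "q \<noteq> 0" using cq[of j] by auto
  have n: "n > 0" using \<open>j < n\<close> by simp
  have dq: "degree q < n" using n cq by (metis degree_less_if_less_eqI le_degree leading_coeff_neq_0 not_le q0)
  have "poly q (s i) = 0" if "i < n" for i
  proof -
    have "(vand s n *\<^sub>v v) $ i = 0" using v(3) that by simp
    thus ?thesis using that v(1)
      by (simp add: vand_def scalar_prod_def q_def poly_sum poly_monom atLeast0LessThan mult.commute)
  qed
  hence "s ` {..<n} \<subseteq> {x. poly q x = 0}" by auto
  hence "card (s ` {..<n}) \<le> degree q"
    using card_mono[OF poly_roots_finite[OF q0]] card_poly_roots_bound[OF q0] le_trans by blast
  thus False using dq card_image[OF assms] by simp
qed

text \<open>Multiplication by \<open>\<Psi>\<close> has the rational matrix \<open>M\<close> in the power basis, and the Vandermonde matrix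
  diagonalises it; its adjugate provides the complementary products \<open>\<Gamma>\<close>.\<close>
lemma norm_rational:
  fixes \<Psi> :: "rat poly poly"
  assumes p: "irreducible p" and nz: "\<And>s. s \<in> rroots p \<Longrightarrow> map_poly (reval s) \<Psi> \<noteq> 0"
  shows "\<exists>M \<Gamma>. (\<Prod>s\<in>rroots p. map_poly (reval s) \<Psi>) = map_poly of_rat M \<and>
     (\<forall>s\<in>rroots p. (\<Prod>t\<in>rroots p - {s}. map_poly (reval t) \<Psi>) = map_poly (reval s) \<Gamma>)"
proof -
  define n where "n = degree p"
  have n: "n > 0" using irreducible_rat_poly_degree[OF p] by (simp add: n_def)
  obtain s where s: "bij_betw s {..<n} (rroots p)" using rroots_enum[OF p] unfolding n_def .
  have inj: "inj_on s {..<n}" and sr: "\<And>i. i < n \<Longrightarrow> s i \<in> rroots p" and im: "s ` {..<n} = rroots p"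
    using s by (auto simp: bij_betw_def)
  have p0: "p \<noteq> 0" using p by (auto simp: irreducible_def)
  define \<Phi> where "\<Phi> i = map_poly (reval (s i)) \<Psi>" for i
  \<comment> \<open>The coordinate at the \<open>k\<close>-th power of the generator in the product
    of \<open>\<Psi>\<close> with its \<open>j\<close>-th power, taken separately for every
    coefficient of \<open>\<Psi>\<close>.\<close>
  define mm where "mm j k = map_poly (\<lambda>c. coeff ((c * monom 1 j) mod p) k) \<Psi>" for j k
  define M where "M = mat n n (\<lambda>(k, j). mm j k)"
  define M' where "M' = map_mat (map_poly (of_rat :: rat \<Rightarrow> complex)) M"
  define V where "V = mat n n (\<lambda>(i, j). [:s i ^ j:])"
  define D where "D = mat n n (\<lambda>(i, j). if i = j then \<Phi> i else 0)"
  define D' where "D' = mat n n (\<lambda>(i, j). if i = j then (\<Prod>t\<in>{..<n} - {i}. \<Phi> t) else 0)"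
  have car: "M \<in> carrier_mat n n" "M' \<in> carrier_mat n n" "V \<in> carrier_mat n n" "D \<in> carrier_mat n n" "D' \<in> carrier_mat n n"
    by (auto simp: M_def M'_def V_def D_def D'_def)
  have deg: "degree (r mod p) < n" for r using degree_mod_less'[of p r] n p0 by (cases "r mod p = 0") (auto simp: n_def)
  have key: "\<Phi> i * [:s i ^ j:] = (\<Sum>k<n. [:s i ^ k:] * map_poly of_rat (mm j k))" if "i < n" "j < n" for i j
  proof (rule poly_eqI)
    fix t
    let ?c = "coeff \<Psi> t"
    have "coeff (\<Phi> i * [:s i ^ j:]) t = reval (s i) (?c * monom 1 j)"
      by (simp add: \<Phi>_def coeff_map_poly reval.hom_mult reval_monom mult.commute)
    also have "\<dots> = reval (s i) ((?c * monom 1 j) mod p)" using sr[OF that(1)] by (simp add: reval_mod)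
    also have "\<dots> = (\<Sum>k<n. of_rat (coeff ((?c * monom 1 j) mod p) k) * s i ^ k)"
      by (rule reval_altdef[OF deg])
    also have "\<dots> = coeff (\<Sum>k<n. [:s i ^ k:] * map_poly of_rat (mm j k)) t"
      by (simp add: coeff_sum mm_def coeff_map_poly mult.commute)
    finally show "coeff (\<Phi> i * [:s i ^ j:]) t = coeff (\<Sum>k<n. [:s i ^ k:] * map_poly of_rat (mm j k)) t" .
  qed
  have DV: "D * V = V * M'"
  proof (rule eq_matI)
    fix i j assume ij: "i < dim_row (V * M')" "j < dim_col (V * M')"
    hence ij: "i < n" "j < n" using car by auto
    have "(D * V) $$ (i, j) = (\<Sum>k<n. (if i = k then \<Phi> i else 0) * [:s k ^ j:])"
      using ij by (simp add: D_def V_def scalar_prod_def atLeast0LessThan)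
    also have "\<dots> = (\<Sum>k<n. if i = k then \<Phi> i * [:s i ^ j:] else 0)" by (rule sum.cong) auto
    also have "\<dots> = \<Phi> i * [:s i ^ j:]" using ij by simp
    also have "\<dots> = (V * M') $$ (i, j)"
      using ij by (simp only: key) (simp add: V_def M'_def M_def scalar_prod_def atLeast0LessThan)
    finally show "(D * V) $$ (i, j) = (V * M') $$ (i, j)" .
  qed (use car in auto)
  have detV: "det V \<noteq> 0"
  proof -
    interpret c: comm_ring_hom "\<lambda>a::complex. [:a:]" by unfold_locales (auto simp: one_pCons)
    have "V = map_mat (\<lambda>a. [:a:]) (vand s n)" by (auto simp: V_def vand_def)
    hence "det V = [:det (vand s n):]" by (simp add: c.hom_det)
    thus ?thesis using det_vand_nonzero[OF inj] by simp
  qed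
  have detD: "det D = (\<Prod>i<n. \<Phi> i)"
  proof -
    have "upper_triangular D" by (auto simp: D_def)
    hence "det D = prod_list (diag_mat D)" using car by (intro det_upper_triangular)
    also have "\<dots> = (\<Prod>i<n. \<Phi> i)"
      by (simp add: diag_mat_def D_def prod.list_conv_set_nth atLeast0LessThan)
    finally show ?thesis .
  qed
  have "det D * det V = det V * det M'"
    using arg_cong[OF DV, of det] car by (simp add: det_mult)
  hence DM: "det D = det M'" using detV by simp
  have M'det: "det M' = map_poly of_rat (det M)"
    unfolding M'_def by (rule of_rat_poly_hom.hom_det)
  have D0: "det D \<noteq> 0" unfolding detD using nz sr by (auto simp: \<Phi>_def)
  have D'D: "D' * D = det D \<cdot>\<^sub>m 1\<^sub>m n"
  proof (rule eq_matI)
    fix i j assume ij: "i < dim_row (det D \<cdot>\<^sub>m 1\<^sub>m n)" "j < dim_col (det D \<cdot>\<^sub>m 1\<^sub>m n)"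
    hence ij: "i < n" "j < n" by auto
    have "(D' * D) $$ (i, j) = (\<Sum>k<n. (if i = k then (\<Prod>t\<in>{..<n} - {i}. \<Phi> t) else 0) * (if k = j then \<Phi> k else 0))"
      using ij by (simp add: D_def D'_def scalar_prod_def atLeast0LessThan)
    also have "\<dots> = (\<Sum>k<n. if k = i then (if i = j then (\<Prod>t\<in>{..<n} - {i}. \<Phi> t) * \<Phi> i else 0) else 0)"
      by (rule sum.cong) auto
    also have "\<dots> = (if i = j then (\<Prod>t\<in>{..<n} - {i}. \<Phi> t) * \<Phi> i else 0)" using ij by simp
    also have "\<dots> = (det D \<cdot>\<^sub>m 1\<^sub>m n) $$ (i, j)"
      using ij prod.remove[of "{..<n}" i \<Phi>] by (auto simp: detD mult.commute)
    finally show "(D' * D) $$ (i, j) = (det D \<cdot>\<^sub>m 1\<^sub>m n) $$ (i, j)" .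
  qed (use car in auto)
  define Ad where "Ad = adj_mat M"
  define Ad' where "Ad' = map_mat (map_poly (of_rat :: rat \<Rightarrow> complex)) Ad"
  have Adc: "Ad \<in> carrier_mat n n" "Ad' \<in> carrier_mat n n" using adj_mat(1)[OF car(1)] by (auto simp: Ad_def Ad'_def)
  have "M * Ad = det M \<cdot>\<^sub>m 1\<^sub>m n" unfolding Ad_def by (rule adj_mat(2)[OF car(1)])
  hence "M' * Ad' = map_mat (map_poly of_rat) (det M \<cdot>\<^sub>m 1\<^sub>m n)"
    unfolding M'_def Ad'_def using of_rat_poly_hom.mat_hom_mult[OF car(1) Adc(1)] by simp
  also have "\<dots> = det D \<cdot>\<^sub>m 1\<^sub>m n" by (rule eq_matI) (auto simp: DM M'det)
  finally have MA: "M' * Ad' = det D \<cdot>\<^sub>m 1\<^sub>m n" .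
  \<comment> \<open>Both sides are compared after multiplication by \<open>det D\<close>, which is
    nonzero; in this way no matrix over a polynomial ring has to be inverted.\<close>
  have VA: "V * Ad' = D' * V"
  proof -
    have "det D \<cdot>\<^sub>m (V * Ad') = (det D \<cdot>\<^sub>m 1\<^sub>m n) * (V * Ad')"
      using car Adc by (subst mult_smult_assoc_mat[of _ n n _ n]) auto
    also have "\<dots> = (D' * D) * (V * Ad')" by (simp add: D'D)
    also have "\<dots> = D' * ((D * V) * Ad')" using car Adc by (simp add: assoc_mult_mat[of _ n n _ n _ n])
    also have "\<dots> = D' * (V * (M' * Ad'))" using car Adc by (simp add: DV assoc_mult_mat[of _ n n _ n _ n])
    also have "\<dots> = det D \<cdot>\<^sub>m (D' * V)" using car by (simp add: MA mult_smult_distrib[of _ n n _ n])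
    finally have eq: "det D \<cdot>\<^sub>m (V * Ad') = det D \<cdot>\<^sub>m (D' * V)" .
    show ?thesis
    proof (rule eq_matI)
      fix i j assume ij: "i < dim_row (D' * V)" "j < dim_col (D' * V)"
      hence "(det D \<cdot>\<^sub>m (V * Ad')) $$ (i, j) = det D * (V * Ad') $$ (i, j)"
        "(det D \<cdot>\<^sub>m (D' * V)) $$ (i, j) = det D * (D' * V) $$ (i, j)" using car Adc by auto
      thus "(V * Ad') $$ (i, j) = (D' * V) $$ (i, j)" using eq D0 by simp
    qed (use car Adc in auto)
  qed
  \<comment> \<open>The first column of \<open>V\<close> consists of ones, so the first column of
    \<open>D' * V\<close> lists the complementary products, and \<open>V * Ad'\<close> writes them
    as rational expressions in the powers of \<open>s i\<close>.\<close>
  define \<Gamma> where "\<Gamma> = (\<Sum>k<n. Polynomial.smult (monom 1 k) (map_poly (\<lambda>c. [:c:]) (Ad $$ (k, 0))))"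
  have G: "(\<Prod>t\<in>{..<n} - {i}. \<Phi> t) = map_poly (reval (s i)) \<Gamma>" if i: "i < n" for i
  proof -
    have "(D' * V) $$ (i, 0) = (\<Sum>k<n. (if i = k then (\<Prod>t\<in>{..<n} - {i}. \<Phi> t) else 0) * [:s k ^ 0:])"
      using i n by (simp add: D'_def V_def scalar_prod_def atLeast0LessThan)
    also have "\<dots> = (\<Sum>k<n. if i = k then (\<Prod>t\<in>{..<n} - {i}. \<Phi> t) else 0)" by (rule sum.cong) auto
    also have "\<dots> = (\<Prod>t\<in>{..<n} - {i}. \<Phi> t)" using i by simp
    finally have "(\<Prod>t\<in>{..<n} - {i}. \<Phi> t) = (V * Ad') $$ (i, 0)" by (simp add: VA)
    also have "\<dots> = (\<Sum>k<n. [:s i ^ k:] * map_poly of_rat (Ad $$ (k, 0)))"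
      using i n Adc by (simp add: V_def Ad'_def scalar_prod_def atLeast0LessThan)
    also have "\<dots> = map_poly (reval (s i)) \<Gamma>"
      by (rule poly_eqI) (simp add: \<Gamma>_def coeff_map_poly coeff_sum reval.hom_sum reval_monom reval.hom_mult mult.commute)
    finally show ?thesis .
  qed
  have "(\<Prod>s\<in>rroots p. map_poly (reval s) \<Psi>) = (\<Prod>i<n. \<Phi> i)"
    using prod.reindex_bij_betw[OF s, of "\<lambda>s. map_poly (reval s) \<Psi>"] by (simp add: \<Phi>_def)
  moreover have "(\<Prod>t\<in>rroots p - {x}. map_poly (reval t) \<Psi>) = map_poly (reval x) \<Gamma>" if x: "x \<in> rroots p" for x
  proof -
    obtain i where i: "i < n" "x = s i" using x im by auto
    have "bij_betw s ({..<n} - {i}) (rroots p - {x})" unfolding i(2) using s i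
      by (intro bij_betw_DiffI) (auto simp: bij_betw_def)
    from prod.reindex_bij_betw[OF this, of "\<lambda>s. map_poly (reval s) \<Psi>"] show ?thesis
      using G[OF i(1)] by (simp add: \<Phi>_def i(2))
  qed
  ultimately show ?thesis using detD DM M'det by metis
qed


lemma norm_integral:
  fixes \<Psi> :: "rat poly poly"
  assumes p: "irreducible p" and nz: "\<And>s. s \<in> rroots p \<Longrightarrow> map_poly (reval s) \<Psi> \<noteq> 0"
    and int: "\<And>s k. s \<in> rroots p \<Longrightarrow> algebraic_int (reval s (coeff \<Psi> k))"
  shows "\<exists>M::int poly. (\<Prod>s\<in>rroots p. map_poly (reval s) \<Psi>) = map_poly of_int M"
proof -
  let ?P = "\<Prod>s\<in>rroots p. map_poly (reval s) \<Psi>"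
  obtain M where M: "?P = map_poly of_rat M" using norm_rational[OF p nz] by blast
  have "?P \<in> polys_over {x. algebraic_int x}"
    using int by (intro subring_of_prod subring_of_polys_over subring_of_algebraic_ints)
      (auto simp: polys_over_def coeff_map_poly)
  hence "algebraic_int (coeff ?P k)" for k by (auto simp: polys_over_def)
  moreover have "coeff ?P k \<in> \<rat>" for k by (simp add: M coeff_map_poly)
  ultimately have "coeff ?P k \<in> \<int>" for k by (rule rational_algebraic_int_is_int)
  thus ?thesis by (rule int_poly_of_int_coeffs)
qed

lemma order_prod_linear:
  fixes t :: "'a::idom"
  assumes "finite R"
  shows "order t (\<Prod>s\<in>R. [:- f s, 1:]) = card {s\<in>R. f s = t}"
  using assms
proof (induction R rule: finite_induct)
  case (insert x R)
  have nz: "(\<Prod>s\<in>insert x R. [:- f s, 1:]) \<noteq> 0" using insert.hyps by (subst prod_zero_iff) auto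
  have "order t [:- f x, 1:] = (if f x = t then 1 else 0)"
    using order_power_n_n[of t 1] by (auto simp: order_0I)
  moreover have "(\<Prod>s\<in>insert x R. [:- f s, 1:]) = [:- f x, 1:] * (\<Prod>s\<in>R. [:- f s, 1:])"
    using insert by (subst prod.insert) auto
  moreover have "{s\<in>insert x R. f s = t} = (if f x = t then insert x {s\<in>R. f s = t} else {s\<in>R. f s = t})" by auto
  ultimately show ?case using insert nz order_mult[of "[:- f x, 1:]" "\<Prod>s\<in>R. [:- f s, 1:]" t]
    by (auto simp del: mult_pCons_left)
qed simp

text \<open>The characteristic polynomial of \<open>k\<close> is rational and all its roots are roots of \<open>q\<close>, hence it is a power of \<open>q\<close>.\<close>
lemma card_conjugate_fibres:
  assumes p: "irreducible p" and q: "irreducible q" and s0: "s0 \<in> rroots p" "reval s0 k \<in> rroots q"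
  shows "\<And>s. s \<in> rroots p \<Longrightarrow> reval s k \<in> rroots q"
    and "\<exists>m>0. \<forall>t\<in>rroots q. card {s\<in>rroots p. reval s k = t} = m"
proof -
  show r: "reval s k \<in> rroots q" if "s \<in> rroots p" for s
    using reval_eq_0_iff[OF p that, of "pcompose q k"] reval_eq_0_iff[OF p s0(1), of "pcompose q k"] s0(2)
    by (simp add: rroots_def reval_pcompose)
  have \<Psi>: "map_poly (reval s) [:- k, 1:] = [:- reval s k, 1:]" for s
    by (simp add: hom_distribs)
  obtain M where M: "(\<Prod>s\<in>rroots p. [:- reval s k, 1:]) = map_poly of_rat M"
    using norm_rational[OF p, of "[:- k, 1:]"] unfolding \<Psi> by auto
  have M0: "M \<noteq> 0"
  proof
    assume "M = 0"
    hence "(\<Prod>s\<in>rroots p. [:- reval s k, 1:]) = 0" using M by simp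
    thus False using finite_rroots[OF p] by (simp add: prod_zero_iff)
  qed
  define m where "m = multiplicity q M"
  obtain M' where M': "M = q ^ m * M'" "\<not> q dvd M'"
    using multiplicity_decompose'[of M q] M0 q unfolding m_def
    by (metis irreducible_not_unit)
  \<comment> \<open>\<open>q\<close> has only simple roots and none in common with
    \<open>M'\<close>; so each of its roots has the same multiplicity \<open>m\<close> in
    \<open>M\<close>, and this multiplicity counts a fibre.\<close>
  have ord: "order t (map_poly of_rat M) = m" if t: "t \<in> rroots q" for t
  proof -
    have q0: "map_poly of_rat q \<noteq> (0::complex poly)" using q by (auto simp: irreducible_def)
    have "order t (map_poly of_rat q) = 1"
    proof -
      have "order t (map_poly of_rat q) \<noteq> 0" using t q0 by (simp add: order_root rroots_def reval_def)
      moreover have "order t (map_poly of_rat q) = Suc (order t (pderiv (map_poly of_rat q)))"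
        by (rule order_pderiv) (use q0 t in \<open>auto simp: rroots_def reval_def\<close>)
      moreover have "order t (pderiv (map_poly of_rat q)) = 0" using pderiv_nonzero_at_rroot[OF q t] by (simp add: order_0I)
      ultimately show ?thesis by simp
    qed
    hence "order t (map_poly of_rat q ^ m) = m" using q0
      by (induction m) (auto simp: order_mult)
    moreover have "order t (map_poly of_rat M') = 0"
      using reval_eq_0_iff[OF q t, of M'] M'(2) by (simp add: order_0I reval_def)
    moreover have "map_poly of_rat M = map_poly of_rat q ^ m * (map_poly of_rat M' :: complex poly)"
      by (simp add: M'(1) hom_distribs)
    moreover have "map_poly of_rat M \<noteq> (0 :: complex poly)" using M0 by simp
    ultimately show ?thesis by (metis add.right_neutral order_mult)
  qed
  have card: "card {s\<in>rroots p. reval s k = t} = m" if "t \<in> rroots q" for t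
    using ord[OF that] order_prod_linear[OF finite_rroots[OF p], of t "\<lambda>s. reval s k"] by (simp add: M)
  have "card {s\<in>rroots p. reval s k = reval s0 k} > 0"
    using s0 finite_rroots[OF p] by (auto simp: card_gt_0_iff)
  hence "m > 0" using card[OF s0(2)] by simp
  thus "\<exists>m>0. \<forall>t\<in>rroots q. card {s\<in>rroots p. reval s k = t} = m" using card by blast
qed

section \<open>Subfields of the complex numbers and primitive elements\<close>

lemma subring_of_range_reval: "subring_of (range (reval a))"
  unfolding subring_of_def
proof (safe)
  show "1 \<in> range (reval a)" by (metis rangeI reval.hom_one)
  fix r r' show "reval a r - reval a r' \<in> range (reval a)" by (metis rangeI reval.hom_minus)
  show "reval a r * reval a r' \<in> range (reval a)" by (metis rangeI reval.hom_mult)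
qed

lemma subfield_C_subring: "subfield_C K \<Longrightarrow> subring_of K"
  by (auto simp: subfield_C_def subring_of_def)

lemma subfield_C_range_reval:
  assumes "algebraic a"
  shows "subfield_C (range (reval a))"
proof -
  note R = subring_of_range_reval[of a]
  obtain p where p: "irreducible p" "a \<in> rroots p" using algebraic_min_rat_poly[OF assms] by blast
  have "inverse x \<in> range (reval a)" if "x \<in> range (reval a)" for x
  proof (cases "x = 0")
    case True thus ?thesis using subring_of_closed(1)[OF R] by simp
  next
    case False
    from that obtain r where r: "x = reval a r" by auto
    from reval_inverse[OF p, of r] False obtain r' where "x * reval a r' = 1" using p r by auto
    hence "inverse x = reval a r'" by (metis inverse_unique)
    thus ?thesis by simp
  qed
  thus ?thesis using subring_of_closed[OF R] by (auto simp: subfield_C_def)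
qed

lemma of_rat_in_subfield:
  assumes K: "subfield_C K"
  shows "of_rat a \<in> K"
proof -
  note R = subring_of_closed[OF subfield_C_subring[OF K]]
  have n: "of_nat n \<in> K" for n by (induction n) (auto intro: R(1,2,6))
  have i: "of_int z \<in> K" for z by (cases z rule: int_cases) (auto intro: R(5) n simp del: of_nat_Suc)
  obtain x y where "a = Rat.Fract x y" by (cases a) auto
  hence "(of_rat a :: complex) = of_int x * inverse (of_int y)" by (simp add: Fract_of_int_quotient of_rat_divide divide_inverse of_rat_mult of_rat_inverse)
  thus ?thesis using i K R(4) by (auto simp: subfield_C_def)
qed

lemma range_reval_subset_subfield:
  assumes K: "subfield_C K" and a: "a \<in> K"
  shows "range (reval a) \<subseteq> K"
proof -
  note R = subring_of_closed[OF subfield_C_subring[OF K]]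
  have "reval a r \<in> K" for r
    by (induction r) (auto intro!: R(1) R(4) R(6) a of_rat_in_subfield[OF K])
  thus ?thesis by blast
qed

lemma gen_field_subset: "A \<subseteq> gen_field A"
  by (auto simp: gen_field_def)

lemma subfield_gen_field: "subfield_C (gen_field A)"
  unfolding subfield_C_def gen_field_def by (safe; (auto simp: subfield_C_def; fail)?)

text \<open>\<open>X - b\<close> is the gcd over \<open>K = \<rat>(\<theta>)\<close> of \<open>g\<close> and \<open>f(\<theta> - t X)\<close>.\<close>
lemma primitive_element_2:
  assumes "algebraic a" "algebraic b"
  shows "\<exists>t::nat. {a, b} \<subseteq> range (reval (a + of_nat t * b))"
proof -
  obtain f where f: "irreducible f" "a \<in> rroots f" using algebraic_min_rat_poly[OF assms(1)] by blast
  obtain g where g: "irreducible g" "b \<in> rroots g" using algebraic_min_rat_poly[OF assms(2)] by blast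
  \<comment> \<open>The values to avoid are those for which \<open>\<theta>\<close> minus
    \<open>t\<close> times another root \<open>b'\<close> of \<open>g\<close> is a conjugate
    \<open>a'\<close> of \<open>a\<close>. For \<open>b' = b\<close> division by zero yields 0,
    which is excluded anyway.\<close>
  have fin: "finite ((\<lambda>(a', b'). (a' - a) / (b - b')) ` (rroots f \<times> rroots g))"
    using finite_rroots[OF f(1)] finite_rroots[OF g(1)] by auto
  have "infinite (range (of_nat :: nat \<Rightarrow> complex))"
    by (auto dest!: finite_imageD simp: inj_on_def)
  hence "infinite (range (of_nat :: nat \<Rightarrow> complex) - {0})" by (simp add: infinite_remove)
  from infinite_super[OF _ this] fin have "\<not> range (of_nat :: nat \<Rightarrow> complex) - {0} \<subseteq> (\<lambda>(a', b'). (a' - a) / (b - b')) ` (rroots f \<times> rroots g)"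
    by (meson finite_subset \<open>infinite (range of_nat - {0})\<close>)
  then obtain t :: nat where t: "(of_nat t :: complex) \<noteq> 0" "(of_nat t :: complex) \<notin> (\<lambda>(a', b'). (a' - a) / (b - b')) ` (rroots f \<times> rroots g)"
    by blast
  define \<theta> where "\<theta> = a + of_nat t * b"
  define K where "K = range (reval \<theta>)"
  have K: "subfield_C K" unfolding K_def \<theta>_def using assms
    by (intro subfield_C_range_reval algebraic_plus algebraic_times algebraic_int_imp_algebraic[OF algebraic_int_of_nat])
  note KR = subfield_C_subring[OF K]
  note KP = subring_of_polys_over[OF KR]
  have \<theta>K: "\<theta> \<in> K" unfolding K_def using reval_monom[of \<theta> 1 1] by (metis mult_1 of_rat_1 power_one_right rangeI)
  have natK: "of_nat n \<in> K" for n using of_rat_in_subfield[OF K, of "of_nat n"] by simp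
  define P1 where "P1 = (map_poly of_rat g :: complex poly)"
  define P2 where "P2 = pcompose (map_poly of_rat f) [:\<theta>, - of_nat t:]"
  have P1: "P1 \<in> polys_over K" using of_rat_in_subfield[OF K] by (auto simp: P1_def polys_over_def coeff_map_poly)
  have "pcompose (map_poly of_rat f) [:\<theta>, - of_nat t:] \<in> polys_over K" for f
  proof (induction f)
    case 0 show ?case using subring_of_closed(1)[OF KP] by simp
  next
    case (pCons c f)
    have "[:\<theta>, - of_nat t:] \<in> polys_over K" using \<theta>K natK subring_of_closed[OF KR]
      by (auto simp: polys_over_def coeff_pCons split: nat.splits)
    moreover have "[:of_rat c:] \<in> polys_over K" using of_rat_in_subfield[OF K] KR by (intro const_in_polys_over)
    moreover have "pcompose (map_poly of_rat (pCons c f)) [:\<theta>, - of_nat t:] =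
        [:of_rat c:] + [:\<theta>, - of_nat t:] * pcompose (map_poly of_rat f) [:\<theta>, - of_nat t:]"
      by (simp add: of_rat_hom.map_poly_pCons_hom pcompose_pCons)
    ultimately show ?case using pCons.IH subring_of_closed(4,6)[OF KP] by metis
  qed
  hence P2: "P2 \<in> polys_over K" by (simp add: P2_def)
  have P1_0: "P1 \<noteq> 0" using g(1) by (auto simp: P1_def irreducible_def)
  have Pb: "poly P1 b = 0" "poly P2 b = 0" using f(2) g(2)
    by (auto simp: P1_def P2_def poly_pcompose \<theta>_def rroots_def reval_def)
  have only: "x = b" if x: "poly P1 x = 0" "poly P2 x = 0" for x
  proof (rule ccontr)
    assume "x \<noteq> b"
    have "\<theta> - of_nat t * x \<in> rroots f" "x \<in> rroots g" using x
      by (auto simp: P1_def P2_def poly_pcompose rroots_def reval_def mult.commute)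
    moreover have "of_nat t = (\<theta> - of_nat t * x - a) / (b - x)" using \<open>x \<noteq> b\<close> by (simp add: \<theta>_def field_simps)
    ultimately show False using t(2) by force
  qed
  obtain w u0 v0 where uv0: "u0 \<in> polys_over K" "v0 \<in> polys_over K" "w = u0 * P1 + v0 * P2"
    and w: "w \<noteq> 0" "w \<in> polys_over K"
    and div: "\<And>v. v = P1 \<or> v = P2 \<Longrightarrow> \<exists>k m. m \<in> polys_over K \<and> [:lead_coeff w ^ k:] * v = w * m"
    using ideal_generator[OF KR P1 P1_0 P2] by metis
  have wb: "poly w b = 0" using uv0(3) Pb by simp
  have root: "poly v x = 0" if "poly w x = 0" "v = P1 \<or> v = P2" for v x
  proof -
    obtain k m where "[:lead_coeff w ^ k:] * v = w * m" using div[OF \<open>v = P1 \<or> v = P2\<close>] by blast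
    hence "poly ([:lead_coeff w ^ k:] * v) x = poly (w * m) x" by simp
    thus ?thesis using that w(1) by simp
  qed
  have wonly: "x = b" if "poly w x = 0" for x
    using only root[OF that, of P1] root[OF that, of P2] by blast
  obtain w1 where w1: "w = [:- b, 1:] * w1" using wb by (metis dvdE poly_eq_0_iff_dvd)
  \<comment> \<open>\<open>b\<close> is the only root of \<open>w\<close>, and were it a double
    root, it would be one of \<open>P1\<close> as well, although \<open>g\<close> is separable. So
    \<open>w\<close> is linear and its coefficients in \<open>K\<close> determine
    \<open>b\<close>.\<close>
  have "degree w1 = 0"
  proof (rule ccontr)
    assume "degree w1 \<noteq> 0"
    hence "\<not> constant (poly w1)" by (simp add: constant_degree)
    then obtain x where x: "poly w1 x = 0" using fundamental_theorem_of_algebra by blast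
    hence "x = b" using wonly[of x] w1 by simp
    then obtain w2 where w2: "w1 = [:- b, 1:] * w2" using x by (metis dvdE poly_eq_0_iff_dvd)
    obtain k m where km: "[:lead_coeff w ^ k:] * P1 = w * m" using div[of P1] by blast
    define L where "L = lead_coeff w ^ k"
    have L: "L \<noteq> 0" using w(1) by (simp add: L_def)
    have "[:L:] * P1 = [:- b, 1:] * ([:- b, 1:] * (w2 * m))"
      unfolding L_def km by (simp only: w1 w2 mult_ac)
    hence "Polynomial.smult L P1 = [:- b, 1:] * ([:- b, 1:] * (w2 * m))" by simp
    hence "pderiv (Polynomial.smult L P1) = pderiv ([:- b, 1:] * ([:- b, 1:] * (w2 * m)))" by simp
    hence "poly (pderiv (Polynomial.smult L P1)) b = poly (pderiv ([:- b, 1:] * ([:- b, 1:] * (w2 * m)))) b" by simp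
    hence "L * poly (pderiv P1) b = 0" by (simp add: pderiv_smult pderiv_mult del: mult_pCons_left)
    thus False using pderiv_nonzero_at_rroot[OF g] L by (simp add: P1_def)
  qed
  then obtain c where c: "w1 = [:c:]" by (rule degree_eq_zeroE)
  have "c \<noteq> 0" using w(1) w1 c by auto
  have "coeff w 0 = - (c * b)" "coeff w 1 = c" by (simp_all add: w1 c)
  hence "c * b \<in> K" "c \<in> K" using w(2) subring_of_closed(5)[OF KR, of "- (c * b)"]
    by (metis coeff_in_polys_over minus_minus)+
  hence "c * b * inverse c \<in> K" using K subring_of_closed(4)[OF KR] by (auto simp: subfield_C_def)
  moreover have "c * b * inverse c = b" using \<open>c \<noteq> 0\<close> by simp
  ultimately have bK: "b \<in> K" by metis
  have "\<theta> - of_nat t * b \<in> K" using bK \<theta>K natK subring_of_closed(3,4)[OF KR] by blast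
  hence "a \<in> K" by (simp add: \<theta>_def)
  thus ?thesis using bK unfolding K_def \<theta>_def by blast
qed

text \<open>Keeping \<open>\<theta>\<close> inside \<open>gen_field A\<close> during the induction
  ensures that it generates nothing more than this field.\<close>

theorem primitive_element:
  assumes "finite A" "\<And>a. a \<in> A \<Longrightarrow> algebraic (a :: complex)"
  shows "\<exists>\<theta>. algebraic \<theta> \<and> range (reval \<theta>) = gen_field A"
proof -
  have "\<exists>\<theta>. algebraic \<theta> \<and> \<theta> \<in> gen_field A \<and> A \<subseteq> range (reval \<theta>)"
    using assms
  proof (induction A rule: finite_induct)
    case empty
    have "0 \<in> gen_field {}" using subring_of_closed(1)[OF subfield_C_subring[OF subfield_gen_field]] .
    thus ?case by (intro exI[of _ 0]) auto
  next
    case (insert b A)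
    then obtain \<theta> where \<theta>: "algebraic \<theta>" "\<theta> \<in> gen_field A" "A \<subseteq> range (reval \<theta>)" by auto
    have b: "algebraic b" using insert by auto
    obtain t :: nat where t: "{\<theta>, b} \<subseteq> range (reval (\<theta> + of_nat t * b))" using primitive_element_2[OF \<theta>(1) b] by blast
    let ?\<theta> = "\<theta> + of_nat t * b"
    have alg: "algebraic ?\<theta>" using \<theta>(1) b
      by (intro algebraic_plus algebraic_times algebraic_int_imp_algebraic[OF algebraic_int_of_nat])
    note G = subfield_gen_field[of "insert b A"]
    note GR = subring_of_closed[OF subfield_C_subring[OF G]]
    have "gen_field A \<subseteq> gen_field (insert b A)" by (auto simp: gen_field_def)
    hence "\<theta> \<in> gen_field (insert b A)" "b \<in> gen_field (insert b A)" using \<theta>(2) gen_field_subset[of "insert b A"] by auto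
    moreover have "of_nat t \<in> gen_field (insert b A)" using of_rat_in_subfield[OF G, of "of_nat t"] by simp
    ultimately have "?\<theta> \<in> gen_field (insert b A)" using GR(4,6) by blast
    moreover have "A \<subseteq> range (reval ?\<theta>)"
      using \<theta>(3) range_reval_subset_subfield[OF subfield_C_range_reval[OF alg], of \<theta>] t by blast
    ultimately show ?case using alg t by (intro exI[of _ ?\<theta>]) auto
  qed
  then obtain \<theta> where \<theta>: "algebraic \<theta>" "\<theta> \<in> gen_field A" "A \<subseteq> range (reval \<theta>)" by blast
  have "range (reval \<theta>) \<subseteq> gen_field A" using range_reval_subset_subfield[OF subfield_gen_field \<theta>(2)] .
  moreover have "gen_field A \<subseteq> range (reval \<theta>)"
    using subfield_C_range_reval[OF \<theta>(1)] \<theta>(3) unfolding gen_field_def by blast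
  ultimately show ?thesis using \<theta>(1) by blast
qed

section \<open>Kronecker's lemma and heights of families\<close>

abbreviation int_polys :: "complex poly set" where
  "int_polys \<equiv> polys_over {x. algebraic_int x}"

lemmas int_polys_closed = subring_of_closed[OF subring_of_polys_over[OF subring_of_algebraic_ints]]

lemma int_polys_iff: "f \<in> int_polys \<longleftrightarrow> (\<forall>k. algebraic_int (coeff f k))"
  by (simp add: polys_over_def)

text \<open>The leading coefficient \<open>a\<close> of \<open>g\<close> is also that of the
  product, so \<open>a\<close> and \<open>a * r\<close> are algebraic integers. Subtracting the
  leading term of \<open>g\<close> therefore keeps the product integral and lowers the
  degree.\<close>

lemma int_polys_divide_root:
  fixes g :: "complex poly"
  assumes "[:- r, 1:] * g \<in> int_polys"
  shows "g \<in> int_polys"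
  using assms
proof (induction "degree g" arbitrary: g rule: less_induct)
  case less
  let ?f = "[:- r, 1:] * g"
  show ?case
  proof (cases "g = 0")
    case True thus ?thesis using int_polys_closed(1) by simp
  next
    case False
    define n where "n = degree g"
    define a where "a = lead_coeff g"
    have f0: "?f \<noteq> 0" using False by (metis mult_eq_0_iff one_neq_zero pCons_eq_0_iff)
    have lf: "lead_coeff ?f = a" by (simp only: lead_coeff_mult a_def) simp
    have ai: "algebraic_int (coeff ?f k)" for k using less.prems by (simp only: int_polys_iff)
    have "poly ?f r = 0" by simp
    from algebraic_int_lead_coeff_times_root[OF ai f0 this] have ar: "algebraic_int (a * r)" unfolding lf .
    have aa: "algebraic_int a" using ai[of "degree ?f"] lf by simp
    define g' where "g' = g - monom a n"
    have m: "[:- r, 1:] * monom a n \<in> int_polys"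
    proof -
      have "[:- r, 1:] * monom a n = monom a (Suc n) - monom (a * r) n"
        by (rule poly_eqI) (auto simp: coeff_pCons mult.commute split: nat.splits)
      moreover have "monom a (Suc n) \<in> int_polys" "monom (a * r) n \<in> int_polys"
        using aa ar by (auto intro!: monom_in_polys_over subring_of_algebraic_ints)
      ultimately show ?thesis using int_polys_closed(3) by metis
    qed
    have "[:- r, 1:] * g' = ?f - [:- r, 1:] * monom a n" by (simp only: g'_def right_diff_distrib)
    hence g'f: "[:- r, 1:] * g' \<in> int_polys" using int_polys_closed(3)[OF less.prems m] by metis
    have "g' = 0 \<or> degree g' < degree g"
    proof (rule disjCI)
      assume "\<not> degree g' < degree g"
      moreover have "degree g' \<le> degree g" unfolding g'_def n_def
        by (rule degree_diff_le) (auto simp: degree_monom_le)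
      moreover have "coeff g' (degree g) = 0" by (simp add: g'_def n_def a_def)
      ultimately show "g' = 0" by (metis leading_coeff_0_iff order_le_less)
    qed
    hence "g' \<in> int_polys" using less.hyps[OF _ g'f] int_polys_closed(1) by auto
    moreover have "monom a n \<in> int_polys" using aa by (auto intro!: monom_in_polys_over subring_of_algebraic_ints)
    ultimately have "g' + monom a n \<in> int_polys" by (rule int_polys_closed(6))
    thus ?thesis by (simp add: g'_def)
  qed
qed

text \<open>If \<open>h = (X - r) h\<^sub>1\<close> has integral coefficients then so have \<open>h\<^sub>1\<close> and \<open>r h\<^sub>1 = X h\<^sub>1 - h\<close>; this allows
  induction on the degree of \<open>f\<close>.\<close>
lemma kronecker_content:
  fixes f g :: "complex poly"
  assumes "[:c:] * (f * g) \<in> int_polys"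
  shows "algebraic_int (c * (coeff f i * coeff g j))"
  using assms
proof (induction "degree f" arbitrary: f i rule: less_induct)
  case less
  show ?case
  proof (cases "degree f = 0")
    case True
    then obtain a where f: "f = [:a:]" by (rule degree_eq_zeroE)
    have "algebraic_int (coeff ([:c:] * (f * g)) j)" using less.prems by (simp only: int_polys_iff)
    thus ?thesis by (cases i) (simp_all add: f mult_ac)
  next
    case False
    hence "\<not> constant (poly f)" by (simp add: constant_degree)
    then obtain r where "poly f r = 0" using fundamental_theorem_of_algebra by blast
    then obtain f1 where f1: "f = [:- r, 1:] * f1" by (metis dvdE poly_eq_0_iff_dvd)
    have f10: "f1 \<noteq> 0" using False f1 by auto
    have d: "degree f1 < degree f" "degree (Polynomial.smult r f1) < degree f"
    proof -
      have "degree f = Suc (degree f1)" unfolding f1 using f10 by (subst degree_mult_eq) auto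
      thus "degree f1 < degree f" "degree (Polynomial.smult r f1) < degree f" using degree_smult_le[of r f1] by linarith+
    qed
    have "[:c:] * (f * g) = [:- r, 1:] * ([:c:] * (f1 * g))" unfolding f1 by (simp only: mult_ac)
    hence h1: "[:c:] * (f1 * g) \<in> int_polys" using less.prems int_polys_divide_root by metis
    have "[:c:] * (Polynomial.smult r f1 * g) = [:0, 1:] * ([:c:] * (f1 * g)) - [:c:] * (f * g)"
      unfolding f1 by (simp add: algebra_simps smult_add_right)
    moreover have "[:0, 1:] \<in> int_polys" by (auto simp: int_polys_iff coeff_pCons split: nat.splits)
    ultimately have h2: "[:c:] * (Polynomial.smult r f1 * g) \<in> int_polys"
      using h1 less.prems int_polys_closed(3,4) by metis
    have e1: "algebraic_int (c * (coeff f1 k * coeff g j))" for k by (rule less.hyps[OF d(1) h1])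
    have e2: "algebraic_int (c * (r * coeff f1 k * coeff g j))" for k using less.hyps[OF d(2) h2, of k] by simp
    have "coeff f i = (case i of 0 \<Rightarrow> 0 | Suc k \<Rightarrow> coeff f1 k) - r * coeff f1 i"
      by (simp add: f1 coeff_pCons)
    hence "c * (coeff f i * coeff g j) = (case i of 0 \<Rightarrow> 0 | Suc k \<Rightarrow> c * (coeff f1 k * coeff g j)) - c * (r * coeff f1 i * coeff g j)"
      by (simp only:) (auto simp: algebra_simps split: nat.splits)
    thus ?thesis using e1 e2 by (auto intro!: algebraic_int_diff split: nat.splits)
  qed
qed

text \<open>The coefficient picked from one factor is absorbed into the constant, which is why
  \<open>c\<close> has to be arbitrary in the induction.\<close>

lemma kronecker_content_prod:
  fixes f :: "'a \<Rightarrow> complex poly"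
  assumes "finite R" "[:c:] * (\<Prod>s\<in>R. f s) \<in> int_polys"
  shows "algebraic_int (c * (\<Prod>s\<in>R. coeff (f s) (\<iota> s)))"
  using assms
proof (induction R arbitrary: c rule: finite_induct)
  case empty
  hence "algebraic_int (coeff ([:c:] * (\<Prod>s\<in>{}. f s)) 0)" by (simp only: int_polys_iff)
  thus ?case by simp
next
  case (insert x R)
  have "[:c:] * (f x * (\<Prod>s\<in>R. f s)) \<in> int_polys" using insert.prems insert.hyps by simp
  from kronecker_content[OF this, of "\<iota> x"]
  have "[:c * coeff (f x) (\<iota> x):] * (\<Prod>s\<in>R. f s) \<in> int_polys" by (simp add: int_polys_iff mult.assoc)
  from insert.IH[OF this] show ?case using insert.hyps by (simp add: mult.assoc)
qed

section \<open>Contents of norm forms and heights of families of conjugates\<close>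

definition int_content :: "complex poly \<Rightarrow> int" where
  "int_content P = content (SOME M :: int poly. P = map_poly of_int M)"

lemma int_content_of_int_poly [simp]: "int_content (map_poly of_int M) = content M"
proof -
  have "(SOME M'. (map_poly of_int M :: complex poly) = map_poly of_int M') = M"
    by (rule some_equality) (auto simp: poly_eq_iff coeff_map_poly)
  thus ?thesis by (simp add: int_content_def)
qed

lemma algebraic_int_quotient_iff:
  assumes "c \<noteq> 0"
  shows "algebraic_int (inverse (of_int c) * of_int k :: complex) \<longleftrightarrow> c dvd k"
proof
  assume "algebraic_int (inverse (of_int c) * of_int k :: complex)"
  moreover have "inverse (of_int c) * of_int k \<in> (\<rat> :: complex set)" by simp
  ultimately have "inverse (of_int c) * of_int k \<in> (\<int> :: complex set)" by (rule rational_algebraic_int_is_int)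
  then obtain z where "inverse (of_int c) * of_int k = (of_int z :: complex)" by (auto elim: Ints_cases)
  hence "of_int k = (of_int (c * z) :: complex)" using assms by (simp add: field_simps)
  hence "k = c * z" by (simp only: of_int_eq_iff)
  thus "c dvd k" by simp
next
  assume "c dvd k"
  then obtain z where "k = c * z" by (auto elim: dvdE)
  hence "inverse (of_int c) * of_int k = (of_int z :: complex)" using assms by simp
  thus "algebraic_int (inverse (of_int c) * of_int k :: complex)" by (metis algebraic_int_of_int)
qed

text \<open>Translates divisibility of integers into integrality of a quotient, the form in which
  Kronecker's lemma uses and delivers it.\<close>

lemma int_content_divides:
  assumes "c \<noteq> 0"
  shows "[:inverse (of_int c):] * map_poly of_int M \<in> int_polys \<longleftrightarrow> c dvd content M"
  using assms by (simp add: int_polys_iff coeff_map_poly algebraic_int_quotient_iff const_poly_dvd_iff flip: const_poly_dvd_iff_dvd_content)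

text \<open>One variable is enough: Kronecker's lemma makes the content of a product of such
  polynomials control every product of coordinates of the factors.\<close>

definition lin_form :: "nat \<Rightarrow> (nat \<Rightarrow> complex) \<Rightarrow> complex poly" where
  "lin_form N x = (\<Sum>i\<le>N. monom (x i) i)"

definition max_abs :: "nat \<Rightarrow> (nat \<Rightarrow> complex) \<Rightarrow> real" where
  "max_abs N x = Max ((\<lambda>i. cmod (x i)) ` {0..N})"

text \<open>A family \<open>X s\<close> of coordinate vectors indexed by the embeddings \<open>s \<in> R\<close> of a number field.\<close>
definition int_family :: "'a set \<Rightarrow> nat \<Rightarrow> ('a \<Rightarrow> nat \<Rightarrow> complex) \<Rightarrow> bool" where
  "int_family R N X \<longleftrightarrow> finite R \<and> R \<noteq> {} \<and> (\<forall>s\<in>R. \<exists>i\<le>N. X s i \<noteq> 0) \<and>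
     (\<forall>s\<in>R. \<forall>i\<le>N. algebraic_int (X s i)) \<and> (\<exists>M::int poly. (\<Prod>s\<in>R. lin_form N (X s)) = map_poly of_int M)"

definition family_content :: "'a set \<Rightarrow> nat \<Rightarrow> ('a \<Rightarrow> nat \<Rightarrow> complex) \<Rightarrow> int" where
  "family_content R N X = int_content (\<Prod>s\<in>R. lin_form N (X s))"

text \<open>Modelled on \<open>height_int\<close>, with the content of the norm form in the place of
  the ideal norm. Unlike the norm of an ideal, the content can be followed through scaling, field
  extension and polynomial maps by Gauss' and Kronecker's lemmas alone.\<close>

definition family_height :: "'a set \<Rightarrow> nat \<Rightarrow> ('a \<Rightarrow> nat \<Rightarrow> complex) \<Rightarrow> real" where
  "family_height R N X = ((\<Sum>s\<in>R. ln (max_abs N (X s))) - ln (real_of_int (family_content R N X))) / real (card R)"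

lemma coeff_lin_form: "coeff (lin_form N x) i = (if i \<le> N then x i else 0)"
proof -
  have "coeff (lin_form N x) i = (\<Sum>j\<le>N. if j = i then x i else 0)"
    unfolding lin_form_def coeff_sum by (rule sum.cong) auto
  thus ?thesis by simp
qed

lemma lin_form_eq_0_iff: "lin_form N x = 0 \<longleftrightarrow> (\<forall>i\<le>N. x i = 0)"
  by (auto simp: poly_eq_iff coeff_lin_form)

lemma lin_form_cong: "(\<And>i. i \<le> N \<Longrightarrow> x i = y i) \<Longrightarrow> lin_form N x = lin_form N y"
  by (simp add: lin_form_def)

lemma lin_form_scale: "lin_form N (\<lambda>i. c * x i) = [:c:] * lin_form N x"
  by (rule poly_eqI) (simp add: coeff_lin_form)

lemma max_abs_ge: "i \<le> N \<Longrightarrow> cmod (x i) \<le> max_abs N x"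
  unfolding max_abs_def by (intro Max_ge) auto

lemma max_abs_pos: "i \<le> N \<Longrightarrow> x i \<noteq> 0 \<Longrightarrow> max_abs N x > 0"
  using max_abs_ge[of i N x] by (metis less_le_trans zero_less_norm_iff)

lemma max_abs_cong: "(\<And>i. i \<le> N \<Longrightarrow> x i = y i) \<Longrightarrow> max_abs N x = max_abs N y"
  unfolding max_abs_def by (metis (no_types, lifting) atLeastAtMost_iff image_cong)

lemma max_abs_attained: "\<exists>i\<le>N. max_abs N x = cmod (x i)"
proof -
  have "max_abs N x \<in> (\<lambda>i. cmod (x i)) ` {0..N}" unfolding max_abs_def by (intro Max_in) auto
  thus ?thesis by auto
qed

lemma max_abs_scale: "max_abs N (\<lambda>i. c * x i) = cmod c * max_abs N x"
proof (rule antisym)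
  obtain i where "i \<le> N" "max_abs N (\<lambda>i. c * x i) = cmod (c * x i)" using max_abs_attained by blast
  thus "max_abs N (\<lambda>i. c * x i) \<le> cmod c * max_abs N x"
    using max_abs_ge[of i N x] by (simp add: norm_mult mult_left_mono)
  obtain i where "i \<le> N" "max_abs N x = cmod (x i)" using max_abs_attained by blast
  thus "cmod c * max_abs N x \<le> max_abs N (\<lambda>i. c * x i)"
    using max_abs_ge[of i N "\<lambda>i. c * x i"] by (simp add: norm_mult)
qed

lemma family_content_pos:
  assumes "int_family R N X"
  shows "family_content R N X > 0"
proof -
  from assms obtain M :: "int poly" where M: "(\<Prod>s\<in>R. lin_form N (X s)) = map_poly of_int M" and fin: "finite R"
    and nz: "\<forall>s\<in>R. \<exists>i\<le>N. X s i \<noteq> 0" by (auto simp: int_family_def)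
  have "(\<Prod>s\<in>R. lin_form N (X s)) \<noteq> 0" using fin nz by (auto simp: prod_zero_iff lin_form_eq_0_iff)
  hence "M \<noteq> 0" using M by auto
  hence "content M \<noteq> 0" by simp
  moreover have "content M \<ge> 0" by (metis abs_ge_zero normalize_content normalize_int_def)
  ultimately have "content M > 0" by linarith
  thus ?thesis by (simp add: family_content_def M)
qed

text \<open>Kronecker's lemma with a coordinate chosen independently for every conjugate. Such mixed
  products appear when a norm form is expanded; norms of single coordinates would not
  suffice.\<close>

lemma family_content_dvd_prod:
  assumes X: "int_family R N X" and i: "\<And>s. s \<in> R \<Longrightarrow> \<iota> s \<le> N"
  shows "algebraic_int (inverse (of_int (family_content R N X)) * (\<Prod>s\<in>R. X s (\<iota> s)))"
proof -
  from X obtain M :: "int poly" where M: "(\<Prod>s\<in>R. lin_form N (X s)) = map_poly of_int M" and fin: "finite R"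
    by (auto simp: int_family_def)
  have c: "family_content R N X = content M" by (simp add: family_content_def M)
  have "content M \<noteq> 0" using family_content_pos[OF X] unfolding c by linarith
  hence "[:inverse (of_int (family_content R N X)):] * (\<Prod>s\<in>R. lin_form N (X s)) \<in> int_polys"
    unfolding M c by (subst int_content_divides) auto
  from kronecker_content_prod[OF fin this, of \<iota>] show ?thesis
    using i by (simp add: coeff_lin_form cong: prod.cong)
qed

lemma dvd_family_contentI:
  assumes X: "int_family R N X" and "c \<noteq> 0" and "[:inverse (of_int c):] * (\<Prod>s\<in>R. lin_form N (X s)) \<in> int_polys"
  shows "c dvd family_content R N X"
proof -
  from X obtain M :: "int poly" where M: "(\<Prod>s\<in>R. lin_form N (X s)) = map_poly of_int M"
    by (auto simp: int_family_def)
  show ?thesis using int_content_divides[OF assms(2), of M] assms(3)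
    by (simp only: family_content_def M int_content_of_int_poly)
qed

text \<open>The sum over the conjugates and the logarithm of the content both grow by the logarithm
  of the absolute value of \<open>z\<close>. The product of the scalars has to be an integer for the
  content to scale.\<close>

lemma family_height_scale:
  assumes X: "int_family R N X" and l: "\<And>s. s \<in> R \<Longrightarrow> l s \<noteq> 0" "(\<Prod>s\<in>R. l s) = of_int z"
    and Y: "\<And>s i. s \<in> R \<Longrightarrow> i \<le> N \<Longrightarrow> Y s i = l s * X s i"
  shows "family_height R N Y = family_height R N X"
proof -
  from X obtain M :: "int poly" where M: "(\<Prod>s\<in>R. lin_form N (X s)) = map_poly of_int M" and fin: "finite R"
    by (auto simp: int_family_def)
  have lf: "lin_form N (Y s) = [:l s:] * lin_form N (X s)" if "s \<in> R" for s
    using Y[OF that] lin_form_cong[of N "Y s" "\<lambda>i. l s * X s i"] lin_form_scale by metis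
  have "(\<Prod>s\<in>R. [:l s:]) = [:\<Prod>s\<in>R. l s:]"
    using fin by (induction R rule: finite_induct) (auto simp: one_pCons mult.commute)
  moreover have "(\<Prod>s\<in>R. lin_form N (Y s)) = (\<Prod>s\<in>R. [:l s:]) * (\<Prod>s\<in>R. lin_form N (X s))"
    unfolding prod.distrib[symmetric] by (intro prod.cong lf) auto
  ultimately have "(\<Prod>s\<in>R. lin_form N (Y s)) = [:of_int z:] * map_poly of_int M"
    by (simp only: l(2) M)
  also have "\<dots> = map_poly of_int (Polynomial.smult z M)" by (simp add: hom_distribs)
  finally have cY: "family_content R N Y = \<bar>z\<bar> * family_content R N X"
    by (simp add: family_content_def M content_smult)
  have z: "z \<noteq> 0" using l fin by (metis of_int_0 prod_zero_iff)
  have c: "family_content R N X > 0" using family_content_pos[OF X] .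
  have mX: "max_abs N (X s) > 0" if "s \<in> R" for s using X that max_abs_pos by (auto simp: int_family_def)
  have mY: "max_abs N (Y s) = cmod (l s) * max_abs N (X s)" if "s \<in> R" for s
    using Y[OF that] max_abs_cong[of N "Y s" "\<lambda>i. l s * X s i"] max_abs_scale by metis
  have "(\<Sum>s\<in>R. ln (max_abs N (Y s))) = (\<Sum>s\<in>R. ln (cmod (l s)) + ln (max_abs N (X s)))"
  proof (intro sum.cong refl)
    fix s assume s: "s \<in> R"
    show "ln (max_abs N (Y s)) = ln (cmod (l s)) + ln (max_abs N (X s))"
      using mX[OF s] l(1)[OF s] by (simp add: mY[OF s] ln_mult)
  qed
  also have "\<dots> = ln (\<Prod>s\<in>R. cmod (l s)) + (\<Sum>s\<in>R. ln (max_abs N (X s)))"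
    using l(1) fin by (simp add: sum.distrib ln_prod)
  also have "(\<Prod>s\<in>R. cmod (l s)) = real_of_int \<bar>z\<bar>" using l(2) by (metis norm_of_int of_int_abs prod_norm)
  finally show ?thesis using z c
    by (simp add: family_height_def cY ln_mult)
qed

text \<open>This is invariance under field extension: every conjugate is repeated \<open>m\<close>
  times, so the sum, the logarithm of the content and the number of conjugates are all multiplied by
  \<open>m\<close>; for the content this is Gauss' lemma.\<close>

lemma family_height_fibres:
  assumes X: "int_family R' N X" and fin: "finite R" and \<pi>: "\<And>s. s \<in> R \<Longrightarrow> \<pi> s \<in> R'"
    and m: "m > 0" "\<And>t. t \<in> R' \<Longrightarrow> card {s\<in>R. \<pi> s = t} = m"
    and Y: "\<And>s i. s \<in> R \<Longrightarrow> i \<le> N \<Longrightarrow> Y s i = X (\<pi> s) i"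
  shows "family_height R N Y = family_height R' N X"
proof -
  from X obtain M :: "int poly" where M: "(\<Prod>s\<in>R'. lin_form N (X s)) = map_poly of_int M" and fin': "finite R'" "R' \<noteq> {}"
    by (auto simp: int_family_def)
  have img: "\<pi> ` R \<subseteq> R'" using \<pi> by auto
  have s: "(\<Sum>s\<in>R. g (\<pi> s)) = real m * (\<Sum>t\<in>R'. g t)" for g :: "_ \<Rightarrow> real"
  proof -
    have "(\<Sum>s\<in>R. g (\<pi> s)) = (\<Sum>t\<in>R'. \<Sum>s\<in>{x\<in>R. \<pi> x = t}. g (\<pi> s))" by (rule sum.group[symmetric, OF fin fin'(1) img])
    also have "\<dots> = (\<Sum>t\<in>R'. real m * g t)" using m(2) by (intro sum.cong) auto
    finally show ?thesis by (simp add: sum_distrib_left)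
  qed
  have p: "(\<Prod>s\<in>R. g (\<pi> s)) = (\<Prod>t\<in>R'. g t) ^ m" for g :: "_ \<Rightarrow> complex poly"
  proof -
    have "(\<Prod>s\<in>R. g (\<pi> s)) = (\<Prod>t\<in>R'. \<Prod>s\<in>{x\<in>R. \<pi> x = t}. g (\<pi> s))" by (rule prod.group[symmetric, OF fin fin'(1) img])
    also have "\<dots> = (\<Prod>t\<in>R'. g t ^ m)" using m(2) by (intro prod.cong) auto
    finally show ?thesis by (simp add: prod_power_distrib)
  qed
  have "(\<Prod>s\<in>R. lin_form N (Y s)) = (\<Prod>s\<in>R. lin_form N (X (\<pi> s)))"
    using Y by (intro prod.cong lin_form_cong) auto
  also have "\<dots> = map_poly of_int (M ^ m)" using p[of "\<lambda>t. lin_form N (X t)"] by (simp add: M hom_distribs)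
  finally have cY: "family_content R N Y = content (M ^ m)" by (simp add: family_content_def)
  have "content (M ^ m) = content M ^ m" by (induction m) (auto simp: content_mult)
  hence c: "family_content R N Y = family_content R' N X ^ m"
    unfolding cY by (simp add: family_content_def M)
  have "(\<Sum>s\<in>R. ln (max_abs N (Y s))) = real m * (\<Sum>s\<in>R'. ln (max_abs N (X s)))"
    unfolding s[of "\<lambda>t. ln (max_abs N (X t))", symmetric]
    using Y by (intro sum.cong arg_cong[where f = ln] max_abs_cong) auto
  moreover have "real (card R) = real m * real (card R')" using s[of "\<lambda>_. 1"] by simp
  moreover have "ln (real_of_int (family_content R N Y)) = real m * ln (real_of_int (family_content R' N X))"
    using family_content_pos[OF X] by (simp add: c ln_realpow)
  ultimately show ?thesis using m(1)
    by (simp add: family_height_def flip: right_diff_distrib)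
qed

text \<open>Spelling a monomial of degree \<open>d\<close> as a word of \<open>d\<close> letters
  allows a product of monomials over all conjugates to be regrouped into \<open>d\<close> products
  with one coordinate per conjugate, so that the content can be divided out \<open>d\<close>
  times.\<close>

lemma mon_eval_word:
  assumes "mon_deg m = d" "Poly_Mapping.keys m \<subseteq> {0..N}"
  shows "\<exists>w. (\<forall>t<d. w t \<le> N) \<and> (\<forall>x::nat \<Rightarrow> 'a::comm_ring_1. mon_eval x m = (\<Prod>t<d. x (w t)))"
proof -
  define ws where "ws = concat (map (\<lambda>i. replicate (Poly_Mapping.lookup m i) i) (sorted_list_of_set (Poly_Mapping.keys m)))"
  have "length ws = sum_list (map (Poly_Mapping.lookup m) (sorted_list_of_set (Poly_Mapping.keys m)))"
    by (simp add: ws_def length_concat comp_def)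
  also have "\<dots> = mon_deg m" by (simp add: mon_deg_def sum_list_distinct_conv_sum_set)
  finally have len: "length ws = d" using assms by simp
  have set: "set ws \<subseteq> {0..N}" using assms(2) by (auto simp: ws_def)
  have "mon_eval x m = (\<Prod>t<d. x (ws ! t))" for x :: "nat \<Rightarrow> 'a"
  proof -
    have "prod_list (map x (concat (map (\<lambda>i. replicate (f i) i) js))) = prod_list (map (\<lambda>i. x i ^ f i) js)" for f and js :: "nat list"
      by (induction js) (auto simp: prod_list_replicate)
    hence "prod_list (map x ws) = prod_list (map (\<lambda>i. x i ^ Poly_Mapping.lookup m i) (sorted_list_of_set (Poly_Mapping.keys m)))"
      by (simp add: ws_def)
    also have "\<dots> = mon_eval x m" by (simp add: mon_eval_def prod.distinct_set_conv_list[symmetric])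
    finally show ?thesis by (simp add: prod.list_conv_set_nth len atLeast0LessThan)
  qed
  moreover have "ws ! t \<le> N" if "t < d" for t using subsetD[OF set nth_mem[of t ws]] len that by simp
  ultimately show ?thesis by (intro exI[of _ "(!) ws"]) auto
qed

text \<open>In the expanded norm form of \<open>Y\<close> each term is an algebraic integer times
  one monomial of degree \<open>d\<close> per conjugate, hence divisible by the \<open>d\<close>-th
  power of the content of \<open>X\<close>. This bounds the content of \<open>Y\<close> from below;
  the absolute values are bounded by the triangle inequality.\<close>

lemma family_height_map:
  assumes X: "int_family R N X" and Y: "int_family R N Y"
    and fin: "\<And>i. finite (Ms i)"
    and Ms: "\<And>i m. i \<le> N \<Longrightarrow> m \<in> Ms i \<Longrightarrow> mon_deg m = d \<and> Poly_Mapping.keys m \<subseteq> {0..N}"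
    and c: "\<And>s i m. s \<in> R \<Longrightarrow> i \<le> N \<Longrightarrow> m \<in> Ms i \<Longrightarrow> algebraic_int (c s i m)"
    and Yeq: "\<And>s i. s \<in> R \<Longrightarrow> i \<le> N \<Longrightarrow> Y s i = (\<Sum>m\<in>Ms i. c s i m * mon_eval (X s) m)"
    and B: "\<And>s i. s \<in> R \<Longrightarrow> i \<le> N \<Longrightarrow> (\<Sum>m\<in>Ms i. cmod (c s i m)) \<le> B" "B \<ge> 1"
  shows "family_height R N Y \<le> real d * family_height R N X + ln B"
proof -
  have finR: "finite R" "R \<noteq> {}" using X by (auto simp: int_family_def)
  define cX where "cX = family_content R N X"
  have cX: "cX > 0" using family_content_pos[OF X] by (simp add: cX_def)
  have mon: "algebraic_int (inverse (of_int (cX ^ d)) * (\<Prod>s\<in>R. mon_eval (X s) (\<mu> s)))"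
    if \<mu>: "\<And>s. s \<in> R \<Longrightarrow> mon_deg (\<mu> s) = d \<and> Poly_Mapping.keys (\<mu> s) \<subseteq> {0..N}" for \<mu>
  proof -
    have "\<forall>s\<in>R. \<exists>w. (\<forall>t<d. w t \<le> N) \<and> (\<forall>x::nat \<Rightarrow> complex. mon_eval x (\<mu> s) = (\<Prod>t<d. x (w t)))"
      using \<mu> by (intro ballI mon_eval_word) auto
    then obtain w where w: "\<And>s t. s \<in> R \<Longrightarrow> t < d \<Longrightarrow> w s t \<le> N"
      "\<And>s x. s \<in> R \<Longrightarrow> mon_eval (x::nat \<Rightarrow> complex) (\<mu> s) = (\<Prod>t<d. x (w s t))" by metis
    have "(\<Prod>s\<in>R. mon_eval (X s) (\<mu> s)) = (\<Prod>t<d. \<Prod>s\<in>R. X s (w s t))"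
      by (subst prod.swap) (simp add: w cong: prod.cong)
    hence "inverse (of_int (cX ^ d)) * (\<Prod>s\<in>R. mon_eval (X s) (\<mu> s)) =
       (\<Prod>t<d. inverse (of_int cX) * (\<Prod>s\<in>R. X s (w s t)))"
      by (simp add: prod.distrib power_inverse)
    moreover have "algebraic_int (inverse (of_int cX) * (\<Prod>s\<in>R. X s (w s t)))" if "t < d" for t
      unfolding cX_def by (rule family_content_dvd_prod[OF X]) (use w(1) that in auto)
    hence "algebraic_int (\<Prod>t<d. inverse (of_int cX) * (\<Prod>s\<in>R. X s (w s t)))"
      by (intro algebraic_int_prod) auto
    ultimately show ?thesis by (simp only:)
  qed
  have "cX ^ d dvd family_content R N Y"
  proof (rule dvd_family_contentI[OF Y])
    define J where "J = (SIGMA i:{..N}. Ms i)"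
    have finJ: "finite J" using fin by (auto simp: J_def)
    have "lin_form N (Y s) = (\<Sum>(i, m)\<in>J. monom (c s i m * mon_eval (X s) m) i)" if "s \<in> R" for s
    proof -
      have "lin_form N (Y s) = (\<Sum>i\<le>N. \<Sum>m\<in>Ms i. monom (c s i m * mon_eval (X s) m) i)"
        unfolding lin_form_def using Yeq[OF that] by (intro sum.cong) (auto simp: monom_sum)
      also have "\<dots> = (\<Sum>(i, m)\<in>J. monom (c s i m * mon_eval (X s) m) i)"
        unfolding J_def using fin by (intro sum.Sigma) auto
      finally show ?thesis .
    qed
    hence "(\<Prod>s\<in>R. lin_form N (Y s)) = (\<Prod>s\<in>R. \<Sum>j\<in>J. monom (c s (fst j) (snd j) * mon_eval (X s) (snd j)) (fst j))"
      by (simp add: case_prod_unfold cong: prod.cong)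
    \<comment> \<open>One summand for each choice of a coordinate and a monomial at every
      conjugate.\<close>
    also have "\<dots> = (\<Sum>\<phi>\<in>Pi\<^sub>E R (\<lambda>_. J). \<Prod>s\<in>R. monom (c s (fst (\<phi> s)) (snd (\<phi> s)) * mon_eval (X s) (snd (\<phi> s))) (fst (\<phi> s)))"
      by (rule prod_sum_PiE) (use finR finJ in auto)
    also have "[:inverse (of_int (cX ^ d)):] * \<dots> \<in> int_polys"
      unfolding sum_distrib_left
    proof (rule subring_of_sum[OF subring_of_polys_over[OF subring_of_algebraic_ints]])
      fix \<phi> assume \<phi>: "\<phi> \<in> Pi\<^sub>E R (\<lambda>_. J)"
      have "(\<Prod>s\<in>R. monom (a s) (k s)) = monom (\<Prod>s\<in>R. a s) (\<Sum>s\<in>R. k s)" for a :: "_ \<Rightarrow> complex" and k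
        using finR(1) by (induction R rule: finite_induct) (auto simp: mult_monom one_pCons monom_0)
      hence eq: "[:inverse (of_int (cX ^ d)):] * (\<Prod>s\<in>R. monom (c s (fst (\<phi> s)) (snd (\<phi> s)) * mon_eval (X s) (snd (\<phi> s))) (fst (\<phi> s))) =
         monom ((\<Prod>s\<in>R. c s (fst (\<phi> s)) (snd (\<phi> s))) * (inverse (of_int (cX ^ d)) * (\<Prod>s\<in>R. mon_eval (X s) (snd (\<phi> s))))) (\<Sum>s\<in>R. fst (\<phi> s))"
        by (simp add: prod.distrib smult_monom mult_ac)
      have m: "fst (\<phi> s) \<le> N \<and> snd (\<phi> s) \<in> Ms (fst (\<phi> s))" if "s \<in> R" for s
        using PiE_mem[OF \<phi> that] by (auto simp: J_def)
      show "[:inverse (of_int (cX ^ d)):] * (\<Prod>s\<in>R. monom (c s (fst (\<phi> s)) (snd (\<phi> s)) * mon_eval (X s) (snd (\<phi> s))) (fst (\<phi> s))) \<in> int_polys"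
        unfolding eq
      proof (intro monom_in_polys_over subring_of_algebraic_ints CollectI algebraic_int_times[OF algebraic_int_prod mon])
        fix s assume "s \<in> R"
        thus "algebraic_int (c s (fst (\<phi> s)) (snd (\<phi> s)))"
          "mon_deg (snd (\<phi> s)) = d \<and> Poly_Mapping.keys (snd (\<phi> s)) \<subseteq> {0..N}"
          using m[of s] Ms c by blast+
      qed
    qed
    finally show "[:inverse (of_int (cX ^ d)):] * (\<Prod>s\<in>R. lin_form N (Y s)) \<in> int_polys" .
  qed (use cX in auto)
  hence "cX ^ d \<le> family_content R N Y" using family_content_pos[OF Y] by (rule zdvd_imp_le)
  hence "ln (real_of_int (cX ^ d)) \<le> ln (real_of_int (family_content R N Y))" using cX family_content_pos[OF Y] by (subst ln_le_cancel_iff) auto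
  hence lc: "real d * ln (real_of_int cX) \<le> ln (real_of_int (family_content R N Y))" using cX by (simp add: ln_realpow)
  have ln: "ln (max_abs N (Y s)) \<le> real d * ln (max_abs N (X s)) + ln B" if s: "s \<in> R" for s
  proof -
    have "\<exists>i\<le>N. X s i \<noteq> 0" "\<exists>i\<le>N. Y s i \<noteq> 0" using X Y s unfolding int_family_def by blast+
    hence pX: "max_abs N (X s) > 0" and pY: "max_abs N (Y s) > 0" using max_abs_pos by blast+
    obtain i where i: "i \<le> N" "max_abs N (Y s) = cmod (Y s i)" using max_abs_attained by blast
    have mb: "cmod (mon_eval (X s) m) \<le> max_abs N (X s) ^ d" if m: "m \<in> Ms i" for m
    proof -
      obtain w where w: "\<And>t. t < d \<Longrightarrow> w t \<le> N" "mon_eval (X s) m = (\<Prod>t<d. X s (w t))"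
        using mon_eval_word[where 'a = complex, OF conjunct1[OF Ms[OF i(1) m]] conjunct2[OF Ms[OF i(1) m]]] by blast
      have "cmod (mon_eval (X s) m) = (\<Prod>t<d. cmod (X s (w t)))" by (simp add: w(2) prod_norm)
      also have "\<dots> \<le> (\<Prod>t<d. max_abs N (X s))" using w(1) max_abs_ge by (intro prod_mono) auto
      finally show ?thesis by simp
    qed
    have "max_abs N (Y s) \<le> (\<Sum>m\<in>Ms i. cmod (c s i m) * cmod (mon_eval (X s) m))"
      unfolding i(2) Yeq[OF s i(1)] by (rule order_trans[OF norm_sum]) (simp add: norm_mult)
    also have "\<dots> \<le> (\<Sum>m\<in>Ms i. cmod (c s i m) * max_abs N (X s) ^ d)"
      using mb by (intro sum_mono mult_left_mono) auto
    also have "\<dots> \<le> B * max_abs N (X s) ^ d"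
      using B(1)[OF s i(1)] pX by (simp add: sum_distrib_right[symmetric] mult_right_mono)
    finally have "ln (max_abs N (Y s)) \<le> ln (B * max_abs N (X s) ^ d)" using pY by (subst ln_le_cancel_iff) auto
    also have "\<dots> = real d * ln (max_abs N (X s)) + ln B" using B(2) pX by (simp add: ln_mult ln_realpow)
    finally show ?thesis .
  qed
  have "(\<Sum>s\<in>R. ln (max_abs N (Y s))) \<le> real d * (\<Sum>s\<in>R. ln (max_abs N (X s))) + real (card R) * ln B"
    using sum_mono[OF ln] by (simp add: sum.distrib sum_distrib_left)
  hence "(\<Sum>s\<in>R. ln (max_abs N (Y s))) - ln (real_of_int (family_content R N Y)) \<le>
     real d * ((\<Sum>s\<in>R. ln (max_abs N (X s))) - ln (real_of_int cX)) + real (card R) * ln B"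
    using lc by (simp add: right_diff_distrib)
  moreover have "real (card R) > 0" using finR by (simp add: card_gt_0_iff)
  ultimately show ?thesis unfolding family_height_def cX_def by (simp add: field_simps)
qed

section \<open>The index of an ideal\<close>

text \<open>Lattices of full rank in the rational space of polynomials of degree below
  \<open>n\<close>: the common denominator expresses discreteness, the multiples of monomials full
  rank.\<close>

definition full_lattice :: "nat \<Rightarrow> rat poly set \<Rightarrow> bool" where
  "full_lattice n L \<longleftrightarrow> 0 \<in> L \<and> (\<forall>q\<in>L. \<forall>q'\<in>L. q - q' \<in> L) \<and> (\<forall>q\<in>L. degree q < n) \<and>
     (\<exists>D::int. D > 0 \<and> (\<forall>q\<in>L. \<forall>k. of_int D * coeff q k \<in> \<int>)) \<and>
     (\<forall>k<n. \<exists>d::int. d > 0 \<and> monom (of_int d) k \<in> L)"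

text \<open>A basis in Hermite normal form: \<open>\<beta> i\<close> has the smallest positive
  coefficient at \<open>i\<close> among the lattice elements of degree at most
  \<open>i\<close>.\<close>

definition tri_basis :: "nat \<Rightarrow> rat poly set \<Rightarrow> (nat \<Rightarrow> rat poly) \<Rightarrow> bool" where
  "tri_basis n L \<beta> \<longleftrightarrow> (\<forall>i<n. \<beta> i \<in> L \<and> degree (\<beta> i) \<le> i \<and> coeff (\<beta> i) i > 0 \<and>
     (\<forall>q\<in>L. degree q \<le> i \<longrightarrow> (\<exists>z::int. coeff q i = of_int z * coeff (\<beta> i) i)))"

lemma tri_basisD:
  assumes "tri_basis n L \<beta>" "i < n"
  shows "\<beta> i \<in> L" "degree (\<beta> i) \<le> i" "coeff (\<beta> i) i > 0"
    "q \<in> L \<Longrightarrow> degree q \<le> i \<Longrightarrow> \<exists>z::int. coeff q i = of_int z * coeff (\<beta> i) i"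
  using assms unfolding tri_basis_def by blast+

abbreviation zsmult :: "int \<Rightarrow> rat poly \<Rightarrow> rat poly" where
  "zsmult z q \<equiv> Polynomial.smult (of_int z) q"

lemma full_lattice_closed:
  assumes "full_lattice n L"
  shows "0 \<in> L" "q \<in> L \<Longrightarrow> q' \<in> L \<Longrightarrow> q - q' \<in> L" "q \<in> L \<Longrightarrow> q' \<in> L \<Longrightarrow> q + q' \<in> L" "q \<in> L \<Longrightarrow> zsmult z q \<in> L"
    "q \<in> L \<Longrightarrow> degree q < n"
proof -
  show 0: "0 \<in> L" and m: "\<And>q q'. q \<in> L \<Longrightarrow> q' \<in> L \<Longrightarrow> q - q' \<in> L" and "q \<in> L \<Longrightarrow> degree q < n"
    using assms by (auto simp: full_lattice_def)
  have n: "- q \<in> L" if "q \<in> L" for q using m[OF 0 that] by simp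
  have a: "q + q' \<in> L" if "q \<in> L" "q' \<in> L" for q q' using m[OF that(1) n[OF that(2)]] by simp
  thus "q \<in> L \<Longrightarrow> q' \<in> L \<Longrightarrow> q + q' \<in> L" .
  assume q: "q \<in> L"
  have nn: "Polynomial.smult (of_nat k) q \<in> L" for k
    by (induction k) (auto simp: 0 smult_add_left q intro: a)
  show "zsmult z q \<in> L"
    by (cases z rule: int_cases) (use nn n in \<open>auto simp del: of_nat_Suc\<close>)
qed

lemma full_lattice_sum:
  assumes "full_lattice n L" "\<And>i. i \<in> I \<Longrightarrow> f i \<in> L"
  shows "sum f I \<in> L"
  using assms(2) by (induction I rule: infinite_finite_induct) (auto intro: full_lattice_closed[OF assms(1)])

text \<open>Multiplied by the common denominator \<open>D\<close>, the coefficients become integers,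
  so a smallest positive one exists; division with remainder shows that the others are its
  multiples.\<close>

lemma tri_basis_exists:
  assumes L: "full_lattice n L"
  shows "\<exists>\<beta>. tri_basis n L \<beta>"
proof -
  obtain D :: int where D: "D > 0" "\<And>q k. q \<in> L \<Longrightarrow> of_int D * coeff q k \<in> \<int>" using L by (auto simp: full_lattice_def)
  have "\<exists>b. b \<in> L \<and> degree b \<le> i \<and> coeff b i > 0 \<and> (\<forall>q\<in>L. degree q \<le> i \<longrightarrow> (\<exists>z::int. coeff q i = of_int z * coeff b i))"
    if i: "i < n" for i
  proof -
    define P where "P q \<longleftrightarrow> q \<in> L \<and> degree q \<le> i \<and> coeff q i > 0" for q
    define \<mu> where "\<mu> (q :: rat poly) = nat \<lfloor>of_int D * coeff q i\<rfloor>" for q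
    obtain d :: int where "d > 0" "monom (of_int d) i \<in> L" using L i by (auto simp: full_lattice_def)
    hence "P (monom (of_int d) i)" by (auto simp: P_def degree_monom_le)
    then obtain b where b: "P b" "\<And>q. P q \<Longrightarrow> \<mu> b \<le> \<mu> q" using ex_has_least_nat[of P _ \<mu>] by blast
    have "\<exists>z::int. coeff q i = of_int z * coeff b i" if q: "q \<in> L" "degree q \<le> i" for q
    proof -
      define z where "z = \<lfloor>coeff q i / coeff b i\<rfloor>"
      define q' where "q' = q - zsmult z b"
      have bp: "coeff b i > 0" using b by (simp add: P_def)
      have q'L: "q' \<in> L" unfolding q'_def using q b by (intro full_lattice_closed[OF L]) (auto simp: P_def)
      have q'd: "degree q' \<le> i" unfolding q'_def using q b
        by (intro degree_diff_le order_trans[OF degree_smult_le]) (auto simp: P_def)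
      have "of_int z \<le> coeff q i / coeff b i" "coeff q i / coeff b i < of_int z + 1" unfolding z_def by linarith+
      hence c: "0 \<le> coeff q' i" "coeff q' i < coeff b i" using bp by (simp_all add: q'_def field_simps)
      have "coeff q' i = 0"
      proof (rule ccontr)
        assume "coeff q' i \<noteq> 0"
        hence "P q'" using q'L q'd c by (auto simp: P_def)
        from b(2)[OF this] have le: "\<mu> b \<le> \<mu> q'" .
        obtain u v where uv: "of_int D * coeff b i = of_int u" "of_int D * coeff q' i = of_int v"
          using D(2)[of b i] D(2)[of q' i] q'L b by (auto simp: P_def elim!: Ints_cases)
        have "of_int D * coeff q' i < of_int D * coeff b i" using c D by (intro mult_strict_left_mono) auto
        hence "v < u" using uv by simp
        moreover have "of_int D * coeff q' i \<ge> 0" using c D by simp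
        hence "v \<ge> 0" using uv by simp
        ultimately show False using le by (simp add: \<mu>_def uv)
      qed
      thus ?thesis by (intro exI[of _ z]) (simp add: q'_def)
    qed
    thus ?thesis using b by (auto simp: P_def)
  qed
  thus ?thesis unfolding tri_basis_def by metis
qed

lemma tri_basis_span:
  assumes L: "full_lattice n L" and \<beta>: "tri_basis n L \<beta>" and q: "q \<in> L"
  shows "\<exists>z::nat \<Rightarrow> int. q = (\<Sum>i<n. zsmult (z i) (\<beta> i))"
proof -
  have "\<exists>z::nat \<Rightarrow> int. q = (\<Sum>i<m. zsmult (z i) (\<beta> i))"
    if "m \<le> n" "q \<in> L" "\<And>i. i \<ge> m \<Longrightarrow> coeff q i = 0" for m q
    using that
  proof (induction m arbitrary: q)
    case 0
    thus ?case by (auto simp: poly_eq_iff)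
  next
    case (Suc m)
    have "degree q \<le> m" using Suc.prems by (intro degree_le) auto
    then obtain z where z: "coeff q m = of_int z * coeff (\<beta> m) m" using tri_basisD(4)[OF \<beta>, of m q] Suc.prems by auto
    define q' where "q' = q - zsmult z (\<beta> m)"
    have "q' \<in> L" unfolding q'_def using Suc.prems tri_basisD(1)[OF \<beta>, of m] by (intro full_lattice_closed[OF L]) auto
    moreover have "coeff q' i = 0" if "i \<ge> m" for i
    proof (cases "i = m")
      case False
      hence "coeff (\<beta> m) i = 0" using that tri_basisD(2)[OF \<beta>, of m] Suc.prems by (intro coeff_eq_0) auto
      thus ?thesis using False that Suc.prems(3)[of i] by (simp add: q'_def)
    qed (simp add: q'_def z)
    ultimately obtain w :: "nat \<Rightarrow> int" where w: "q' = (\<Sum>i<m. zsmult (w i) (\<beta> i))" using Suc.IH[of q'] Suc.prems by auto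
    have "q = (\<Sum>i<m. zsmult ((w(m := z)) i) (\<beta> i)) + zsmult z (\<beta> m)" using w by (simp add: q'_def algebra_simps)
    thus ?case by (intro exI[of _ "w(m := z)"]) simp
  qed
  from this[of n q] show ?thesis using q full_lattice_closed(5)[OF L q] by (auto simp: coeff_eq_0)
qed

text \<open>The \<open>c i\<close> are the ratios of the diagonal entries, and digit vectors with
  entries from 0 to \<open>c i - 1\<close> represent the cosets of \<open>L'\<close> in
  \<open>L\<close>. They are inequivalent because at the largest index where two of them differ the
  difference is smaller than \<open>c i\<close>; they are exhaustive by division with remainder from
  the top degree downwards.\<close>

lemma tri_basis_index:
  assumes L: "full_lattice n L" "tri_basis n L \<beta>" and L': "full_lattice n L'" "tri_basis n L' \<beta>'" and sub: "L' \<subseteq> L"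
  obtains c :: "nat \<Rightarrow> int" where "\<And>i. i < n \<Longrightarrow> c i > 0" "\<And>i. i < n \<Longrightarrow> coeff (\<beta>' i) i = of_int (c i) * coeff (\<beta> i) i"
    "\<And>e e'. e \<in> Pi\<^sub>E {..<n} (\<lambda>i. {0..<c i}) \<Longrightarrow> e' \<in> Pi\<^sub>E {..<n} (\<lambda>i. {0..<c i}) \<Longrightarrow>
      (\<Sum>i<n. zsmult (e i) (\<beta> i)) - (\<Sum>i<n. zsmult (e' i) (\<beta> i)) \<in> L' \<Longrightarrow> e = e'"
    "\<And>q. q \<in> L \<Longrightarrow> \<exists>e\<in>Pi\<^sub>E {..<n} (\<lambda>i. {0..<c i}). q - (\<Sum>i<n. zsmult (e i) (\<beta> i)) \<in> L'"
proof -
  have "\<forall>i\<in>{..<n}. \<exists>z::int. coeff (\<beta>' i) i = of_int z * coeff (\<beta> i) i"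
    using L(2) L'(2) sub unfolding tri_basis_def by (metis lessThan_iff subsetD)
  then obtain c where c: "\<And>i. i < n \<Longrightarrow> coeff (\<beta>' i) i = of_int (c i) * coeff (\<beta> i) i" by (metis lessThan_iff)
  have bp: "coeff (\<beta> i) i > 0" "coeff (\<beta>' i) i > 0" if "i < n" for i using L L' that by (auto simp: tri_basis_def)
  have cp: "c i > 0" if "i < n" for i using c[OF that] bp[OF that] by (auto simp: zero_less_mult_iff)
  have z0: "coeff (\<beta> j) i = 0" "coeff (\<beta>' j) i = 0" if "j < i" "j < n" for i j
    using L L' that by (auto simp: tri_basis_def intro!: coeff_eq_0 le_less_trans[of _ j i])
  have inj: "e = e'" if e: "e \<in> Pi\<^sub>E {..<n} (\<lambda>i. {0..<c i})" "e' \<in> Pi\<^sub>E {..<n} (\<lambda>i. {0..<c i})"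
    and d: "(\<Sum>i<n. zsmult (e i) (\<beta> i)) - (\<Sum>i<n. zsmult (e' i) (\<beta> i)) \<in> L'" for e e'
  proof (rule ccontr)
    assume "e \<noteq> e'"
    hence ne: "\<exists>i<n. e i \<noteq> e' i" using e by (metis PiE_ext lessThan_iff)
    define i where "i = Max {i. i < n \<and> e i \<noteq> e' i}"
    have fin: "finite {i. i < n \<and> e i \<noteq> e' i}" by auto
    have i: "i < n" "e i \<noteq> e' i" using Max_in[OF fin] ne unfolding i_def by auto
    have mx: "e j = e' j" if "i < j" "j < n" for j
    proof (rule ccontr)
      assume "e j \<noteq> e' j"
      hence "j \<le> i" unfolding i_def using that by (intro Max_ge[OF fin]) auto
      thus False using that by simp
    qed
    define q where "q = (\<Sum>j<n. zsmult (e j - e' j) (\<beta> j))"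
    have qL: "q \<in> L'" using d by (simp add: q_def sum_subtractf smult_diff_left)
    have cq: "coeff q k = (\<Sum>j<n. of_int (e j - e' j) * coeff (\<beta> j) k)" for k by (simp add: q_def coeff_sum)
    have "coeff q k = 0" if "k > i" for k unfolding cq
    proof (rule sum.neutral, intro ballI)
      fix j assume "j \<in> {..<n}"
      thus "of_int (e j - e' j) * coeff (\<beta> j) k = 0"
        using mx[of j] z0(1)[of j k] that by (cases "j \<le> i") auto
    qed
    hence dq: "degree q \<le> i" by (intro degree_le) auto
    have "coeff q i = (\<Sum>j<n. if j = i then of_int (e i - e' i) * coeff (\<beta> i) i else 0)" unfolding cq
    proof (rule sum.cong)
      fix j assume "j \<in> {..<n}"
      thus "of_int (e j - e' j) * coeff (\<beta> j) i = (if j = i then of_int (e i - e' i) * coeff (\<beta> i) i else 0)"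
        using mx[of j] z0(1)[of j i] by (cases j i rule: linorder_cases) auto
    qed simp
    hence ci: "coeff q i = of_int (e i - e' i) * coeff (\<beta> i) i" using i by simp
    obtain z :: int where "coeff q i = of_int z * coeff (\<beta>' i) i" using L'(2) qL dq i by (auto simp: tri_basis_def)
    hence "of_int (e i - e' i) * coeff (\<beta> i) i = of_int (z * c i) * coeff (\<beta> i) i" using ci c[OF i(1)] by simp
    hence "e i - e' i = z * c i" using bp(1)[OF i(1)] by (simp only: mult_cancel_right of_int_eq_iff) auto
    moreover have "\<bar>e i - e' i\<bar> < c i" using PiE_mem[OF e(1), of i] PiE_mem[OF e(2), of i] i by auto
    ultimately have "\<bar>z\<bar> * c i < 1 * c i" using cp[OF i(1)] by (simp add: abs_mult)
    hence "z = 0" using cp[OF i(1)] by (simp add: mult_less_cancel_right)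
    thus False using \<open>e i - e' i = z * c i\<close> i by simp
  qed
  have surj0: "\<exists>e. (\<forall>i<m. e i \<in> {0..<c i}) \<and> q - (\<Sum>i<m. zsmult (e i) (\<beta> i)) \<in> L'"
    if "m \<le> n" "q \<in> L" "\<And>i. i \<ge> m \<Longrightarrow> coeff q i = 0" for m q
    using that
  proof (induction m arbitrary: q)
    case 0
    hence "q = 0" by (auto simp: poly_eq_iff)
    thus ?case using full_lattice_closed(1)[OF L'(1)] by simp
  next
    case (Suc m)
    have m: "m < n" using Suc.prems by simp
    have "degree q \<le> m" using Suc.prems by (intro degree_le) auto
    then obtain z where z: "coeff q m = of_int z * coeff (\<beta> m) m" using tri_basisD(4)[OF L(2) m, of q] Suc.prems by auto
    have b: "\<beta> m \<in> L" "\<beta>' m \<in> L'" using L(2) L'(2) m by (auto simp: tri_basis_def)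
    \<comment> \<open>The remainder of the top coefficient becomes the digit, while the quotient is
      absorbed by a multiple of the basis element of \<open>L'\<close>.\<close>
    define q1 where "q1 = q - zsmult (z mod c m) (\<beta> m) - zsmult (z div c m) (\<beta>' m)"
    have "q1 \<in> L" unfolding q1_def using Suc.prems(2) b sub by (intro full_lattice_closed[OF L(1)]) auto
    moreover have "coeff q1 i = 0" if "i \<ge> m" for i
    proof (cases "i = m")
      case True
      have "of_int z = (of_int (z mod c m + z div c m * c m) :: rat)" by simp
      hence "of_int z = of_int (z mod c m) + of_int (z div c m) * (of_int (c m) :: rat)" by (simp only: of_int_add of_int_mult)
      thus ?thesis using True by (simp add: q1_def z c[OF m] algebra_simps)
    next
      case False
      thus ?thesis using that Suc.prems(3)[of i] z0[of m i] m by (simp add: q1_def)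
    qed
    ultimately obtain e where e: "\<forall>i<m. e i \<in> {0..<c i}" "q1 - (\<Sum>i<m. zsmult (e i) (\<beta> i)) \<in> L'"
      using Suc.IH[of q1] Suc.prems by auto
    define e' where "e' = e(m := z mod c m)"
    have "q - (\<Sum>i<Suc m. zsmult (e' i) (\<beta> i)) = (q1 - (\<Sum>i<m. zsmult (e i) (\<beta> i))) + zsmult (z div c m) (\<beta>' m)"
      by (simp add: e'_def q1_def)
    also have "\<dots> \<in> L'" by (rule full_lattice_closed(3)[OF L'(1) e(2) full_lattice_closed(4)[OF L'(1) b(2)]])
    finally have "q - (\<Sum>i<Suc m. zsmult (e' i) (\<beta> i)) \<in> L'" .
    moreover have "\<forall>i<Suc m. e' i \<in> {0..<c i}" using e cp[OF m] by (auto simp: e'_def less_Suc_eq)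
    ultimately show ?case by blast
  qed
  have surj: "\<exists>e\<in>Pi\<^sub>E {..<n} (\<lambda>i. {0..<c i}). q - (\<Sum>i<n. zsmult (e i) (\<beta> i)) \<in> L'" if q: "q \<in> L" for q
  proof -
    have "coeff q i = 0" if "i \<ge> n" for i using full_lattice_closed(5)[OF L(1) q] that by (intro coeff_eq_0) simp
    from surj0[OF order_refl q this] obtain e where e: "\<forall>i<n. e i \<in> {0..<c i}" "q - (\<Sum>i<n. zsmult (e i) (\<beta> i)) \<in> L'" by blast
    have "(\<Sum>i<n. zsmult (restrict e {..<n} i) (\<beta> i)) = (\<Sum>i<n. zsmult (e i) (\<beta> i))" by (rule sum.cong) auto
    thus ?thesis using e by (intro bexI[of _ "restrict e {..<n}"]) auto
  qed
  show ?thesis using that[of c] cp c inj surj by blast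
qed

lemma det_in_subring:
  assumes S: "subring_of S" and A: "A \<in> carrier_mat n n" and el: "\<And>i j. i < n \<Longrightarrow> j < n \<Longrightarrow> A $$ (i, j) \<in> S"
  shows "det A \<in> S"
proof -
  have "signof p * (\<Prod>i = 0..<n. A $$ (i, p i)) \<in> S" if "p permutes {0..<n}" for p
  proof -
    have "(\<Prod>i = 0..<n. A $$ (i, p i)) \<in> S" using that el permutes_in_image[OF that]
      by (intro subring_of_prod[OF S]) auto
    thus ?thesis by (cases p rule: sign_cases) (auto intro: subring_of_closed(5)[OF S])
  qed
  thus ?thesis unfolding det_def'[OF A] by (intro subring_of_sum[OF S]) auto
qed

lemma det_scale_rows:
  fixes A :: "nat \<Rightarrow> nat \<Rightarrow> 'a::idom"
  shows "det (mat n n (\<lambda>(i, j). d i * A i j)) = (\<Prod>i<n. d i) * det (mat n n (\<lambda>(i, j). A i j))"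
proof -
  have "(\<Prod>i = 0..<n. d i * A i (p i)) = (\<Prod>i<n. d i) * (\<Prod>i = 0..<n. A i (p i))" for p
    by (simp add: prod.distrib atLeast0LessThan)
  moreover have "(\<Prod>i = 0..<n. mat n n (\<lambda>(i, j). B i j) $$ (i, p i)) = (\<Prod>i = 0..<n. B i (p i))" if "p permutes {0..<n}" for B :: "nat \<Rightarrow> nat \<Rightarrow> 'a" and p
    using permutes_in_image[OF that] by (intro prod.cong) auto
  ultimately show ?thesis
    by (subst (1 2) det_def'[of _ n]) (auto simp: sum_distrib_left mult_ac intro!: sum.cong)
qed

lemma common_denominator:
  assumes "finite A" "\<And>a. a \<in> A \<Longrightarrow> algebraic (a :: complex)"
  shows "\<exists>c::nat. c > 0 \<and> (\<forall>a\<in>A. algebraic_int (of_nat c * a))"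
  using assms
proof (induction A rule: finite_induct)
  case empty thus ?case by (intro exI[of _ 1]) auto
next
  case (insert a A)
  then obtain c where c: "c > 0" "\<forall>a\<in>A. algebraic_int (of_nat c * a)" by auto
  obtain d where d: "d > 0" "algebraic_int (of_nat d * a)" using algebraic_imp_scaled_algebraic_int[of a] insert by auto
  have "algebraic_int (of_nat (c * d) * b)" if "b \<in> insert a A" for b
  proof -
    have "of_nat (c * d) * b = of_nat d * (of_nat c * b)" "of_nat (c * d) * b = of_nat c * (of_nat d * b)" by (simp_all add: mult_ac)
    moreover have "algebraic_int (of_nat d * (of_nat c * b)) \<or> algebraic_int (of_nat c * (of_nat d * b))"
      using that c(2) d(2) algebraic_int_times[OF algebraic_int_of_nat] by blast
    ultimately show ?thesis by metis
  qed
  thus ?case using c d by (intro exI[of _ "c * d"]) auto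
qed

text \<open>A triangular change from the power basis contributes its diagonal. The Vandermonde
  factor is common to all lattices, so quotients of these determinants are quotients of diagonals,
  that is, indices.\<close>

lemma det_tri_basis:
  assumes s: "\<And>i. i < n \<Longrightarrow> s i \<in> R" and \<beta>: "\<And>i. i < n \<Longrightarrow> degree (\<beta> i) \<le> i"
  shows "det (mat n n (\<lambda>(i, j). reval (s i) (\<beta> j))) = det (vand s n) * (\<Prod>i<n. of_rat (coeff (\<beta> i) i))"
proof -
  define U where "U = mat n n (\<lambda>(k, j). of_rat (coeff (\<beta> j) k) :: complex)"
  have U: "U \<in> carrier_mat n n" by (simp add: U_def)
  have "mat n n (\<lambda>(i, j). reval (s i) (\<beta> j)) = vand s n * U"
  proof (rule eq_matI)
    fix i j assume "i < dim_row (vand s n * U)" "j < dim_col (vand s n * U)"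
    hence ij: "i < n" "j < n" by (auto simp: U_def vand_def)
    have "degree (\<beta> j) < n" using \<beta>[OF ij(2)] ij by simp
    from reval_altdef[OF this] show "mat n n (\<lambda>(i, j). reval (s i) (\<beta> j)) $$ (i, j) = (vand s n * U) $$ (i, j)"
      using ij by (simp add: vand_def U_def scalar_prod_def atLeast0LessThan mult.commute)
  qed (auto simp: U_def vand_def)
  hence "det (mat n n (\<lambda>(i, j). reval (s i) (\<beta> j))) = det (vand s n) * det U" using det_mult[OF vand_carrier U] by simp
  moreover have "det U = (\<Prod>i<n. of_rat (coeff (\<beta> i) i))"
  proof -
    have "coeff (\<beta> j) i = 0" if "j < i" "i < n" for i j using \<beta>[of j] that by (intro coeff_eq_0) simp
    hence "upper_triangular U" by (auto simp: U_def upper_triangular_def)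
    hence "det U = prod_list (diag_mat U)" using U by (intro det_upper_triangular)
    also have "\<dots> = (\<Prod>i<n. of_rat (coeff (\<beta> i) i))"
      by (simp add: diag_mat_def U_def prod.list_conv_set_nth atLeast0LessThan)
    finally show ?thesis .
  qed
  ultimately show ?thesis by simp
qed

text \<open>Inverting the Vandermonde matrix bounds the denominators of integral elements in the power basis.\<close>
lemma coeff_denominator_bound:
  assumes p: "irreducible p" and a: "a \<in> rroots p"
  shows "\<exists>D::int. D > 0 \<and> (\<forall>q. degree q < degree p \<longrightarrow> algebraic_int (reval a q) \<longrightarrow> (\<forall>k. of_int D * coeff q k \<in> \<int>))"
proof -
  define n where "n = degree p"
  obtain s where s: "bij_betw s {..<n} (rroots p)" using rroots_enum[OF p] unfolding n_def .
  have inj: "inj_on s {..<n}" and sr: "\<And>i. i < n \<Longrightarrow> s i \<in> rroots p" using s by (auto simp: bij_betw_def)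
  define V where "V = vand s n"
  define A where "A = adj_mat V"
  have V: "V \<in> carrier_mat n n" by (simp add: V_def)
  have A: "A \<in> carrier_mat n n" "A * V = det V \<cdot>\<^sub>m 1\<^sub>m n" using adj_mat[OF V] by (auto simp: A_def)
  note S = subring_of_algebraics
  have Vel: "V $$ (i, j) \<in> {x. algebraic x}" if "i < n" "j < n" for i j
    using that sr[OF that(1)] algebraic_rroot[OF p] subring_of_power[OF S, of "s i" j] by (simp add: V_def vand_def)
  have detV: "det V \<noteq> 0" "algebraic (det V)"
    using det_vand_nonzero[OF inj] det_in_subring[OF S V Vel] by (auto simp: V_def)
  have Ael: "A $$ (i, j) \<in> {x. algebraic x}" if "i < n" "j < n" for i j
  proof -
    have md: "mat_delete V j i \<in> carrier_mat (n - 1) (n - 1)" using V by (rule mat_delete_carrier)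
    have "det (mat_delete V j i) \<in> {x. algebraic x}"
    proof (rule det_in_subring[OF S md])
      fix i' j' assume ij': "i' < n - 1" "j' < n - 1"
      have "mat_delete V j i $$ (i', j') = V $$ (insert_index j i', insert_index i j')"
        using mat_delete_index[of V "n - 1" j i i' j'] V that ij' by simp
      moreover have "insert_index j i' < n" "insert_index i j' < n" using ij' that by (auto simp: insert_index_def)
      ultimately show "mat_delete V j i $$ (i', j') \<in> {x. algebraic x}" using Vel by simp
    qed
    moreover have "(-1) ^ (j + i) \<in> {x :: complex. algebraic x}"
      by (intro subring_of_power[OF S] subring_of_closed(5)[OF S] subring_of_closed(2)[OF S])
    ultimately show ?thesis using that V subring_of_closed(4)[OF S]
      unfolding A_def adj_mat_def cofactor_def by auto
  qed
  define W where "W k i = A $$ (k, i) * inverse (det V)" for k i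
  have "algebraic (W k i)" if "k < n" "i < n" for k i
    using Ael[OF that] detV by (auto simp: W_def intro: algebraic_times algebraic_inverse)
  hence "\<exists>c::nat. c > 0 \<and> (\<forall>w\<in>(\<lambda>(k, i). W k i) ` ({..<n} \<times> {..<n}). algebraic_int (of_nat c * w))"
    by (intro common_denominator) auto
  then obtain c :: nat where c: "c > 0" "\<And>k i. k < n \<Longrightarrow> i < n \<Longrightarrow> algebraic_int (of_nat c * W k i)" by auto
  have WV: "(\<Sum>i<n. W k i * s i ^ j) = (if k = j then 1 else 0)" if "k < n" "j < n" for k j
  proof -
    have "(A * V) $$ (k, j) = (\<Sum>i<n. A $$ (k, i) * s i ^ j)"
      using that A(1) V by (simp add: scalar_prod_def V_def vand_def atLeast0LessThan)
    moreover have "(A * V) $$ (k, j) = (if k = j then det V else 0)" unfolding A(2) using that by simp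
    ultimately have "(\<Sum>i<n. A $$ (k, i) * s i ^ j) = (if k = j then det V else 0)" by simp
    moreover have "(\<Sum>i<n. W k i * s i ^ j) = inverse (det V) * (\<Sum>i<n. A $$ (k, i) * s i ^ j)"
      by (simp add: W_def sum_distrib_left mult_ac)
    ultimately show ?thesis using detV by simp
  qed
  have "of_int (int c) * coeff q k \<in> \<int>" if q: "degree q < n" "algebraic_int (reval a q)" for q k
  proof (cases "k < n")
    case False
    thus ?thesis using q by (simp add: coeff_eq_0)
  next
    case k: True
    have "(\<Sum>i<n. W k i * reval (s i) q) = (\<Sum>i<n. \<Sum>j<n. of_rat (coeff q j) * (W k i * s i ^ j))"
      by (simp add: reval_altdef[OF q(1)] sum_distrib_left mult_ac)
    also have "\<dots> = (\<Sum>j<n. of_rat (coeff q j) * (\<Sum>i<n. W k i * s i ^ j))"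
      by (subst sum.swap) (simp add: sum_distrib_left)
    also have "\<dots> = (\<Sum>j<n. if j = k then of_rat (coeff q k) else 0)"
      using k by (intro sum.cong) (auto simp: WV)
    also have "\<dots> = of_rat (coeff q k)" using k by simp
    finally have e: "(\<Sum>i<n. W k i * reval (s i) q) = of_rat (coeff q k)" .
    \<comment> \<open>The scaled coefficient is rational and also a sum of products of algebraic
      integers, hence an integer.\<close>
    have "of_rat (of_int (int c) * coeff q k) = (\<Sum>i<n. (of_nat c * W k i) * reval (s i) q)"
      by (simp add: of_rat_mult e[symmetric] sum_distrib_left mult.assoc)
    moreover have "algebraic_int (\<Sum>i<n. (of_nat c * W k i) * reval (s i) q)"
      using c(2)[OF k] algebraic_int_conjugate[OF p a _ q(2)] sr
      by (intro algebraic_int_sum algebraic_int_times[OF c(2)[OF k]]) auto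
    ultimately have "algebraic_int (of_rat (of_int (int c) * coeff q k) :: complex)" by simp
    hence "(of_rat (of_int (int c) * coeff q k) :: complex) \<in> \<int>" by (rule rational_algebraic_int_is_int) simp
    then obtain z where "(of_rat (of_int (int c) * coeff q k) :: complex) = of_int z" by (auto elim: Ints_cases)
    hence "of_int (int c) * coeff q k = of_int z" by (metis of_rat_eq_iff of_rat_of_int_eq)
    thus ?thesis by simp
  qed
  thus ?thesis using c(1) unfolding n_def by (intro exI[of _ "int c"]) auto
qed


section \<open>The ideal generated by the integral coordinates of a point\<close>

lemma subfield_ints_closed:
  assumes "subfield_C K" "x \<in> ring_of_integers K" "y \<in> ring_of_integers K"
  shows "x + y \<in> ring_of_integers K" "x - y \<in> ring_of_integers K" "x * y \<in> ring_of_integers K"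
  using assms by (auto simp: ring_of_integers_def subfield_C_def algebraic_int_plus algebraic_int_diff algebraic_int_times)

text \<open>The coordinates are given by polynomials in \<open>a\<close>, which makes all conjugates
  of the point available. The ring of integers and the ideal are studied through \<open>LO\<close>
  and \<open>LI\<close>, their preimages among polynomials of degree below \<open>n\<close>.\<close>

locale field_ideal =
  fixes p :: "rat poly" and a :: complex and N :: nat and r :: "nat \<Rightarrow> rat poly"
  assumes p: "irreducible p" and a: "a \<in> rroots p"
    and r_int: "\<And>i. i \<le> N \<Longrightarrow> algebraic_int (reval a (r i))"
    and r_nz: "\<exists>i\<le>N. reval a (r i) \<noteq> 0"
begin

definition X :: "complex \<Rightarrow> nat \<Rightarrow> complex" where "X s i = reval s (r i)"
definition n :: nat where "n = degree p"
definition K :: "complex set" where "K = range (reval a)"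
definition OK :: "complex set" where "OK = ring_of_integers K"
definition I :: "complex set" where "I = {\<Sum>i\<le>N. b i * X a i | b. \<forall>i\<le>N. b i \<in> OK}"
definition LO :: "rat poly set" where "LO = {q. degree q < n \<and> reval a q \<in> OK}"
definition LI :: "rat poly set" where "LI = {q. degree q < n \<and> reval a q \<in> I}"

lemma n_pos: "n > 0"
  using irreducible_rat_poly_degree[OF p] by (simp add: n_def)

lemma degree_mod: "degree (q mod p) < n"
  using degree_mod_less'[of p q] n_pos p by (cases "q mod p = 0") (auto simp: n_def irreducible_def)

lemma K: "subfield_C K"
  unfolding K_def using algebraic_rroot[OF p a] by (rule subfield_C_range_reval)

lemma OK_iff: "reval a q \<in> OK \<longleftrightarrow> algebraic_int (reval a q)"
  by (auto simp: OK_def K_def ring_of_integers_def)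

lemmas OK_closed = subfield_ints_closed[OF K, folded OK_def]

lemma OK_of_int: "of_int z \<in> OK"
  using OK_iff[of "[:of_int z:]"] by simp

lemma X_OK: "i \<le> N \<Longrightarrow> X a i \<in> OK"
  using r_int OK_iff by (simp add: X_def)

lemma X_int: "s \<in> rroots p \<Longrightarrow> i \<le> N \<Longrightarrow> algebraic_int (X s i)"
  unfolding X_def using algebraic_int_conjugate[OF p a] r_int by blast

lemma X_nz: "s \<in> rroots p \<Longrightarrow> X s i \<noteq> 0 \<longleftrightarrow> X a i \<noteq> 0"
  unfolding X_def using reval_eq_0_iff[OF p] a by simp

definition \<Psi> :: "rat poly poly" where "\<Psi> = (\<Sum>i\<le>N. monom (r i) i)"

lemma map_\<Psi>: "map_poly (reval s) \<Psi> = lin_form N (X s)"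
  by (simp add: \<Psi>_def lin_form_def hom_distribs X_def)

lemma lin_form_nz: "s \<in> rroots p \<Longrightarrow> lin_form N (X s) \<noteq> 0"
  using r_nz X_nz unfolding lin_form_eq_0_iff by (auto simp: X_def)

lemma int_family: "int_family (rroots p) N X"
proof -
  have "algebraic_int (reval s (coeff \<Psi> k))" if "s \<in> rroots p" for s k
  proof -
    have "reval s (coeff \<Psi> k) = coeff (lin_form N (X s)) k" by (simp flip: map_\<Psi> add: coeff_map_poly)
    thus ?thesis using X_int[OF that] by (simp add: coeff_lin_form)
  qed
  hence "\<exists>M::int poly. (\<Prod>s\<in>rroots p. map_poly (reval s) \<Psi>) = map_poly of_int M"
    by (intro norm_integral[OF p]) (auto simp: map_\<Psi> lin_form_nz)
  thus ?thesis unfolding int_family_def map_\<Psi>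
    using finite_rroots[OF p] rroots_nonempty[OF p] X_int X_nz r_nz by (auto simp: X_def)
qed

lemma I_OK: "I \<subseteq> OK"
proof
  fix x assume "x \<in> I"
  then obtain b where b: "x = (\<Sum>i\<le>N. b i * X a i)" "\<forall>i\<le>N. b i \<in> OK" by (auto simp: I_def)
  have "(\<Sum>i\<in>J. b i * X a i) \<in> OK" if "finite J" "J \<subseteq> {..N}" for J
    using that by (induction J rule: finite_induct) (use OK_of_int[of 0] b X_OK in \<open>auto intro!: OK_closed\<close>)
  thus "x \<in> OK" unfolding b by simp
qed

lemma I_minus: "x \<in> I \<Longrightarrow> y \<in> I \<Longrightarrow> x - y \<in> I"
proof -
  assume "x \<in> I" "y \<in> I"
  then obtain b c where "x = (\<Sum>i\<le>N. b i * X a i)" "\<forall>i\<le>N. b i \<in> OK" "y = (\<Sum>i\<le>N. c i * X a i)" "\<forall>i\<le>N. c i \<in> OK"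
    by (auto simp: I_def)
  thus ?thesis unfolding I_def
    by (auto simp: algebra_simps sum_subtractf OK_closed intro!: exI[of _ "\<lambda>i. b i - c i"])
qed

lemma I_times: "x \<in> I \<Longrightarrow> y \<in> OK \<Longrightarrow> y * x \<in> I"
proof -
  assume "x \<in> I" "y \<in> OK"
  moreover from this obtain b where "x = (\<Sum>i\<le>N. b i * X a i)" "\<forall>i\<le>N. b i \<in> OK" by (auto simp: I_def)
  ultimately show ?thesis unfolding I_def
    by (auto simp: sum_distrib_left mult.assoc OK_closed intro!: exI[of _ "\<lambda>i. y * b i"])
qed

lemma X_in_I: "i \<le> N \<Longrightarrow> X a i \<in> I"
  unfolding I_def using OK_of_int[of 0] OK_of_int[of 1]
  by (auto intro!: exI[of _ "\<lambda>j. if j = i then 1 else 0"] simp: if_distribR if_distrib cong: if_cong)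

text \<open>Some coordinate has an inverse in the field, and clearing the denominator of the inverse
  puts a positive integer into the ideal. This is what gives \<open>LI\<close> full rank.\<close>

lemma exists_int_in_I: "\<exists>e::int. e > 0 \<and> of_int e \<in> I"
proof -
  obtain i where i: "i \<le> N" "X a i \<noteq> 0" using r_nz by (auto simp: X_def)
  obtain r' where "X a i * reval a r' = 1" using reval_inverse[OF p a, of "r i"] i a by (auto simp: X_def)
  moreover have "algebraic (reval a r')" by (rule algebraic_reval[OF algebraic_rroot[OF p a]])
  then obtain c :: nat where c: "c > 0" "algebraic_int (of_nat c * reval a r')"
    using algebraic_imp_scaled_algebraic_int by blast
  moreover have "of_nat c * reval a r' \<in> OK" using c OK_iff[of "[:of_nat c:] * r'"] by simp
  ultimately have "of_nat c \<in> I" using I_times[OF X_in_I[OF i(1)], of "of_nat c * reval a r'"] by (simp add: mult_ac)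
  thus ?thesis using c(1) by (intro exI[of _ "int c"]) auto
qed

lemma LO_monom: "k < n \<Longrightarrow> \<exists>d::int. d > 0 \<and> monom (of_int d) k \<in> LO"
proof -
  assume k: "k < n"
  have "algebraic (a ^ k)" using subring_of_power[OF subring_of_algebraics] algebraic_rroot[OF p a] by auto
  then obtain c :: nat where c: "c > 0" "algebraic_int (of_nat c * a ^ k)" using algebraic_imp_scaled_algebraic_int by blast
  hence "monom (of_int (int c)) k \<in> LO" using k by (auto simp: LO_def OK_iff reval_monom degree_monom_eq)
  thus ?thesis using c(1) by (intro exI[of _ "int c"]) auto
qed

lemma LI_LO: "LI \<subseteq> LO"
  using I_OK by (auto simp: LI_def LO_def)

lemma full_LO: "full_lattice n LO" and full_LI: "full_lattice n LI"
proof -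
  obtain D where D: "D > 0" "\<And>q k. degree q < n \<Longrightarrow> algebraic_int (reval a q) \<Longrightarrow> of_int D * coeff q k \<in> \<int>"
    using coeff_denominator_bound[OF p a] unfolding n_def by blast
  have d: "degree (q - q') < n" if "degree q < n" "degree q' < n" for q q' :: "rat poly"
    using that by (rule degree_diff_less)
  have 0: "0 \<in> I" using I_minus[OF X_in_I[of 0] X_in_I[of 0]] by simp
  show "full_lattice n LO" unfolding full_lattice_def
    using LO_monom D n_pos OK_of_int[of 0]
    by (auto simp: LO_def OK_iff reval.hom_minus algebraic_int_diff intro!: d exI[of _ D])
  have "\<exists>d::int. d > 0 \<and> monom (of_int d) k \<in> LI" if k: "k < n" for k
  proof -
    obtain d :: int where d: "d > 0" "monom (of_int d) k \<in> LO" using LO_monom[OF k] by blast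
    obtain e :: int where e: "e > 0" "of_int e \<in> I" using exists_int_in_I by blast
    have "reval a (monom (of_int (d * e)) k) = reval a (monom (of_int d) k) * of_int e" by (simp add: reval_monom of_rat_mult)
    also have "\<dots> \<in> I" using e d by (intro I_times) (auto simp: LO_def)
    finally have "monom (of_int (d * e)) k \<in> LI" using le_less_trans[OF degree_monom_le k] by (simp add: LI_def)
    thus ?thesis using d e by (intro exI[of _ "d * e"]) auto
  qed
  thus "full_lattice n LI" unfolding full_lattice_def
    using D n_pos 0 LI_LO by (auto simp: LI_def LO_def OK_iff reval.hom_minus subset_iff intro!: d I_minus exI[of _ D])
qed

definition \<omega> :: "nat \<Rightarrow> rat poly" where "\<omega> = (SOME \<beta>. tri_basis n LO \<beta>)"
definition \<beta> :: "nat \<Rightarrow> rat poly" where "\<beta> = (SOME \<beta>. tri_basis n LI \<beta>)"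

lemma \<omega>: "tri_basis n LO \<omega>" and \<beta>: "tri_basis n LI \<beta>"
  unfolding \<omega>_def \<beta>_def
  using someI_ex[OF tri_basis_exists[OF full_LO]] someI_ex[OF tri_basis_exists[OF full_LI]] .

text \<open>The digit vectors enumerate the cosets counted by \<open>ideal_norm\<close>; reduction
  modulo \<open>p\<close> represents every element of the field in degree below
  \<open>n\<close>.\<close>

lemma ideal_norm_index:
  obtains c :: "nat \<Rightarrow> int" where "\<And>i. i < n \<Longrightarrow> c i > 0" "\<And>i. i < n \<Longrightarrow> coeff (\<beta> i) i = of_int (c i) * coeff (\<omega> i) i"
    "int (ideal_norm K N (X a)) = (\<Prod>i<n. c i)"
proof -
  from tri_basis_index[OF full_LO \<omega> full_LI \<beta> LI_LO] obtain c where
    c: "\<And>i. i < n \<Longrightarrow> c i > 0" "\<And>i. i < n \<Longrightarrow> coeff (\<beta> i) i = of_int (c i) * coeff (\<omega> i) i"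
    and inj: "\<And>e e'. e \<in> Pi\<^sub>E {..<n} (\<lambda>i. {0..<c i}) \<Longrightarrow> e' \<in> Pi\<^sub>E {..<n} (\<lambda>i. {0..<c i}) \<Longrightarrow>
      (\<Sum>i<n. zsmult (e i) (\<omega> i)) - (\<Sum>i<n. zsmult (e' i) (\<omega> i)) \<in> LI \<Longrightarrow> e = e'"
    and surj: "\<And>q. q \<in> LO \<Longrightarrow> \<exists>e\<in>Pi\<^sub>E {..<n} (\<lambda>i. {0..<c i}). q - (\<Sum>i<n. zsmult (e i) (\<omega> i)) \<in> LI"
    by blast
  define T where "T = Pi\<^sub>E {..<n} (\<lambda>i. {0..<c i})"
  define g where "g e = (\<Sum>i<n. zsmult (e i) (\<omega> i))" for e
  define coset where "coset b = {b + c | c. c \<in> I}" for b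
  have gLO: "g e \<in> LO" for e unfolding g_def
    using tri_basisD(1)[OF \<omega>] by (intro full_lattice_sum[OF full_LO] full_lattice_closed[OF full_LO]) auto
  have 0: "0 \<in> I" using I_minus[OF X_in_I[of 0] X_in_I[of 0]] by simp
  have plus: "x + y \<in> I" if "x \<in> I" "y \<in> I" for x y
    using I_minus[OF that(1) I_minus[OF 0 that(2)]] by simp
  have coset_eq: "coset x = coset y \<longleftrightarrow> x - y \<in> I" for x y
  proof
    assume "coset x = coset y"
    hence "x + 0 \<in> coset y" using 0 unfolding coset_def by blast
    thus "x - y \<in> I" by (auto simp: coset_def)
  next
    assume xy: "x - y \<in> I"
    show "coset x = coset y"
    proof (intro equalityI subsetI)
      fix z assume "z \<in> coset x"
      then obtain c where "z = x + c" "c \<in> I" by (auto simp: coset_def)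
      thus "z \<in> coset y" using plus[OF xy] by (auto simp: coset_def intro!: exI[of _ "x - y + c"])
    next
      fix z assume "z \<in> coset y"
      then obtain c where "z = y + c" "c \<in> I" by (auto simp: coset_def)
      thus "z \<in> coset x" using I_minus[OF _ xy] by (auto simp: coset_def intro!: exI[of _ "c - (x - y)"])
    qed
  qed
  have dd: "degree (q - q') < n" if "q \<in> LO" "q' \<in> LO" for q q'
    using that degree_diff_less by (auto simp: LO_def)
  have "bij_betw (\<lambda>e. coset (reval a (g e))) T (coset ` OK)"
  proof (rule bij_betw_imageI)
    show "inj_on (\<lambda>e. coset (reval a (g e))) T"
    proof (rule inj_onI)
      fix e e' assume e: "e \<in> T" "e' \<in> T" "coset (reval a (g e)) = coset (reval a (g e'))"
      hence "reval a (g e - g e') \<in> I" by (simp add: coset_eq reval.hom_minus)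
      hence "g e - g e' \<in> LI" using dd[OF gLO gLO] by (simp add: LI_def)
      thus "e = e'" using inj e by (simp add: T_def g_def)
    qed
    show "(\<lambda>e. coset (reval a (g e))) ` T = coset ` OK"
    proof (intro equalityI subsetI)
      fix z assume "z \<in> (\<lambda>e. coset (reval a (g e))) ` T"
      thus "z \<in> coset ` OK" using gLO by (auto simp: LO_def)
    next
      fix z assume "z \<in> coset ` OK"
      then obtain q0 where q0: "reval a q0 \<in> OK" "z = coset (reval a q0)" by (auto simp: OK_def K_def ring_of_integers_def)
      define q where "q = q0 mod p"
      have q: "q \<in> LO" "z = coset (reval a q)" using q0 degree_mod reval_mod[OF a] by (auto simp: q_def LO_def)
      obtain e where e: "e \<in> T" "q - g e \<in> LI" using surj[OF q(1)] by (auto simp: T_def g_def)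
      hence "coset (reval a q) = coset (reval a (g e))" by (simp add: coset_eq LI_def reval.hom_minus)
      thus "z \<in> (\<lambda>e. coset (reval a (g e))) ` T" using e q by auto
    qed
  qed
  hence "card (coset ` OK) = card T" using bij_betw_same_card by metis
  also have "\<dots> = (\<Prod>i<n. nat (c i))" by (simp add: T_def card_PiE)
  also have "int \<dots> = (\<Prod>i<n. c i)" unfolding of_nat_prod using c(1) by (intro prod.cong) (auto simp: less_imp_le)
  finally have "int (ideal_norm K N (X a)) = (\<Prod>i<n. c i)"
    by (simp add: ideal_norm_def Let_def OK_def[symmetric] coset_def I_def)
  thus ?thesis using that c by blast
qed

text \<open>Turns the index into a quotient of determinants of conjugates, where both bounds for
  \<open>ideal_norm\<close> below can be obtained by multiplying matrices.\<close>

lemma det_ratio: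
  assumes s: "bij_betw s {..<n} (rroots p)"
  shows "det (mat n n (\<lambda>(i, j). reval (s i) (\<beta> j))) =
    of_nat (ideal_norm K N (X a)) * det (mat n n (\<lambda>(i, j). reval (s i) (\<omega> j)))"
    and "det (mat n n (\<lambda>(i, j). reval (s i) (\<omega> j))) \<noteq> 0"
    and "ideal_norm K N (X a) > 0"
proof -
  have sr: "\<And>i. i < n \<Longrightarrow> s i \<in> rroots p" and inj: "inj_on s {..<n}" using s by (auto simp: bij_betw_def)
  obtain c :: "nat \<Rightarrow> int" where c: "\<And>i. i < n \<Longrightarrow> c i > 0" "\<And>i. i < n \<Longrightarrow> coeff (\<beta> i) i = of_int (c i) * coeff (\<omega> i) i"
    and k: "int (ideal_norm K N (X a)) = (\<Prod>i<n. c i)" using ideal_norm_index by blast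
  have kC: "(of_nat (ideal_norm K N (X a)) :: complex) = (\<Prod>i<n. of_int (c i))" using k by (metis of_int_of_nat_eq of_int_prod)
  have d: "det (mat n n (\<lambda>(i, j). reval (s i) (\<beta> j))) = det (vand s n) * (\<Prod>i<n. of_rat (coeff (\<beta> i) i))"
    "det (mat n n (\<lambda>(i, j). reval (s i) (\<omega> j))) = det (vand s n) * (\<Prod>i<n. of_rat (coeff (\<omega> i) i))"
    using tri_basisD(2)[OF \<omega>] tri_basisD(2)[OF \<beta>] by (intro det_tri_basis[OF sr]; simp)+
  have "(\<Prod>i<n. of_rat (coeff (\<beta> i) i) :: complex) = (\<Prod>i<n. of_int (c i) * of_rat (coeff (\<omega> i) i))"
    using c(2) by (intro prod.cong) (auto simp: of_rat_mult)
  thus "det (mat n n (\<lambda>(i, j). reval (s i) (\<beta> j))) =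
    of_nat (ideal_norm K N (X a)) * det (mat n n (\<lambda>(i, j). reval (s i) (\<omega> j)))"
    unfolding d kC by (simp add: prod.distrib)
  have "coeff (\<omega> i) i \<noteq> 0" if "i < n" for i using tri_basisD(3)[OF \<omega> that] by simp
  thus "det (mat n n (\<lambda>(i, j). reval (s i) (\<omega> j))) \<noteq> 0" unfolding d using det_vand_nonzero[OF inj] by simp
  have "(\<Prod>i<n. c i) > 0" using c(1) by (intro prod_pos) auto
  thus "ideal_norm K N (X a) > 0" using k by linarith
qed

lemma det_const_poly:
  fixes A :: "nat \<Rightarrow> nat \<Rightarrow> complex"
  shows "det (mat n n (\<lambda>(i, j). [:A i j:])) = [:det (mat n n (\<lambda>(i, j). A i j)):]"
proof -
  interpret c: comm_ring_hom "\<lambda>a::complex. [:a:]" by unfold_locales (auto simp: one_pCons)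
  have "mat n n (\<lambda>(i, j). [:A i j:]) = map_mat (\<lambda>a. [:a:]) (mat n n (\<lambda>(i, j). A i j))" by (rule eq_matI) auto
  thus ?thesis by (simp add: c.hom_det)
qed

lemma mat_times_mat:
  "mat n n (\<lambda>(i, j). \<Sum>l<n. A i l * B l j) = mat n n (\<lambda>(i, j). A i j) * (mat n n (\<lambda>(i, j). B i j) :: 'b::comm_ring_1 mat)"
  by (rule eq_matI) (auto simp: scalar_prod_def atLeast0LessThan)

text \<open>With \<open>c\<close> the content and \<open>u\<close> the primitive part of the norm form, \<open>u^n [O : I] = c u det H\<close> in \<open>\<int>[T]\<close>.\<close>
lemma content_le_ideal_norm: "family_content (rroots p) N X \<le> int (ideal_norm K N (X a))"
proof -
  obtain s where s: "bij_betw s {..<n} (rroots p)" using rroots_enum[OF p] unfolding n_def .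
  have sr: "\<And>i. i < n \<Longrightarrow> s i \<in> rroots p" using s by (auto simp: bij_betw_def)
  define k where "k = ideal_norm K N (X a)"
  define c where "c = family_content (rroots p) N X"
  have c: "c > 0" unfolding c_def by (rule family_content_pos[OF int_family])
  obtain M :: "int poly" where M: "(\<Prod>s\<in>rroots p. lin_form N (X s)) = map_poly of_int M"
    using int_family by (auto simp: int_family_def)
  have cM: "c = content M" by (simp add: c_def family_content_def M)
  define u where "u = primitive_part M"
  have Mu: "M = Polynomial.smult c u" by (simp add: cM u_def)
  have M0: "M \<noteq> 0" using c cM by auto
  have u1: "content u = 1" unfolding u_def using M0 by (rule content_primitive_part)
  have u0: "u \<noteq> 0" using M0 Mu by auto
  obtain \<Gamma> where \<Gamma>: "\<And>s. s \<in> rroots p \<Longrightarrow> (\<Prod>t\<in>rroots p - {s}. lin_form N (X t)) = map_poly (reval s) \<Gamma>"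
    using norm_rational[OF p, of \<Psi>] lin_form_nz unfolding map_\<Psi> by blast
  have split: "lin_form N (X s) * map_poly (reval s) \<Gamma> = map_poly of_int M" if "s \<in> rroots p" for s
    using prod.remove[OF finite_rroots[OF p] that, of "\<lambda>s. lin_form N (X s)"] \<Gamma>[OF that] M by simp
  \<comment> \<open>Multiplication by \<open>\<Gamma>\<close> divided by \<open>c\<close>, for each
    coefficient of \<open>\<Gamma>\<close> separately and reduced modulo \<open>p\<close>. It maps
    \<open>LI\<close> into \<open>LO\<close>, and \<open>H\<close> below is its integral matrix with
    respect to the two triangular bases.\<close>
  define \<eta> where "\<eta> q t = (Polynomial.smult (inverse (of_int c)) (q * coeff \<Gamma> t)) mod p" for q t
  have \<eta>_eval: "reval s (\<eta> q t) = inverse (of_int c) * (reval s q * reval s (coeff \<Gamma> t))" if "s \<in> rroots p" for s q t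
    using reval_mod[OF that] by (simp add: \<eta>_def reval.hom_mult of_rat_inverse)
  \<comment> \<open>By Kronecker's lemma for the linear form and its complementary product,
    \<open>c\<close> divides each coordinate times each coefficient of \<open>\<Gamma>\<close>,
    hence every element of the ideal times such a coefficient.\<close>
  have \<eta>: "\<eta> q t \<in> LO" if q: "q \<in> LI" for q t
  proof -
    obtain b where b: "reval a q = (\<Sum>i\<le>N. b i * X a i)" "\<forall>i\<le>N. b i \<in> OK" using q by (auto simp: LI_def I_def)
    have "[:inverse (of_int c):] * (lin_form N (X a) * map_poly (reval a) \<Gamma>) = map_poly of_int u"
      unfolding split[OF a] Mu using c by (simp add: hom_distribs)
    hence "[:inverse (of_int c):] * (lin_form N (X a) * map_poly (reval a) \<Gamma>) \<in> int_polys"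
      by (simp only:) (simp add: int_polys_iff coeff_map_poly)
    from kronecker_content[OF this, of _ t]
    have kc: "algebraic_int (inverse (of_int c) * (X a i * reval a (coeff \<Gamma> t)))" if "i \<le> N" for i
      using that by (auto simp: coeff_lin_form coeff_map_poly dest!: spec[of _ i] split: if_splits) (metis)
    have "reval a (\<eta> q t) = (\<Sum>i\<le>N. b i * (inverse (of_int c) * (X a i * reval a (coeff \<Gamma> t))))"
      by (simp add: \<eta>_eval[OF a] b sum_distrib_left sum_distrib_right mult_ac)
    also have "algebraic_int \<dots>"
    proof (rule algebraic_int_sum)
      fix i assume "i \<in> {..N}"
      thus "algebraic_int (b i * (inverse (of_int c) * (X a i * reval a (coeff \<Gamma> t))))"
        using kc b(2) by (intro algebraic_int_times[OF _ kc]) (auto simp: OK_def ring_of_integers_def)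
    qed
    finally show ?thesis using degree_mod by (simp add: LO_def OK_iff \<eta>_def)
  qed
  have "\<forall>j\<in>{..<n}. \<forall>t. \<exists>z::nat \<Rightarrow> int. \<eta> (\<beta> j) t = (\<Sum>l<n. zsmult (z l) (\<omega> l))"
    using tri_basis_span[OF full_LO \<omega> \<eta>] tri_basisD(1)[OF \<beta>] by auto
  then obtain Z :: "nat \<Rightarrow> nat \<Rightarrow> nat \<Rightarrow> int" where Z: "\<And>j t. j < n \<Longrightarrow> \<eta> (\<beta> j) t = (\<Sum>l<n. zsmult (Z j t l) (\<omega> l))"
    by (metis lessThan_iff)
  define H where "H l j = (\<Sum>t\<le>degree \<Gamma>. monom (Z j t l) t)" for l j
  have cH: "coeff (H l j) t = (if t \<le> degree \<Gamma> then Z j t l else 0)" for l j t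
  proof -
    have "coeff (H l j) t = (\<Sum>t'\<le>degree \<Gamma>. if t' = t then Z j t l else 0)"
      unfolding H_def coeff_sum by (rule sum.cong) auto
    thus ?thesis by simp
  qed
  have key: "map_poly (reval (s i)) \<Gamma> * [:reval (s i) (\<beta> j):] =
      (\<Sum>l<n. [:of_int c * reval (s i) (\<omega> l):] * map_poly of_int (H l j))" if ij: "i < n" "j < n" for i j
  proof (rule poly_eqI)
    fix t
    show "coeff (map_poly (reval (s i)) \<Gamma> * [:reval (s i) (\<beta> j):]) t =
        coeff (\<Sum>l<n. [:of_int c * reval (s i) (\<omega> l):] * map_poly of_int (H l j)) t"
    proof (cases "t \<le> degree \<Gamma>")
      case True
      have "reval (s i) (coeff \<Gamma> t) * reval (s i) (\<beta> j) = of_int c * reval (s i) (\<eta> (\<beta> j) t)"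
        using c by (simp add: \<eta>_eval[OF sr[OF ij(1)]] mult_ac)
      also have "\<dots> = (\<Sum>l<n. of_int c * reval (s i) (\<omega> l) * of_int (Z j t l))"
        by (simp add: Z[OF ij(2)] reval.hom_sum sum_distrib_left mult_ac)
      finally show ?thesis using True by (simp add: coeff_map_poly coeff_sum cH mult_ac)
    next
      case False
      thus ?thesis by (simp add: coeff_map_poly coeff_sum cH coeff_eq_0)
    qed
  qed
  define HM where "HM = mat n n (\<lambda>(l, j). H l j)"
  define dA where "dA = det (mat n n (\<lambda>(i, j). reval (s i) (\<omega> j)))"
  have dA: "dA \<noteq> 0" "det (mat n n (\<lambda>(i, j). reval (s i) (\<beta> j))) = of_nat k * dA" "k > 0"
    using det_ratio[OF s] by (simp_all add: dA_def k_def)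
  have "mat n n (\<lambda>(i, j). map_poly (reval (s i)) \<Gamma> * [:reval (s i) (\<beta> j):]) =
    mat n n (\<lambda>(i, j). \<Sum>l<n. [:of_int c * reval (s i) (\<omega> l):] * map_poly of_int (H l j))"
    by (rule eq_matI) (simp_all only: dim_row_mat dim_col_mat index_mat prod.case key)
  hence "det (mat n n (\<lambda>(i, j). map_poly (reval (s i)) \<Gamma> * [:reval (s i) (\<beta> j):])) =
    det (mat n n (\<lambda>(i, j). [:of_int c * reval (s i) (\<omega> j):]) * mat n n (\<lambda>(l, j). map_poly of_int (H l j)))"
    unfolding mat_times_mat by simp
  also have "\<dots> = det (mat n n (\<lambda>(i, j). [:of_int c * reval (s i) (\<omega> j):])) * det (mat n n (\<lambda>(l, j). map_poly of_int (H l j)))"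
    by (rule det_mult) auto
  also have "det (mat n n (\<lambda>(i, j). [:of_int c * reval (s i) (\<omega> j):])) = [:of_int c ^ n * dA:]"
    unfolding det_const_poly det_scale_rows dA_def by simp
  also have "mat n n (\<lambda>(l, j). map_poly of_int (H l j)) = map_mat (map_poly of_int) HM"
    by (rule eq_matI) (auto simp: HM_def)
  also have "det (map_mat (map_poly of_int) HM) = (map_poly of_int (det HM) :: complex poly)"
    by (rule comm_ring_hom.hom_det[OF of_int_poly_hom.comm_ring_hom_axioms])
  also have "det (mat n n (\<lambda>(i, j). map_poly (reval (s i)) \<Gamma> * [:reval (s i) (\<beta> j):])) =
      (\<Prod>i<n. map_poly (reval (s i)) \<Gamma>) * [:of_nat k * dA:]"
    unfolding det_scale_rows det_const_poly dA(2) ..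
  finally have E1: "(\<Prod>i<n. map_poly (reval (s i)) \<Gamma>) * [:of_nat k * dA:] = [:of_int c ^ n * dA:] * map_poly of_int (det HM)" .
  have "(\<Prod>i<n. lin_form N (X (s i))) = map_poly of_int M"
    using prod.reindex_bij_betw[OF s, of "\<lambda>s. lin_form N (X s)"] M by simp
  \<comment> \<open>A linear form times its complementary product is the whole norm form; this
    eliminates \<open>\<Gamma>\<close> from the identity between the determinants.\<close>
  moreover have "(\<Prod>i<n. lin_form N (X (s i))) * (\<Prod>i<n. map_poly (reval (s i)) \<Gamma>) = map_poly of_int M ^ n"
  proof -
    have "(\<Prod>i<n. lin_form N (X (s i)) * map_poly (reval (s i)) \<Gamma>) = (\<Prod>i<n. map_poly of_int M)"
      by (intro prod.cong split sr) auto
    thus ?thesis by (simp add: prod.distrib)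
  qed
  ultimately have "map_poly of_int M ^ n * [:of_nat k * dA:] = map_poly of_int M * ([:of_int c ^ n * dA:] * map_poly of_int (det HM))"
    using E1 by (simp only: mult.assoc flip: \<open>(\<Prod>i<n. lin_form N (X (s i))) * (\<Prod>i<n. map_poly (reval (s i)) \<Gamma>) = map_poly of_int M ^ n\<close>)
  hence "[:of_int c ^ n * dA:] * map_poly of_int (Polynomial.smult (int k) (u ^ n)) =
      [:of_int c ^ n * dA:] * map_poly of_int (Polynomial.smult c (u * det HM))"
    by (simp add: Mu hom_distribs smult_power mult_ac)
  moreover have "[:of_int c ^ n * dA:] \<noteq> 0" using c dA by simp
  ultimately have "(map_poly of_int (Polynomial.smult (int k) (u ^ n)) :: complex poly) = map_poly of_int (Polynomial.smult c (u * det HM))"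
    by (metis mult_left_cancel)
  hence "Polynomial.smult (int k) (u ^ n) = Polynomial.smult c (u * det HM)"
    by (simp only: of_int_poly_hom.eq_iff)
  \<comment> \<open>As \<open>u\<close> and its powers have content 1, comparing contents leaves the
    index as \<open>c\<close> times an integer.\<close>
  hence "content (Polynomial.smult (int k) (u ^ n)) = content (Polynomial.smult c (u * det HM))" by simp
  moreover have "content (u ^ m) = 1" for m by (induction m) (auto simp: content_mult u1)
  ultimately have "int k = c * content (det HM)" using c by (simp add: content_mult u1 content_smult)
  hence "c dvd int k" by simp
  thus ?thesis using dA(3) unfolding c_def[symmetric] k_def[symmetric] by (intro zdvd_imp_le) auto
qed

text \<open>A nonzero coordinate generates a principal ideal inside \<open>I\<close>, so the index
  divides the norm of that coordinate; here the matrix of multiplication by it, from the integers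
  into the ideal, has an integral determinant. The bound yields nonnegativity of the Weil
  height.\<close>

lemma ideal_norm_le_prod: "real (ideal_norm K N (X a)) \<le> (\<Prod>s\<in>rroots p. max_abs N (X s))"
proof -
  obtain s where s: "bij_betw s {..<n} (rroots p)" using rroots_enum[OF p] unfolding n_def .
  have sr: "\<And>i. i < n \<Longrightarrow> s i \<in> rroots p" using s by (auto simp: bij_betw_def)
  define k where "k = ideal_norm K N (X a)"
  obtain i0 where i0: "i0 \<le> N" "X a i0 \<noteq> 0" using r_nz by (auto simp: X_def)
  have "(r i0 * \<omega> l) mod p \<in> LI" if "l < n" for l
  proof -
    have "reval a ((r i0 * \<omega> l) mod p) = reval a (\<omega> l) * X a i0" by (simp add: reval_mod[OF a] reval.hom_mult X_def mult.commute)
    also have "\<dots> \<in> I" using tri_basisD(1)[OF \<omega> that] by (intro I_times X_in_I i0) (auto simp: LO_def)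
    finally show ?thesis using degree_mod by (simp add: LI_def)
  qed
  hence "\<forall>l\<in>{..<n}. \<exists>z::nat \<Rightarrow> int. (r i0 * \<omega> l) mod p = (\<Sum>j<n. zsmult (z j) (\<beta> j))"
    using tri_basis_span[OF full_LI \<beta>] by auto
  then obtain Z :: "nat \<Rightarrow> nat \<Rightarrow> int" where Z: "\<And>l. l < n \<Longrightarrow> (r i0 * \<omega> l) mod p = (\<Sum>j<n. zsmult (Z l j) (\<beta> j))"
    by (metis lessThan_iff)
  have key: "X (s i) i0 * reval (s i) (\<omega> l) = (\<Sum>j<n. reval (s i) (\<beta> j) * of_int (Z l j))" if "i < n" "l < n" for i l
  proof -
    have "X (s i) i0 * reval (s i) (\<omega> l) = reval (s i) ((r i0 * \<omega> l) mod p)"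
      using sr[OF that(1)] by (simp add: reval_mod reval.hom_mult X_def)
    thus ?thesis by (simp add: Z[OF that(2)] reval.hom_sum mult.commute)
  qed
  define HM where "HM = mat n n (\<lambda>(j, l). Z l j)"
  define dA where "dA = det (mat n n (\<lambda>(i, j). reval (s i) (\<omega> j)))"
  have dA: "dA \<noteq> 0" "det (mat n n (\<lambda>(i, j). reval (s i) (\<beta> j))) = of_nat k * dA"
    using det_ratio[OF s] by (simp_all add: dA_def k_def)
  have "mat n n (\<lambda>(i, l). X (s i) i0 * reval (s i) (\<omega> l)) = mat n n (\<lambda>(i, l). \<Sum>j<n. reval (s i) (\<beta> j) * of_int (Z l j))"
    by (rule eq_matI) (simp_all only: dim_row_mat dim_col_mat index_mat prod.case key)
  hence "det (mat n n (\<lambda>(i, l). X (s i) i0 * reval (s i) (\<omega> l))) =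
      det (mat n n (\<lambda>(i, j). reval (s i) (\<beta> j)) * mat n n (\<lambda>(j, l). of_int (Z l j)))"
    unfolding mat_times_mat by simp
  also have "\<dots> = det (mat n n (\<lambda>(i, j). reval (s i) (\<beta> j))) * det (mat n n (\<lambda>(j, l). of_int (Z l j)))"
    by (rule det_mult) auto
  also have "mat n n (\<lambda>(j, l). of_int (Z l j)) = map_mat of_int HM" by (rule eq_matI) (auto simp: HM_def)
  also have "det (map_mat of_int HM) = (of_int (det HM) :: complex)" by (rule of_int_hom.hom_det)
  finally have "(\<Prod>i<n. X (s i) i0) * dA = of_nat k * dA * of_int (det HM)"
    unfolding det_scale_rows dA(2) dA_def[symmetric] .
  hence e: "(\<Prod>i<n. X (s i) i0) = of_int (int k * det HM)" using dA(1) by simp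
  have nz: "(\<Prod>i<n. X (s i) i0) \<noteq> 0" using X_nz[OF sr] i0 by auto
  hence "det HM \<noteq> 0" using e by auto
  hence "int k \<le> \<bar>int k * det HM\<bar>" by (simp add: abs_mult mult_le_cancel_left1) linarith
  hence "real k \<le> cmod (\<Prod>i<n. X (s i) i0)" unfolding e norm_of_int by linarith
  also have "\<dots> = (\<Prod>i<n. cmod (X (s i) i0))" by (simp add: prod_norm)
  also have "\<dots> \<le> (\<Prod>i<n. max_abs N (X (s i)))" by (intro prod_mono) (auto intro: max_abs_ge i0)
  also have "\<dots> = (\<Prod>s\<in>rroots p. max_abs N (X s))" using prod.reindex_bij_betw[OF s, of "\<lambda>s. max_abs N (X s)"] by simp
  finally show ?thesis by (simp add: k_def)
qed

end

section \<open>Weil heights along compositions\<close>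

lemma embedding_reval:
  assumes K: "K = range (reval a)" "subfield_C K" and \<sigma>: "\<sigma> \<in> embeddings K"
  shows "\<sigma> (reval a q) = reval (\<sigma> a) q"
proof -
  note R = subring_of_closed[OF subfield_C_subring[OF K(2)]]
  have add: "\<sigma> (x + y) = \<sigma> x + \<sigma> y" and mult: "\<sigma> (x * y) = \<sigma> x * \<sigma> y" if "x \<in> K" "y \<in> K" for x y
    using \<sigma> that by (auto simp: embeddings_def)
  have one: "\<sigma> 1 = 1" using \<sigma> by (auto simp: embeddings_def)
  have zero: "\<sigma> 0 = 0" using add[OF R(1) R(1)] by simp
  have rat: "of_rat b \<in> K" for b by (rule of_rat_in_subfield[OF K(2)])
  have natK: "of_nat k \<in> K" for k using rat[of "of_nat k"] by (simp only: of_rat_of_nat_eq)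
  have nat: "\<sigma> (of_nat k) = of_nat k" for k
  proof (induction k)
    case (Suc k)
    show ?case using add[OF R(2) natK[of k]] Suc one by simp
  qed (simp add: zero)
  have neg: "\<sigma> (- x) = - \<sigma> x" if "x \<in> K" for x
    using add[OF that R(5)[OF that]] zero by (simp add: add_eq_0_iff)
  have int: "\<sigma> (of_int z) = of_int z" for z
  proof (cases z rule: int_cases)
    case (neg k)
    from \<open>\<And>x. x \<in> K \<Longrightarrow> \<sigma> (- x) = - \<sigma> x\<close>[OF natK[of "Suc k"]] nat[of "Suc k"] show ?thesis using neg by simp
  qed (simp add: nat)
  have ratf: "\<sigma> (of_rat b) = of_rat b" for b
  proof -
    obtain x y where b: "b = Rat.Fract x y" "y > 0" by (cases b) auto
    have e: "of_rat b * of_int y = (of_int x :: complex)"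
      using b by (simp add: Fract_of_int_quotient of_rat_divide)
    have "of_int y \<in> K" using rat[of "of_int y"] by simp
    hence "\<sigma> (of_rat b) * of_int y = of_int x" using mult[OF rat, of "of_int y" b] int e by simp
    thus ?thesis using e b by (metis mult_right_cancel of_int_eq_0_iff less_irrefl)
  qed
  have aK: "a \<in> K" using K(1) reval_monom[of a 1 1] by (metis mult_1 of_rat_1 power_one_right rangeI)
  show ?thesis
  proof (induction q)
    case (pCons b q)
    have "reval a q \<in> K" using K(1) by simp
    thus ?case using add[OF rat[of b], of "a * reval a q"] mult[OF aK, of "reval a q"] R(4)[OF aK] pCons.IH ratf by simp
  qed (simp add: zero)
qed

text \<open>Rewrites the sum over embeddings in \<open>height_int\<close> as a sum over conjugates.
  Injectivity relies on the convention that embeddings vanish outside \<open>K\<close>.\<close>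

lemma embeddings_bij:
  assumes p: "irreducible p" "a \<in> rroots p" and K: "K = range (reval a)"
  shows "bij_betw (\<lambda>\<sigma>. \<sigma> a) (embeddings K) (rroots p)"
proof -
  have sf: "subfield_C K" unfolding K using algebraic_rroot[OF p] by (rule subfield_C_range_reval)
  have aK: "a \<in> K" using K reval_monom[of a 1 1] by (metis mult_1 of_rat_1 power_one_right rangeI)
  show ?thesis
  proof (rule bij_betw_imageI)
    show "inj_on (\<lambda>\<sigma>. \<sigma> a) (embeddings K)"
    proof (rule inj_onI, rule ext)
      fix \<sigma> \<tau> x assume st: "\<sigma> \<in> embeddings K" "\<tau> \<in> embeddings K" "\<sigma> a = \<tau> a"
      show "\<sigma> x = \<tau> x"
      proof (cases "x \<in> K")
        case True
        then obtain q where "x = reval a q" by (auto simp: K)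
        thus ?thesis using embedding_reval[OF K sf] st by metis
      qed (use st in \<open>auto simp: embeddings_def\<close>)
    qed
    show "(\<lambda>\<sigma>. \<sigma> a) ` embeddings K = rroots p"
    proof (intro equalityI subsetI)
      fix s assume "s \<in> (\<lambda>\<sigma>. \<sigma> a) ` embeddings K"
      then obtain \<sigma> where s: "\<sigma> \<in> embeddings K" "s = \<sigma> a" by auto
      have "reval s p = \<sigma> (reval a p)" using embedding_reval[OF K sf s(1)] s(2) by simp
      moreover have "\<sigma> 0 = 0" using embedding_reval[OF K sf s(1), of 0] by simp
      ultimately show "s \<in> rroots p" using p(2) by (simp add: rroots_def)
    next
      fix s assume s: "s \<in> rroots p"
      define \<sigma> where "\<sigma> x = (if x \<in> K then reval s (SOME q. reval a q = x) else 0)" for x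
      have \<sigma>: "\<sigma> (reval a q) = reval s q" for q
      proof -
        have "reval a (SOME q'. reval a q' = reval a q) = reval a q" by (rule someI[of _ q]) simp
        thus ?thesis using reval_eq_iff[OF p(1) p(2) s] by (simp add: \<sigma>_def K)
      qed
      have "\<sigma> \<in> embeddings K" unfolding embeddings_def
      proof (intro CollectI conjI ballI allI impI)
        fix x y assume "x \<in> K" "y \<in> K"
        then obtain u v where "x = reval a u" "y = reval a v" by (auto simp: K)
        thus "\<sigma> (x + y) = \<sigma> x + \<sigma> y" "\<sigma> (x * y) = \<sigma> x * \<sigma> y"
          using \<sigma>[of u] \<sigma>[of v] \<sigma>[of "u + v"] \<sigma>[of "u * v"] by (simp_all add: reval.hom_add reval.hom_mult)
      next
        show "\<sigma> 1 = 1" using \<sigma>[of 1] by simp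
      qed (simp add: \<sigma>_def)
      moreover have "\<sigma> a = s" using \<sigma>[of "monom 1 1"] by (simp add: reval_monom)
      ultimately show "s \<in> (\<lambda>\<sigma>. \<sigma> a) ` embeddings K" by force
    qed
  qed
qed

lemma ideal_norm_cong: "(\<And>i. i \<le> N \<Longrightarrow> x i = y i) \<Longrightarrow> ideal_norm K N x = ideal_norm K N y"
proof -
  assume xy: "\<And>i. i \<le> N \<Longrightarrow> x i = y i"
  have "(\<Sum>i\<le>N. a i * x i) = (\<Sum>i\<le>N. a i * y i)" for a using xy by (intro sum.cong) auto
  thus ?thesis by (simp only: ideal_norm_def)
qed

text \<open>Within the field generated by the coordinates, the lower bound comes from
  \<open>ideal_norm_le_prod\<close> and the upper one from
  \<open>content_le_ideal_norm\<close>.\<close>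

lemma height_int_bounds:
  assumes x: "\<And>i. i \<le> N \<Longrightarrow> algebraic_int (x i)" "\<exists>i\<le>N. x i \<noteq> 0"
  obtains p a r where "irreducible p" "a \<in> rroots p" "\<And>i. i \<le> N \<Longrightarrow> x i = reval a (r i)"
    "0 \<le> height_int N x" "height_int N x \<le> family_height (rroots p) N (\<lambda>s i. reval s (r i))"
proof -
  have "algebraic y" if "y \<in> x ` {0..N}" for y using that x(1) by (auto simp: algebraic_int_imp_algebraic)
  then obtain a where ha: "algebraic a" "range (reval a) = gen_field (x ` {0..N})"
    using primitive_element[of "x ` {0..N}"] by blast
  obtain p where hp: "irreducible p" "a \<in> rroots p" using algebraic_min_rat_poly[OF ha(1)] by blast
  have "\<forall>i\<in>{0..N}. \<exists>r. x i = reval a r"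
  proof
    fix i assume "i \<in> {0..N}"
    hence "x i \<in> range (reval a)" using ha(2) gen_field_subset[of "x ` {0..N}"] by blast
    thus "\<exists>r. x i = reval a r" by blast
  qed
  then obtain r where hr: "\<And>i. i \<le> N \<Longrightarrow> x i = reval a (r i)" by (metis atLeastAtMost_iff le0)
  interpret field_ideal p a N r
    by unfold_locales (use hp x hr in auto)
  have Xx: "X a i = x i" if "i \<le> N" for i using hr[OF that] by (simp add: X_def)
  have Keq: "gen_field (x ` {0..N}) = K" using ha(2) by (simp add: K_def)
  have bij: "bij_betw (\<lambda>\<sigma>. \<sigma> a) (embeddings K) (rroots p)" by (rule embeddings_bij[OF hp K_def])
  have \<sigma>: "max_abs N (\<lambda>i. \<sigma> (x i)) = max_abs N (X (\<sigma> a))" if "\<sigma> \<in> embeddings K" for \<sigma>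
    using embedding_reval[OF K_def K that] hr by (intro max_abs_cong) (simp add: X_def)
  have "(\<Sum>\<sigma>\<in>embeddings K. ln (Max ((\<lambda>i. cmod (\<sigma> (x i))) ` {0..N}))) = (\<Sum>\<sigma>\<in>embeddings K. ln (max_abs N (X (\<sigma> a))))"
    using \<sigma> by (intro sum.cong) (auto simp: max_abs_def)
  also have "\<dots> = (\<Sum>s\<in>rroots p. ln (max_abs N (X s)))" by (rule sum.reindex_bij_betw[OF bij])
  finally have h: "height_int N x = ((\<Sum>s\<in>rroots p. ln (max_abs N (X s))) - ln (real (ideal_norm K N (X a)))) / real (card (rroots p))"
    using ideal_norm_cong[of N "X a" x K] Xx bij_betw_same_card[OF bij] by (simp add: height_int_def Let_def Keq)
  obtain s where "bij_betw s {..<n} (rroots p)" using rroots_enum[OF hp(1)] unfolding n_def .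
  hence ip: "ideal_norm K N (X a) > 0" by (rule det_ratio(3))
  have mp: "max_abs N (X s) > 0" if "s \<in> rroots p" for s
    using int_family that max_abs_pos[of _ N "X s"] unfolding int_family_def by blast
  have "ln (real (ideal_norm K N (X a))) \<le> ln (\<Prod>s\<in>rroots p. max_abs N (X s))"
    using ideal_norm_le_prod ip mp by (subst ln_le_cancel_iff) (auto intro: prod_pos)
  also have "\<dots> = (\<Sum>s\<in>rroots p. ln (max_abs N (X s)))" using mp finite_rroots[OF hp(1)] by (intro ln_prod) (auto dest!: mp)
  finally have "0 \<le> height_int N x" unfolding h by simp
  moreover have "ln (real_of_int (family_content (rroots p) N X)) \<le> ln (real (ideal_norm K N (X a)))"
    using content_le_ideal_norm family_content_pos[OF int_family] ip by (subst ln_le_cancel_iff) auto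
  hence "height_int N x \<le> family_height (rroots p) N X" unfolding h family_height_def
    by (intro divide_right_mono) auto
  moreover have "X = (\<lambda>s i. reval s (r i))" by (simp add: X_def fun_eq_iff)
  ultimately show ?thesis using hp hr by (intro that[of p a r]) auto
qed

lemma int_family_reval:
  assumes "irreducible p" "a \<in> rroots p" "\<And>i. i \<le> N \<Longrightarrow> algebraic_int (reval a (r i))" "\<exists>i\<le>N. reval a (r i) \<noteq> 0"
  shows "int_family (rroots p) N (\<lambda>s i. reval s (r i))"
proof -
  interpret field_ideal p a N r by unfold_locales (use assms in auto)
  have "X = (\<lambda>s i. reval s (r i))" by (simp add: X_def fun_eq_iff)
  thus ?thesis using int_family by simp
qed

lemma prod_reval_int:
  assumes p: "irreducible p" "a \<in> rroots p" and q: "algebraic_int (reval a q)" "reval a q \<noteq> 0"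
  shows "\<exists>z::int. (\<Prod>s\<in>rroots p. reval s q) = of_int z"
proof -
  have c: "map_poly (reval s) [:q:] = [:reval s q:]" for s by (simp add: hom_distribs)
  have "\<exists>M::int poly. (\<Prod>s\<in>rroots p. map_poly (reval s) [:q:]) = map_poly of_int M"
  proof (rule norm_integral[OF p(1)])
    fix s k assume s: "s \<in> rroots p"
    show "map_poly (reval s) [:q:] \<noteq> 0" using reval_eq_0_iff[OF p(1)] s p(2) q(2) by (simp add: c)
    show "algebraic_int (reval s (coeff [:q:] k))"
      using algebraic_int_conjugate[OF p s q(1)] by (cases k) auto
  qed
  then obtain M :: "int poly" where "(\<Prod>s\<in>rroots p. [:reval s q:]) = map_poly of_int M" unfolding c by blast
  moreover have "(\<Prod>s\<in>rroots p. [:reval s q:]) = [:\<Prod>s\<in>rroots p. reval s q:]"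
    using finite_rroots[OF p(1)] by (induction rule: finite_induct) (auto simp: one_pCons mult.commute)
  ultimately have "[:\<Prod>s\<in>rroots p. reval s q:] = map_poly of_int M" by simp
  hence "coeff [:\<Prod>s\<in>rroots p. reval s q:] 0 = of_int (coeff M 0)" by (simp add: coeff_map_poly)
  thus ?thesis by auto
qed

text \<open>Compare both families over a number field containing \<open>a\<close>, \<open>b\<close> and the scalar \<open>l\<close>.\<close>
lemma family_height_proportional:
  assumes p: "irreducible p" "a \<in> rroots p" and q: "irreducible q" "b \<in> rroots q"
    and r: "\<And>i. i \<le> N \<Longrightarrow> algebraic_int (reval a (r i))" and r': "\<And>i. i \<le> N \<Longrightarrow> algebraic_int (reval b (r' i))"
    and nz: "\<exists>i\<le>N. reval b (r' i) \<noteq> 0" and l: "l \<noteq> 0" "algebraic l"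
    and eq: "\<And>i. i \<le> N \<Longrightarrow> reval a (r i) = l * reval b (r' i)"
  shows "family_height (rroots p) N (\<lambda>s i. reval s (r i)) = family_height (rroots q) N (\<lambda>s i. reval s (r' i))"
proof -
  have nz': "\<exists>i\<le>N. reval a (r i) \<noteq> 0" using nz eq l by fastforce
  obtain \<theta> where \<theta>: "algebraic \<theta>" "range (reval \<theta>) = gen_field {a, b, l}"
    using primitive_element[of "{a, b, l}"] algebraic_rroot[OF p] algebraic_rroot[OF q] l(2) by auto
  obtain P where P: "irreducible P" "\<theta> \<in> rroots P" using algebraic_min_rat_poly[OF \<theta>(1)] by blast
  have "{a, b, l} \<subseteq> range (reval \<theta>)" using \<theta>(2) gen_field_subset by metis
  then obtain k k' m where k: "a = reval \<theta> k" "b = reval \<theta> k'" "l = reval \<theta> m" by auto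
  \<comment> \<open>A conjugate of \<open>\<theta>\<close> determines one of \<open>a\<close> or
    \<open>b\<close>, and all fibres of this map have the same size, so the height may be computed
    in the larger field.\<close>
  have lift: "family_height (rroots P) N (\<lambda>s i. reval s (pcompose (r i) k)) = family_height (rroots p) N (\<lambda>s i. reval s (r i))"
    if p: "irreducible p" "reval \<theta> k \<in> rroots p" and fam: "int_family (rroots p) N (\<lambda>s i. reval s (r i))" for p r k
  proof -
    obtain m' where m': "m' > 0" "\<And>t. t \<in> rroots p \<Longrightarrow> card {s\<in>rroots P. reval s k = t} = m'"
      using card_conjugate_fibres(2)[OF P(1) p(1) P(2) p(2)] by blast
    show ?thesis
      by (rule family_height_fibres[OF fam finite_rroots[OF P(1)] card_conjugate_fibres(1)[OF P(1) p(1) P(2) p(2)] m'])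
         (auto simp: reval_pcompose)
  qed
  define X where "X s i = reval s (pcompose (r i) k)" for s i
  define Y where "Y s i = reval s (pcompose (r' i) k')" for s i
  have famX: "int_family (rroots P) N X" unfolding X_def[abs_def]
    using P r nz' by (intro int_family_reval[of P \<theta>]) (auto simp: reval_pcompose k(1)[symmetric])
  have famY: "int_family (rroots P) N Y" unfolding Y_def[abs_def]
    using P r' nz by (intro int_family_reval[of P \<theta>]) (auto simp: reval_pcompose k(2)[symmetric])
  \<comment> \<open>The scalar \<open>l\<close> need not be integral, but \<open>e\<close> and
    \<open>e * l\<close> are. Scaling one family by \<open>e\<close> and the other by the conjugates
    of \<open>e * l\<close> gives the same family, and both times the product of the scalars is an
    integer.\<close>
  obtain e :: nat where e: "e > 0" "algebraic_int (of_nat e * l)" using algebraic_imp_scaled_algebraic_int[OF l(2)] by blast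
  define em where "em = [:of_nat e:] * m"
  have em: "reval \<theta> em = of_nat e * l" by (simp add: em_def k(3))
  obtain z :: int where z: "(\<Prod>s\<in>rroots P. reval s em) = of_int z"
    using prod_reval_int[OF P, of em] e l(1) em by auto
  have emnz: "reval s em \<noteq> 0" if "s \<in> rroots P" for s
    using reval_eq_iff[OF P(1) that P(2), of em 0] em e l(1) by simp
  have XY: "of_nat e * X s i = reval s em * Y s i" if "s \<in> rroots P" "i \<le> N" for s i
  proof -
    have "reval \<theta> ([:of_nat e:] * pcompose (r i) k) = reval \<theta> (em * pcompose (r' i) k')"
      using eq[OF that(2)] by (simp add: reval.hom_mult reval_pcompose k(1,2)[symmetric] em mult.assoc del: mult_pCons_left)
    hence "reval s ([:of_nat e:] * pcompose (r i) k) = reval s (em * pcompose (r' i) k')"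
      using reval_eq_iff[OF P that(1)] by blast
    thus ?thesis by (simp add: reval.hom_mult X_def Y_def)
  qed
  have "family_height (rroots P) N (\<lambda>s i. of_nat e * X s i) = family_height (rroots P) N X"
    by (rule family_height_scale[OF famX, of "\<lambda>_. of_nat e" "int e ^ card (rroots P)"]) (use e in auto)
  moreover have "family_height (rroots P) N (\<lambda>s i. of_nat e * X s i) = family_height (rroots P) N Y"
    by (rule family_height_scale[OF famY emnz z XY])
  moreover have "family_height (rroots P) N X = family_height (rroots p) N (\<lambda>s i. reval s (r i))"
    unfolding X_def[abs_def] using p int_family_reval[OF p r nz'] k by (intro lift) auto
  moreover have "family_height (rroots P) N Y = family_height (rroots q) N (\<lambda>s i. reval s (r' i))"
    unfolding Y_def[abs_def] using q int_family_reval[OF q r' nz] k by (intro lift) auto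
  ultimately show ?thesis by simp
qed

text \<open>The denominator chosen in \<open>weil_height\<close> and the field used there have no
  influence on the upper bound, so any integral point proportional to \<open>x\<close>, over any
  number field, may be used.\<close>

theorem weil_height_bounds:
  assumes q: "irreducible q" "b \<in> rroots q" and r': "\<And>i. i \<le> N \<Longrightarrow> algebraic_int (reval b (r' i))"
    and l: "l \<noteq> 0" "algebraic l" and x: "proj_pt N x" "\<And>i. i \<le> N \<Longrightarrow> x i = l * reval b (r' i)"
  shows "0 \<le> weil_height N x" "weil_height N x \<le> family_height (rroots q) N (\<lambda>s i. reval s (r' i))"
proof -
  have "\<exists>c::nat. c > 0 \<and> (\<forall>i. algebraic_int (of_nat c * x i))"
  proof -
    obtain c :: nat where c: "c > 0" "\<forall>a\<in>x ` {..N}. algebraic_int (of_nat c * a)"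
      using common_denominator[of "x ` {..N}"] x(1) by (auto simp: proj_pt_def)
    have "algebraic_int (of_nat c * x i)" for i
      using c(2) x(1) by (cases "i \<le> N") (auto simp: proj_pt_def)
    thus ?thesis using c(1) by blast
  qed
  from someI_ex[OF this] obtain c :: nat where c: "c > 0" "\<And>i. algebraic_int (of_nat c * x i)"
    and wh: "weil_height N x = height_int N (\<lambda>i. of_nat c * x i)" unfolding weil_height_def Let_def by blast
  have nzx: "\<exists>i\<le>N. x i \<noteq> 0" using x(1) by (auto simp: proj_pt_def)
  obtain p a r where p: "irreducible p" "a \<in> rroots p" and r: "\<And>i. i \<le> N \<Longrightarrow> of_nat c * x i = reval a (r i)"
    and h: "0 \<le> height_int N (\<lambda>i. of_nat c * x i)"
      "height_int N (\<lambda>i. of_nat c * x i) \<le> family_height (rroots p) N (\<lambda>s i. reval s (r i))"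
    using height_int_bounds[of N "\<lambda>i. of_nat c * x i"] c nzx by auto
  show "0 \<le> weil_height N x" using h wh by simp
  have "algebraic (of_nat c * l)" using l(2) by (intro algebraic_times algebraic_int_imp_algebraic[OF algebraic_int_of_nat])
  moreover have "\<exists>i\<le>N. reval b (r' i) \<noteq> 0" using nzx x(2) by fastforce
  moreover have "algebraic_int (reval a (r i))" if "i \<le> N" for i using c(2)[of i] r[OF that] by simp
  moreover have "reval a (r i) = (of_nat c * l) * reval b (r' i)" if "i \<le> N" for i
    using r[OF that] x(2)[OF that] by (simp add: mult.assoc)
  ultimately have "family_height (rroots p) N (\<lambda>s i. reval s (r i)) = family_height (rroots q) N (\<lambda>s i. reval s (r' i))"
    using c(1) l(1) by (intro family_height_proportional[OF p q _ r']) auto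
  thus "weil_height N x \<le> family_height (rroots q) N (\<lambda>s i. reval s (r' i))" using h wh by simp
qed

lemma mp_eval_scale:
  assumes "p \<in> mp_hom d"
  shows "mp_eval p (\<lambda>i. l * x i) = l ^ d * mp_eval p x"
proof -
  have "mon_eval (\<lambda>i. l * x i) m = l ^ mon_deg m * mon_eval x m" for m
    by (simp add: mon_eval_def mon_deg_def power_mult_distrib prod.distrib power_sum)
  moreover have "mon_deg m = d" if "m \<in> Poly_Mapping.keys p" for m using assms that by (auto simp: mp_hom_def)
  ultimately show ?thesis by (simp add: mp_eval_conv_ins mp_ins_def sum_distrib_left mult_ac cong: sum.cong)
qed

lemma reval_mon_eval: "reval s (mon_eval r m) = mon_eval (\<lambda>i. reval s (r i)) m"
  by (simp add: mon_eval_def reval.hom_prod reval.hom_power)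

text \<open>All iterates are proportional to integral points over the fixed field \<open>\<rat>(a)\<close> obtained by applying the
  minimal representatives with cleared denominators.\<close>
theorem weil_height_blocks:
  assumes di: "degree_independent N S" and P: "P \<in> good_pts N S"
    and T: "finite T" "\<And>ts. ts \<in> T \<Longrightarrow> ts \<noteq> [] \<and> set ts \<subseteq> S"
  shows "\<exists>C\<ge>1. \<forall>tss. set tss \<subseteq> T \<longrightarrow> 0 \<le> weil_height N (list_orbit N (concat tss) P) \<and>
    weil_height N (list_orbit N (concat tss) P) \<le> C * prod_list (map (\<lambda>ts. real (rat_deg N (comp_list N ts))) tss)"
proof -
  have "\<forall>ts\<in>T. \<exists>G. rep_of N (comp_list N ts) (rat_deg N (comp_list N ts)) G"
    using exists_min_rep[OF di P] T(2) by blast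
  then obtain G where G: "\<And>ts. ts \<in> T \<Longrightarrow> rep_of N (comp_list N ts) (rat_deg N (comp_list N ts)) (G ts)" by metis
  define dg where "dg ts = rat_deg N (comp_list N ts)" for ts
  have Gc: "G ts i \<in> mp_carrier (Suc N)" "G ts i \<in> mp_hom (dg ts)" if "ts \<in> T" "i \<le> N" for ts i
    using G[OF that(1)] that(2) by (auto simp: rep_of_def hom_tuple_def hom_poly_iff dg_def)
  \<comment> \<open>All coefficients of the minimal representatives of the blocks; together with the
    coordinates of \<open>P\<close> they generate the field in which the whole orbit is
    followed.\<close>
  define CF where "CF = (\<Union>ts\<in>T. \<Union>i\<in>{..N}. Poly_Mapping.lookup (G ts i) ` Poly_Mapping.keys (G ts i))"
  have CF: "finite CF" "\<And>x. x \<in> CF \<Longrightarrow> algebraic x"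
    using T(1) by (auto simp: CF_def intro: algebraic_lookup Gc(1))
  have pP: "proj_pt N P" using P by (simp add: good_pts_def)
  obtain a where a: "algebraic a" "range (reval a) = gen_field (CF \<union> P ` {..N})"
    using primitive_element[of "CF \<union> P ` {..N}"] CF pP by (auto simp: proj_pt_def)
  obtain p where p: "irreducible p" "a \<in> rroots p" using algebraic_min_rat_poly[OF a(1)] by blast
  have rng: "CF \<union> P ` {..N} \<subseteq> range (reval a)" using a(2) gen_field_subset by metis
  obtain e :: nat where e: "e > 0" "\<forall>x\<in>CF \<union> P ` {..N}. algebraic_int (of_nat e * x)"
    using common_denominator[of "CF \<union> P ` {..N}"] CF pP by (auto simp: proj_pt_def)
  have "\<forall>x\<in>CF \<union> P ` {..N}. \<exists>u. reval a u = of_nat e * x"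
  proof
    fix x assume "x \<in> CF \<union> P ` {..N}"
    then obtain u where "x = reval a u" using rng by blast
    thus "\<exists>u. reval a u = of_nat e * x" by (intro exI[of _ "[:of_nat e:] * u"]) simp
  qed
  then obtain g where g: "\<And>x. x \<in> CF \<union> P ` {..N} \<Longrightarrow> reval a (g x) = of_nat e * x" by metis
  have gint: "algebraic_int (reval a (g x))" if "x \<in> CF \<union> P ` {..N}" for x using g[OF that] e(2) that by simp
  define r0 where "r0 i = g (P i)" for i
  define cf where "cf ts i m = g (Poly_Mapping.lookup (G ts i) m)" for ts i m
  \<comment> \<open>A crude bound for the conjugates of the coefficients of a block. The summand 1
    makes its logarithm nonnegative, so that the sum \<open>C0\<close> dominates each of
    them.\<close>
  define Bt where "Bt ts = 1 + (\<Sum>s\<in>rroots p. \<Sum>i\<le>N. \<Sum>m\<in>Poly_Mapping.keys (G ts i). cmod (reval s (cf ts i m)))" for ts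
  have Bt1: "Bt ts \<ge> 1" for ts unfolding Bt_def by (simp add: sum_nonneg)
  define C0 where "C0 = (\<Sum>ts\<in>T. ln (Bt ts))"
  have lnB: "0 \<le> ln (Bt ts)" for ts using Bt1[of ts] by simp
  have C0: "C0 \<ge> 0" "\<And>ts. ts \<in> T \<Longrightarrow> ln (Bt ts) \<le> C0"
    unfolding C0_def using lnB T(1) by (auto intro: sum_nonneg member_le_sum)
  define hf where "hf r = family_height (rroots p) N (\<lambda>s i. reval s (r i))" for r
  define D where "D tss = prod_list (map (\<lambda>ts. real (dg ts)) tss)" for tss
  \<comment> \<open>Adding \<open>C0\<close> to the height makes the estimate purely multiplicative.
    The coordinates are not divided by common factors on the way; the content takes care of
    those.\<close>
  have inv: "\<exists>r l. l \<noteq> 0 \<and> algebraic l \<and> (\<forall>i\<le>N. algebraic_int (reval a (r i))) \<and>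
      (\<forall>i\<le>N. list_orbit N (concat tss) P i = l * reval a (r i)) \<and> hf r + C0 \<le> (hf r0 + C0) * D tss"
    if "set tss \<subseteq> T" for tss
    using that
  proof (induction tss rule: rev_induct)
    case Nil
    have "algebraic (inverse (of_nat e :: complex))" by (intro algebraic_inverse algebraic_int_imp_algebraic) auto
    moreover have "P i = inverse (of_nat e) * reval a (r0 i)" if "i \<le> N" for i
      using g[of "P i"] that e(1) by (simp add: r0_def)
    moreover have "algebraic_int (reval a (r0 i))" if "i \<le> N" for i using gint that by (auto simp: r0_def)
    ultimately show ?case using e(1) by (intro exI[of _ r0] exI[of _ "inverse (of_nat e)"]) (auto simp: D_def)
  next
    case (snoc ts tss)
    have tsT: "ts \<in> T" using snoc.prems by simp
    define Q where "Q = list_orbit N (concat tss) P"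
    obtain r l where l: "l \<noteq> 0" "algebraic l" and r: "\<And>i. i \<le> N \<Longrightarrow> algebraic_int (reval a (r i))"
      and Qr: "\<And>i. i \<le> N \<Longrightarrow> Q i = l * reval a (r i)" and hr: "hf r + C0 \<le> (hf r0 + C0) * D tss"
      using snoc unfolding Q_def by auto
    have Qg: "Q \<in> good_pts N S" unfolding Q_def using T(2) snoc.prems by (intro good_pts_list_orbit[OF P]) auto
    have Q0: "Q i = 0" if "i > N" for i using Qg that by (auto simp: good_pts_def proj_pt_def)
    define y where "y i = (if i \<le> N then reval a (r i) else 0)" for i
    have Qy: "Q = (\<lambda>i. l * y i)" using Qr Q0 by (auto simp: y_def not_le)
    obtain l' where l': "l' \<noteq> 0" "algebraic l'" "\<And>i. list_orbit N ts Q i = l' * mp_eval (G ts i) Q"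
      using list_orbit_min_rep(1)[OF di Qg _ G[OF tsT]] T(2)[OF tsT] by blast
    have GQ: "\<exists>i\<le>N. mp_eval (G ts i) Q \<noteq> 0"
      using list_orbit_min_rep(2)[OF di Qg _ G[OF tsT]] T(2)[OF tsT] by blast
    define r' where "r' i = (\<Sum>m\<in>Poly_Mapping.keys (G ts i). cf ts i m * mon_eval r m)" for i
    have keys: "mon_deg m = dg ts \<and> Poly_Mapping.keys m \<subseteq> {0..N}" if "i \<le> N" "m \<in> Poly_Mapping.keys (G ts i)" for i m
      using Gc[OF tsT that(1)] that(2) by (auto simp: mp_carrier_def mp_hom_def lessThan_Suc_atMost atLeast0AtMost)
    have cfint: "algebraic_int (reval s (cf ts i m))" if "s \<in> rroots p" "i \<le> N" "m \<in> Poly_Mapping.keys (G ts i)" for s i m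
      unfolding cf_def using that tsT by (intro algebraic_int_conjugate[OF p that(1) gint]) (auto simp: CF_def)
    have r'eq: "reval s (r' i) = (\<Sum>m\<in>Poly_Mapping.keys (G ts i). reval s (cf ts i m) * mon_eval (\<lambda>i. reval s (r i)) m)" for s i
      by (simp add: r'_def reval.hom_sum reval.hom_mult reval_mon_eval)
    have ev: "reval a (r' i) = of_nat e * mp_eval (G ts i) y" if i: "i \<le> N" for i
    proof -
      have "mon_eval (\<lambda>i. reval a (r i)) m = mon_eval y m" if "m \<in> Poly_Mapping.keys (G ts i)" for m
        using keys[OF i that] unfolding mon_eval_def by (intro prod.cong) (auto simp: y_def)
      moreover have "reval a (cf ts i m) = of_nat e * Poly_Mapping.lookup (G ts i) m" if "m \<in> Poly_Mapping.keys (G ts i)" for m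
        unfolding cf_def using that i tsT by (intro g) (auto simp: CF_def)
      ultimately show ?thesis unfolding r'eq mp_eval_conv_ins mp_ins_def
        by (simp add: sum_distrib_left mult.assoc cong: sum.cong)
    qed
    have r'int: "algebraic_int (reval a (r' i))" if i: "i \<le> N" for i
      unfolding r'eq
    proof (intro algebraic_int_sum algebraic_int_times cfint p(2) i)
      fix m assume m: "m \<in> Poly_Mapping.keys (G ts i)"
      show "algebraic_int (mon_eval (\<lambda>i. reval a (r i)) m)"
        unfolding mon_eval_def using keys[OF i m] r by (intro algebraic_int_prod algebraic_int_power) auto
    qed
    \<comment> \<open>Collects the scalar of the block, the previous scalar raised to the degree by
      homogeneity, and the denominator \<open>e\<close> that was cleared from the
      coefficients.\<close>
    define l2 where "l2 = l' * l ^ dg ts * inverse (of_nat e)"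
    have l2: "l2 \<noteq> 0" "algebraic l2"
      using l l' e(1) subring_of_power[OF subring_of_algebraics, of l]
      by (auto simp: l2_def intro!: algebraic_times algebraic_inverse algebraic_int_imp_algebraic[OF algebraic_int_of_nat])
    have evQ: "mp_eval (G ts i) Q = l ^ dg ts * mp_eval (G ts i) y" if "i \<le> N" for i
      unfolding Qy using Gc(2)[OF tsT that] by (rule mp_eval_scale)
    have orb: "list_orbit N (concat (tss @ [ts])) P i = l2 * reval a (r' i)" if "i \<le> N" for i
      using that e(1) by (simp add: list_orbit_append Q_def[symmetric] l'(3) evQ ev l2_def)
    have nzy: "\<exists>i\<le>N. reval a (r i) \<noteq> 0" using Qg Qr by (fastforce simp: good_pts_def proj_pt_def)
    have nzy': "\<exists>i\<le>N. reval a (r' i) \<noteq> 0" using GQ evQ ev e(1) by auto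
    have "hf r' \<le> real (dg ts) * hf r + ln (Bt ts)" unfolding hf_def
    proof (rule family_height_map[OF int_family_reval[OF p r nzy] int_family_reval[OF p r'int nzy']])
      show "finite (Poly_Mapping.keys (G ts i))" for i by simp
      fix s i assume si: "s \<in> rroots p" "i \<le> N"
      show "reval s (r' i) = (\<Sum>m\<in>Poly_Mapping.keys (G ts i). reval s (cf ts i m) * mon_eval (\<lambda>i. reval s (r i)) m)" by (rule r'eq)
      have "(\<Sum>m\<in>Poly_Mapping.keys (G ts i). cmod (reval s (cf ts i m))) \<le>
        (\<Sum>i\<le>N. \<Sum>m\<in>Poly_Mapping.keys (G ts i). cmod (reval s (cf ts i m)))"
        using si by (intro member_le_sum[of i "{..N}"]) (auto intro: sum_nonneg)
      also have "\<dots> \<le> (\<Sum>s\<in>rroots p. \<Sum>i\<le>N. \<Sum>m\<in>Poly_Mapping.keys (G ts i). cmod (reval s (cf ts i m)))"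
        using si finite_rroots[OF p(1)] by (intro member_le_sum[of s "rroots p"]) (auto intro!: sum_nonneg)
      finally show "(\<Sum>m\<in>Poly_Mapping.keys (G ts i). cmod (reval s (cf ts i m))) \<le> Bt ts" by (simp add: Bt_def)
    qed (use keys cfint Bt1 in auto)
    \<comment> \<open>Degree independence enters here: the error \<open>ln (Bt ts)\<close> and the
      added \<open>C0\<close> are together at most \<open>2 * C0\<close>, hence at most the degree
      times \<open>C0\<close>.\<close>
    moreover have "dg ts \<ge> 2" using di T(2)[OF tsT] by (auto simp: degree_independent_def dg_def)
    hence "2 * C0 \<le> real (dg ts) * C0" using C0(1) by (intro mult_right_mono) auto
    ultimately have "hf r' + C0 \<le> real (dg ts) * (hf r + C0)" using C0(2)[OF tsT] by (simp add: distrib_left)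
    also have "\<dots> \<le> real (dg ts) * ((hf r0 + C0) * D tss)" using hr by (intro mult_left_mono) auto
    also have "\<dots> = (hf r0 + C0) * D (tss @ [ts])" by (simp add: D_def mult_ac)
    finally show ?case using l2 r'int orb by blast
  qed
  define C where "C = max 1 (hf r0 + C0)"
  have Dnn: "D tss \<ge> 0" for tss unfolding D_def by (induction tss) auto
  have "0 \<le> weil_height N (list_orbit N (concat tss) P) \<and> weil_height N (list_orbit N (concat tss) P) \<le> C * D tss"
    if tss: "set tss \<subseteq> T" for tss
  proof -
    obtain r l where l: "l \<noteq> 0" "algebraic l" and r: "\<And>i. i \<le> N \<Longrightarrow> algebraic_int (reval a (r i))"
      and Qr: "\<And>i. i \<le> N \<Longrightarrow> list_orbit N (concat tss) P i = l * reval a (r i)" and hr: "hf r + C0 \<le> (hf r0 + C0) * D tss"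
      using inv[OF tss] by auto
    have "list_orbit N (concat tss) P \<in> good_pts N S" using T(2) tss by (intro good_pts_list_orbit[OF P]) auto
    hence "proj_pt N (list_orbit N (concat tss) P)" by (simp add: good_pts_def)
    note w = weil_height_bounds[OF p r l this Qr]
    have "weil_height N (list_orbit N (concat tss) P) \<le> hf r" using w(2) by (simp add: hf_def)
    also have "\<dots> \<le> (hf r0 + C0) * D tss" using hr C0(1) by simp
    also have "\<dots> \<le> C * D tss" using Dnn by (intro mult_right_mono) (auto simp: C_def)
    finally show ?thesis using w(1) by simp
  qed
  thus ?thesis unfolding D_def dg_def by (intro exI[of _ C]) (auto simp: C_def)
qed

section \<open>Block sums and the limsup\<close>

lemma (in product_prob_space) indep_vars_coordinates:
  assumes "I \<noteq> {}"
  shows "prob_space.indep_vars (PiM I M) M (\<lambda>i x. x i) I"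
proof (subst P.indep_vars_iff_distr_eq_PiM'[OF assms])
  show "distr (PiM I M) (PiM I M) (\<lambda>x. \<lambda>i\<in>I. x i) = (\<Pi>\<^sub>M i\<in>I. distr (PiM I M) (M i) (\<lambda>x. x i))"
  proof -
    have "distr (PiM I M) (PiM I M) (\<lambda>x. \<lambda>i\<in>I. x i) = distr (PiM I M) (PiM I M) (\<lambda>x. x)"
      by (intro distr_cong) (auto simp: space_PiM)
    also have "\<dots> = PiM I M" by (rule distr_id)
    also have "\<dots> = (\<Pi>\<^sub>M i\<in>I. distr (PiM I M) (M i) (\<lambda>x. x i))"
      by (intro PiM_cong) (auto simp: PiM_component)
    finally show ?thesis .
  qed
qed auto

definition block_sum :: "nat \<Rightarrow> 'a set \<Rightarrow> ('a list \<Rightarrow> real) \<Rightarrow> nat \<Rightarrow> (nat \<Rightarrow> 'a) \<Rightarrow> real" where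
  "block_sum m S L j \<gamma> = (\<Sum>ts\<in>{ts. set ts \<subseteq> S \<and> length ts = m}. L ts * (\<Prod>i<m. indicator {ts ! i} (\<gamma> (j * m + i))))"

text \<open>On a sequence that stays in \<open>S\<close> exactly one summand survives.\<close>

lemma block_sum_eq:
  assumes "finite S" "range \<gamma> \<subseteq> S"
  shows "block_sum m S L j \<gamma> = L (map \<gamma> [j * m..<j * m + m])"
proof -
  let ?ts0 = "map \<gamma> [j * m..<j * m + m]"
  have "(\<Prod>i<m. indicator {ts ! i} (\<gamma> (j * m + i)) :: real) = (if ts = ?ts0 then 1 else 0)" if len: "length ts = m" for ts
  proof (cases "ts = ?ts0")
    case False
    then obtain i where "i < m" "ts ! i \<noteq> \<gamma> (j * m + i)" using len by (auto simp: list_eq_iff_nth_eq)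
    hence "(\<Prod>i<m. indicator {ts ! i} (\<gamma> (j * m + i)) :: real) = 0"
      by (intro prod_zero bexI[of _ i]) auto
    thus ?thesis using False by simp
  qed simp
  hence "block_sum m S L j \<gamma> = (\<Sum>ts\<in>{ts. set ts \<subseteq> S \<and> length ts = m}. if ts = ?ts0 then L ?ts0 else 0)"
    unfolding block_sum_def by (intro sum.cong) auto
  also have "\<dots> = L ?ts0"
    using assms finite_lists_length_eq[OF assms(1), of m] by (subst sum.delta) auto
  finally show ?thesis .
qed

text \<open>Hoeffding's inequality and Borel-Cantelli.  Writing a block variable as a finite sum of products of indicators
  makes it measurable although the discrete space is uncountable.\<close>
lemma AE_block_sums_le:
  fixes \<nu> :: "'a pmf" and L :: "'a list \<Rightarrow> real"
  assumes S: "finite S" and m: "m > 0" and L: "\<And>ts. set ts \<subseteq> S \<Longrightarrow> L ts \<ge> 0" and \<epsilon>: "\<epsilon> > 0"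
  shows "AE \<gamma> in (\<Pi>\<^sub>M i\<in>(UNIV::nat set). measure_pmf \<nu>). eventually (\<lambda>k.
    (\<Sum>j<k. block_sum m S L j \<gamma>) \<le>
     real k * ((\<Sum>ts\<in>{ts. set ts \<subseteq> S \<and> length ts = m}. (\<Prod>i<m. pmf \<nu> (ts ! i)) * L ts) + \<epsilon>)) sequentially"
proof -
  interpret product_prob_space "\<lambda>_::nat. measure_pmf \<nu>" UNIV
    by unfold_locales
  define T where "T = {ts. set ts \<subseteq> S \<and> length ts = m}"
  have finT: "finite T" unfolding T_def by (rule finite_lists_length_eq[OF S])
  define \<mu> where "\<mu> = (\<Sum>ts\<in>T. (\<Prod>i<m. pmf \<nu> (ts ! i)) * L ts)"
  define X where "X = block_sum m S L"
  \<comment> \<open>The added 1 keeps the range of the variables a nondegenerate interval, since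
    Hoeffding's exponent divides by the square of \<open>B\<close>.\<close>
  define B where "B = (\<Sum>ts\<in>T. L ts) + 1"
  have LT: "L ts \<ge> 0" if "ts \<in> T" for ts using L that by (auto simp: T_def)
  have B: "B > 0" unfolding B_def using sum_nonneg[of T L] LT by force
  define Y where "Y j \<gamma> = (\<Sum>ts\<in>T. L ts * (\<Prod>i<m. indicator {ts ! i} (\<gamma> (j * m + i))))" for j and \<gamma> :: "nat \<Rightarrow> 'a"
  have XY: "X = Y" by (simp add: X_def block_sum_def Y_def T_def fun_eq_iff)
  have meas: "Y j \<in> borel_measurable (PiM K (\<lambda>_. measure_pmf \<nu>))" if "{j * m..<j * m + m} \<subseteq> K" for j K
  proof -
    have "(\<lambda>\<gamma>. indicator {t} (\<gamma> (j * m + i)) :: real) \<in> borel_measurable (PiM K (\<lambda>_. measure_pmf \<nu>))" if "i < m" for t i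
    proof (rule measurable_compose[OF measurable_component_singleton])
      show "j * m + i \<in> K" using that \<open>{j * m..<j * m + m} \<subseteq> K\<close> by auto
      show "indicator {t} \<in> borel_measurable (measure_pmf \<nu>)" by simp
    qed
    thus ?thesis unfolding Y_def by (intro borel_measurable_sum borel_measurable_times borel_measurable_prod) auto
  qed
  have ind: "P.indep_vars (\<lambda>_. borel) X UNIV"
  proof -
    define K where "K j = {j * m..<j * m + m}" for j
    have disj: "disjoint_family_on K UNIV"
    proof (unfold disjoint_family_on_def, intro ballI impI)
      fix i j :: nat assume "i \<noteq> j"
      have "x div m = i" if "x \<in> K i" for x i using that m
        by (auto simp: K_def div_nat_eqI mult.commute)
      thus "K i \<inter> K j = {}" using \<open>i \<noteq> j\<close> by blast
    qed
    \<comment> \<open>Blocks use disjoint sets of coordinates, so independence of the coordinates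
      passes to the blocks.\<close>
    have "P.indep_vars (\<lambda>j. PiM (K j) (\<lambda>_. measure_pmf \<nu>)) (\<lambda>j \<omega>. restrict (\<lambda>i. \<omega> i) (K j)) UNIV"
      by (rule P.indep_vars_restrict[OF indep_vars_coordinates _ disj]) auto
    hence "P.indep_vars (\<lambda>_. borel) (\<lambda>j \<omega>. Y j (restrict (\<lambda>i. \<omega> i) (K j))) UNIV"
      by (rule P.indep_vars_compose2) (auto intro!: meas simp: K_def)
    moreover have "Y j (restrict (\<lambda>i. \<omega> i) (K j)) = X j \<omega>" for j \<omega>
      unfolding XY Y_def by (intro sum.cong arg_cong2[of _ _ _ _ "(*)"] prod.cong) (auto simp: K_def)
    ultimately show ?thesis by simp
  qed
  have bnd: "X j \<gamma> \<in> {0..B}" for j \<gamma>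
  proof -
    have p: "0 \<le> (\<Prod>i<m. indicator {ts ! i} (\<gamma> (j * m + i)) :: real)" "(\<Prod>i<m. indicator {ts ! i} (\<gamma> (j * m + i)) :: real) \<le> 1" for ts
      by (auto intro!: prod_nonneg prod_le_1 simp: indicator_def)
    have "0 \<le> Y j \<gamma>" unfolding Y_def using LT p by (intro sum_nonneg mult_nonneg_nonneg) auto
    moreover have "Y j \<gamma> \<le> (\<Sum>ts\<in>T. L ts)" unfolding Y_def using LT p
      by (intro sum_mono mult_left_le) auto
    ultimately show ?thesis by (simp add: XY B_def)
  qed
  have EX: "P.expectation (X j) = \<mu>" for j
  proof -
    have e: "(\<integral>\<gamma>. (\<Prod>i<m. indicator {ts ! i} (\<gamma> (j * m + i)) :: real) \<partial>PiM UNIV (\<lambda>_. measure_pmf \<nu>)) = (\<Prod>i<m. pmf \<nu> (ts ! i))"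
      and int: "integrable (PiM UNIV (\<lambda>_. measure_pmf \<nu>)) (\<lambda>\<gamma>. (\<Prod>i<m. indicator {ts ! i} (\<gamma> (j * m + i)) :: real))" for ts
    proof -
      let ?J = "(\<lambda>i. j * m + i) ` {..<m}"
      let ?A = "{\<gamma>\<in>space (PiM UNIV (\<lambda>_. measure_pmf \<nu>)). \<forall>l\<in>?J. \<gamma> l \<in> {ts ! (l - j * m)}}"
      have "{\<gamma>\<in>space (PiM UNIV (\<lambda>_. measure_pmf \<nu>)). \<gamma> l \<in> {t}} \<in> sets (PiM UNIV (\<lambda>_. measure_pmf \<nu>))" for l :: nat and t
        using measurable_sets[OF measurable_component_singleton[of l UNIV "\<lambda>_. measure_pmf \<nu>"], of "{t}"]
        by (simp add: vimage_def Int_def conj_commute)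
      hence As: "?A \<in> sets (PiM UNIV (\<lambda>_. measure_pmf \<nu>))" by (intro sets.sets_Collect_finite_All) auto
      have eq: "(\<lambda>\<gamma>. (\<Prod>i<m. indicator {ts ! i} (\<gamma> (j * m + i)) :: real)) = indicator ?A"
      proof
        fix \<gamma> :: "nat \<Rightarrow> 'a"
        show "(\<Prod>i<m. indicator {ts ! i} (\<gamma> (j * m + i)) :: real) = indicator ?A \<gamma>"
          by (cases "\<forall>i<m. \<gamma> (j * m + i) = ts ! i") (auto simp: indicator_def prod_zero_iff space_PiM)
      qed
      have "emeasure (PiM UNIV (\<lambda>_. measure_pmf \<nu>)) ?A = (\<Prod>l\<in>?J. emeasure (measure_pmf \<nu>) {ts ! (l - j * m)})"
        by (rule emeasure_PiM_Collect) auto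
      also have "\<dots> = (\<Prod>i<m. emeasure (measure_pmf \<nu>) {ts ! i})"
        by (subst prod.reindex) (auto simp: inj_on_def)
      also have "\<dots> = ennreal (\<Prod>i<m. pmf \<nu> (ts ! i))"
        by (simp add: emeasure_pmf_single prod_ennreal)
      finally have "P.prob ?A = (\<Prod>i<m. pmf \<nu> (ts ! i))" by (simp add: measure_def prod_nonneg)
      thus "(\<integral>\<gamma>. (\<Prod>i<m. indicator {ts ! i} (\<gamma> (j * m + i)) :: real) \<partial>PiM UNIV (\<lambda>_. measure_pmf \<nu>)) = (\<Prod>i<m. pmf \<nu> (ts ! i))"
        unfolding eq using As by simp
      show "integrable (PiM UNIV (\<lambda>_. measure_pmf \<nu>)) (\<lambda>\<gamma>. (\<Prod>i<m. indicator {ts ! i} (\<gamma> (j * m + i)) :: real))"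
        unfolding eq using As by (simp add: P.emeasure_finite less_top[symmetric])
    qed
    show ?thesis unfolding XY Y_def \<mu>_def using int by (simp add: e mult.commute)
  qed
  define A where "A k = {\<gamma>\<in>space (PiM UNIV (\<lambda>_. measure_pmf \<nu>)). real k * \<mu> + real k * \<epsilon> \<le> (\<Sum>j<k. X j \<gamma>)}" for k
  have Xm: "X j \<in> borel_measurable (PiM UNIV (\<lambda>_. measure_pmf \<nu>))" for j unfolding XY by (rule meas) simp
  have Ameas: "A k \<in> sets (PiM UNIV (\<lambda>_. measure_pmf \<nu>))" for k
    unfolding A_def using Xm by measurable
  \<comment> \<open>For \<open>k\<close> variables in the interval from 0 to \<open>B\<close> and a
    deviation of \<open>k * \<epsilon>\<close>, Hoeffding's bound is the \<open>k\<close>-th power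
    of this number below 1, hence summable.\<close>
  define q where "q = exp (-2 * \<epsilon>\<^sup>2 / B\<^sup>2)"
  have Aprob: "P.prob (A k) \<le> q ^ k" for k
  proof (cases "k = 0")
    case False
    interpret H: Hoeffding_ineq "PiM UNIV (\<lambda>_. measure_pmf \<nu>)" "{..<k}" X "\<lambda>_. 0" "\<lambda>_. B" "real k * \<mu>"
      using P.indep_vars_subset[OF ind, of "{..<k}"] bnd by unfold_locales (auto simp: EX)
    have "P.prob (A k) \<le> exp (-2 * (real k * \<epsilon>)\<^sup>2 / (\<Sum>i<k. (B - 0)\<^sup>2))"
      unfolding A_def using False \<epsilon> B by (intro H.Hoeffding_ineq_ge) auto
    also have "-2 * (real k * \<epsilon>)\<^sup>2 / (\<Sum>i<k. (B - 0)\<^sup>2) = real k * (-2 * \<epsilon>\<^sup>2 / B\<^sup>2)"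
      using False B by (simp add: field_simps power2_eq_square)
    also have "exp \<dots> = q ^ k" unfolding q_def by (rule exp_of_nat_mult)
    finally show ?thesis .
  qed simp
  have "summable (\<lambda>k. q ^ k)" using \<epsilon> B by (intro summable_geometric) (simp add: q_def)
  hence "summable (\<lambda>k. P.prob (A k))" by (rule summable_comparison_test'[of _ 0]) (use Aprob in auto)
  hence "AE \<gamma> in PiM UNIV (\<lambda>_. measure_pmf \<nu>). eventually (\<lambda>k. \<gamma> \<in> space (PiM UNIV (\<lambda>_. measure_pmf \<nu>)) - A k) sequentially"
    by (intro borel_cantelli_AE1 Ameas) (auto simp: less_top[symmetric])
  thus ?thesis
  proof (rule AE_mp, intro AE_I2 impI)
    fix \<gamma> assume "eventually (\<lambda>k. \<gamma> \<in> space (PiM UNIV (\<lambda>_. measure_pmf \<nu>)) - A k) sequentially"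
    thus "eventually (\<lambda>k. (\<Sum>j<k. block_sum m S L j \<gamma>) \<le>
       real k * ((\<Sum>ts\<in>{ts. set ts \<subseteq> S \<and> length ts = m}. (\<Prod>i<m. pmf \<nu> (ts ! i)) * L ts) + \<epsilon>)) sequentially"
      by eventually_elim (auto simp: A_def X_def \<mu>_def T_def distrib_left)
  qed
qed

text \<open>The constant \<open>A\<close> is lost in the limit because its \<open>n\<close>-th root
  tends to 1.\<close>

lemma limsup_powr_inverse_le:
  assumes f: "\<And>n. f n \<ge> 0" and A: "A \<ge> 1" and le: "eventually (\<lambda>n. f n \<le> A * exp (real n * c)) sequentially"
  shows "limsup (\<lambda>n. ereal (f n powr (1 / real n))) \<le> ereal (exp c)"
proof -
  have "eventually (\<lambda>n. ereal (f n powr (1 / real n)) \<le> ereal (A powr (1 / real n) * exp c)) sequentially"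
    using le eventually_gt_at_top[of 0]
  proof eventually_elim
    case (elim n)
    have "f n powr (1 / real n) \<le> (A * exp (real n * c)) powr (1 / real n)"
      using f elim by (intro powr_mono2) auto
    also have "\<dots> = A powr (1 / real n) * exp c"
      using A elim by (simp add: powr_def ln_mult add_divide_distrib exp_add)
    finally show ?case by simp
  qed
  hence "limsup (\<lambda>n. ereal (f n powr (1 / real n))) \<le> limsup (\<lambda>n. ereal (A powr (1 / real n) * exp c))"
    by (rule Limsup_mono)
  also have "(\<lambda>n. A powr (1 / real n) * exp c) \<longlonglongrightarrow> A powr 0 * exp c"
    using A by (intro tendsto_intros lim_1_over_n) auto
  hence "(\<lambda>n. ereal (A powr (1 / real n) * exp c)) \<longlonglongrightarrow> ereal (exp c)"
    using A by (simp add: powr_zero_eq_one)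
  hence "limsup (\<lambda>n. ereal (A powr (1 / real n) * exp c)) = ereal (exp c)" by (intro lim_imp_Limsup) auto
  finally show ?thesis .
qed

lemma concat_blocks: "concat (map (\<lambda>j. map \<gamma> [j * m..<j * m + m]) [0..<k]) = map \<gamma> [0..<k * m]"
proof (induction k)
  case (Suc k)
  have "[0..<Suc k * m] = [0..<k * m] @ [k * m..<k * m + m]" by (metis add.commute mult_Suc upt_add_eq_append zero_le)
  thus ?case using Suc by simp
qed simp

text \<open>The first \<open>n\<close> maps are cut into \<open>n div m\<close> full blocks and a
  shorter rest. The rest is why \<open>T\<close> also contains lists shorter than \<open>m\<close>;
  it contributes a factor of at most \<open>B\<close>, which disappears in the limit.\<close>

lemma limsup_weil_height_le:
  assumes S: "finite S" and di: "degree_independent N S" and P: "P \<in> good_pts N S" and m: "m > 0"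
    and \<gamma>: "range \<gamma> \<subseteq> S" and c: "c \<ge> 0"
    and ev: "eventually (\<lambda>k. (\<Sum>j<k. ln (real (rat_deg N (comp_list N (map \<gamma> [j * m..<j * m + m]))))) \<le> real k * c) sequentially"
  shows "limsup (\<lambda>n. ereal (weil_height N (orbit N \<gamma> P n) powr (1 / real n))) \<le> ereal (exp (c / real m))"
proof -
  define T where "T = {ts. ts \<noteq> [] \<and> set ts \<subseteq> S \<and> length ts \<le> m}"
  have "finite T" unfolding T_def by (rule finite_subset[OF _ finite_lists_length_le[OF S, of m]]) auto
  define D where "D ts = real (rat_deg N (comp_list N ts))" for ts
  from weil_height_blocks[OF di P \<open>finite T\<close>] obtain C where C: "C \<ge> 1"
    "\<And>tss. set tss \<subseteq> T \<Longrightarrow> 0 \<le> weil_height N (list_orbit N (concat tss) P)"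
    "\<And>tss. set tss \<subseteq> T \<Longrightarrow> weil_height N (list_orbit N (concat tss) P) \<le> C * prod_list (map D tss)"
    unfolding D_def by (auto simp: T_def)
  have D2: "D ts \<ge> 2" if "ts \<noteq> []" "set ts \<subseteq> S" for ts
    using di that by (auto simp: D_def degree_independent_def)
  define B where "B = 1 + (\<Sum>ts\<in>T. D ts)"
  have B: "B \<ge> 1" "\<And>ts. ts \<in> T \<Longrightarrow> D ts \<le> B"
  proof -
    show "B \<ge> 1" unfolding B_def D_def by (simp add: sum_nonneg)
    fix ts assume "ts \<in> T"
    hence "D ts \<le> (\<Sum>ts\<in>T. D ts)" using \<open>finite T\<close> by (intro member_le_sum) (auto simp: D_def)
    thus "D ts \<le> B" by (simp add: B_def)
  qed
  define tss where "tss n = map (\<lambda>j. map \<gamma> [j * m..<j * m + m]) [0..<n div m] @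
     (if n mod m = 0 then [] else [map \<gamma> [n div m * m..<n]])" for n
  have cc: "concat (tss n) = map \<gamma> [0..<n]" for n
  proof -
    have "[0..<n] = [0..<n div m * m] @ [n div m * m..<n]"
      by (metis div_times_less_eq_dividend le_add_diff_inverse upt_add_eq_append zero_le)
    moreover have "[n div m * m..<n] = []" if "n mod m = 0" using that by auto
    ultimately show ?thesis by (simp add: tss_def concat_blocks)
  qed
  have tT: "set (tss n) \<subseteq> T" for n
  proof -
    have "map \<gamma> [j * m..<j * m + m] \<in> T" for j using m \<gamma> by (auto simp: T_def)
    moreover have "map \<gamma> [n div m * m..<n] \<in> T" if "n mod m \<noteq> 0"
    proof -
      have "n - n div m * m = n mod m" by (simp add: minus_div_mult_eq_mod)
      thus ?thesis using that \<gamma> m by (auto simp: T_def less_imp_le)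
    qed
    ultimately show ?thesis by (auto simp: tss_def)
  qed
  have orb: "orbit N \<gamma> P n = list_orbit N (concat (tss n)) P" for n by (simp add: cc orbit_conv_list_orbit)
  define A where "A = C * B"
  have "eventually (\<lambda>n. weil_height N (orbit N \<gamma> P n) \<le> A * exp (real n * (c / real m))) sequentially"
  proof -
    have "filterlim (\<lambda>n. n div m) at_top sequentially"
      unfolding filterlim_at_top
    proof
      fix Z show "eventually (\<lambda>n. Z \<le> n div m) sequentially"
        using eventually_ge_at_top[of "Z * m"] by eventually_elim (use m in \<open>simp add: less_eq_div_iff_mult_less_eq\<close>)
    qed
    from eventually_compose_filterlim[OF ev this]
    show ?thesis
    proof eventually_elim
      case (elim n)
      define k where "k = n div m"
      have pos: "D (map \<gamma> [j * m..<j * m + m]) > 0" for j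
        using D2[of "map \<gamma> [j * m..<j * m + m]"] m \<gamma> by fastforce
      have pl: "prod_list (map f [0..<k]) = (\<Prod>j<k. f j)" for f :: "nat \<Rightarrow> real"
        by (induction k) (auto simp: mult.commute)
      have "prod_list (map D (tss n)) = (\<Prod>j<k. D (map \<gamma> [j * m..<j * m + m])) * (if n mod m = 0 then 1 else D (map \<gamma> [n div m * m..<n]))"
        using pl[of "\<lambda>j. D (map \<gamma> [j * m..<j * m + m])"] by (simp add: tss_def k_def comp_def)
      also have "\<dots> \<le> (\<Prod>j<k. D (map \<gamma> [j * m..<j * m + m])) * B"
        using B tT[of n] pos by (intro mult_left_mono prod_nonneg) (auto simp: tss_def less_imp_le)
      also have "(\<Prod>j<k. D (map \<gamma> [j * m..<j * m + m])) = exp (\<Sum>j<k. ln (D (map \<gamma> [j * m..<j * m + m])))"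
        using pos by (simp add: exp_sum)
      also have "\<dots> * B \<le> exp (real n * (c / real m)) * B"
      proof (intro mult_right_mono)
        have "(\<Sum>j<k. ln (D (map \<gamma> [j * m..<j * m + m]))) \<le> real k * c" using elim by (simp add: k_def D_def)
        \<comment> \<open>Passing from the number of blocks to \<open>n / m\<close> only enlarges
          the exponent because \<open>c\<close> is nonnegative.\<close>
        also have "real k \<le> real n / real m" 
        proof -
          have "real (k * m) \<le> real n" unfolding k_def by (simp only: of_nat_le_iff div_times_less_eq_dividend)
          thus ?thesis using m by (simp add: pos_le_divide_eq)
        qed
        hence "real k * c \<le> real n / real m * c" using c by (rule mult_right_mono)
        finally show "exp (\<Sum>j<k. ln (D (map \<gamma> [j * m..<j * m + m]))) \<le> exp (real n * (c / real m))" by simp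
      qed (use B in auto)
      finally have "C * prod_list (map D (tss n)) \<le> C * (exp (real n * (c / real m)) * B)"
        using C(1) by (intro mult_left_mono) auto
      thus ?case using C(3)[OF tT[of n]] by (simp add: orb A_def mult_ac)
    qed
  qed
  moreover have "A \<ge> 1" unfolding A_def using C(1) B(1) mult_mono[of 1 C 1 B] by simp
  moreover have "0 \<le> weil_height N (orbit N \<gamma> P n)" for n unfolding orb by (rule C(2)[OF tT])
  ultimately show ?thesis by (intro limsup_powr_inverse_le)
qed

theorem theorem1p3:
  fixes N :: nat and S :: "(nat \<Rightarrow> mpoly) set" and \<nu> :: "(nat \<Rightarrow> mpoly) pmf"
  assumes "finite S"
    and "\<forall>\<phi>\<in>S. rat_map N \<phi> \<and> dominant N \<phi>"
    and "degree_independent N S"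
    and "set_pmf \<nu> \<subseteq> S"
    and "P \<in> good_pts N S"
  shows "AE \<gamma> in (\<Pi>\<^sub>M i\<in>(UNIV::nat set). measure_pmf \<nu>).
           limsup (\<lambda>n. ereal (weil_height N (orbit N \<gamma> P n) powr (1 / real n)))
             \<le> ereal (dyn_degree N S \<nu>)"
proof -
  define L where "L ts = ln (real (rat_deg N (comp_list N ts)))" for ts
  have L: "L ts \<ge> 0" for ts unfolding L_def by (cases "rat_deg N (comp_list N ts)") auto
  define \<mu> where "\<mu> m = exp_log_deg N S \<nu> m" for m
  have \<mu>: "\<mu> m = (\<Sum>ts\<in>{ts. set ts \<subseteq> S \<and> length ts = m}. (\<Prod>i<m. pmf \<nu> (ts ! i)) * L ts)" for m
    by (simp add: \<mu>_def exp_log_deg_def L_def)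
  have \<mu>0: "\<mu> m \<ge> 0" for m unfolding \<mu> using L by (auto intro!: sum_nonneg mult_nonneg_nonneg prod_nonneg)
  interpret product_prob_space "\<lambda>_::nat. measure_pmf \<nu>" UNIV by unfold_locales
  have "AE \<gamma> in (\<Pi>\<^sub>M i\<in>(UNIV::nat set). measure_pmf \<nu>). \<gamma> i \<in> S" for i
    using assms(4) by (intro AE_component) (auto simp: AE_measure_pmf_iff)
  hence "AE \<gamma> in (\<Pi>\<^sub>M i\<in>(UNIV::nat set). measure_pmf \<nu>). \<forall>i. \<gamma> i \<in> S" by (subst AE_all_countable) auto
  \<comment> \<open>One exceptional null set for all block lengths and all tolerances: both range
    over countable sets, with \<open>Suc\<close> excluding the value 0.\<close>
  moreover have "AE \<gamma> in (\<Pi>\<^sub>M i\<in>(UNIV::nat set). measure_pmf \<nu>). \<forall>m q. eventually (\<lambda>k.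
      (\<Sum>j<k. block_sum (Suc m) S L j \<gamma>) \<le> real k * (\<mu> (Suc m) + 1 / real (Suc q))) sequentially"
    unfolding AE_all_countable \<mu> using L by (intro allI AE_block_sums_le assms(1)) auto
  ultimately show ?thesis
  proof eventually_elim
    case (elim \<gamma>)
    define l where "l = limsup (\<lambda>n. ereal (weil_height N (orbit N \<gamma> P n) powr (1 / real n)))"
    have rng: "range \<gamma> \<subseteq> S" using elim by auto
    have le: "l \<le> ereal (exp ((\<mu> (Suc m) + 1 / real (Suc q)) / real (Suc m)))" for m q
      unfolding l_def
    proof (rule limsup_weil_height_le[OF assms(1,3,5) _ rng])
      show "eventually (\<lambda>k. (\<Sum>j<k. ln (real (rat_deg N (comp_list N (map \<gamma> [j * Suc m..<j * Suc m + Suc m]))))) \<le>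
        real k * (\<mu> (Suc m) + 1 / real (Suc q))) sequentially"
        using elim by (simp add: block_sum_eq[OF assms(1) rng] L_def)
    qed (use \<mu>0 in auto)
    have "l \<le> ereal (dyn_degree N S \<nu>)"
    \<comment> \<open>The estimate with \<open>m\<close> and \<open>q\<close> equal to 0 excludes
      the value infinity. For a finite limsup logarithms are taken if it is positive; otherwise the
      exponential on the right is larger anyway.\<close>
    proof (cases l)
      case (real x)
      show ?thesis
      proof (cases "x > 0")
        case True
        have lx: "ln x \<le> (\<mu> (Suc m) + 1 / real (Suc q)) / real (Suc m)" for m q
          using le[of m q] True by (simp only: real ereal_less_eq(3)) (metis exp_le_cancel_iff exp_ln)
        have "ln x \<le> \<mu> (Suc m) / real (Suc m)" for m
        proof (rule LIMSEQ_le_const)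
          have "(\<lambda>q. (\<mu> (Suc m) + 1 / real (Suc q)) / real (Suc m)) \<longlonglongrightarrow> (\<mu> (Suc m) + 0) / real (Suc m)"
            by (intro tendsto_intros LIMSEQ_Suc[OF lim_1_over_n]) auto
          thus "(\<lambda>q. (\<mu> (Suc m) + 1 / real (Suc q)) / real (Suc m)) \<longlonglongrightarrow> \<mu> (Suc m) / real (Suc m)" by simp
        qed (use lx in auto)
        hence "ln x \<le> \<mu> m / real m" if "m \<in> {1..}" for m using that by (cases m) auto
        hence "ln x \<le> (INF m\<in>{1..}. \<mu> m / real m)" by (intro cINF_greatest) auto
        hence "exp (ln x) \<le> exp (INF m\<in>{1..}. \<mu> m / real m)" by simp
        thus ?thesis using True by (simp add: real dyn_degree_def \<mu>_def)
      next
        case False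
        have "x \<le> dyn_degree N S \<nu>" using False by (auto simp: dyn_degree_def intro: order_trans[of _ 0])
        thus ?thesis by (simp add: real)
      qed
    qed (use le[of 0 0] in auto)
    thus ?case by (simp add: l_def)
  qed
qed

end
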